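(* Let $H$ be a Hilbert space, let $A$ be a weak* closed subalgebra of $M = B(H)$ containing the unit of $M$, and let $D$ be a weak* closed selfadjoint subalgebra of $A$ containing the unit of $M$. Suppose that $\Phi : A \to D$ is a weak* continuous unital homomorphism that is a $D$-bimodule map, i.e. $\Phi(d_1 a d_2) = d_1\Phi(a)d_2$ for all $a \in A$, $d_1, d_2 \in D$. Suppose that there exists a normal positive linear map $\Psi : M \to D$ extending $\Phi$. Then $D$ is an atomic von Neumann algebra.
   Context: Homomorphism means (complex) linear and multiplicative map. The algebra $A$ is not assumed selfadjoint. Normal means weak* continuous. A von Neumann algebra $D$ is atomic (purely atomic) if it is isomorphic to an $\ell^\infty$-direct sum $\oplus_{i \in I} B(H_i)$ for Hilbert spaces $H_i$; equivalently every nonzero projection in $D$ dominates a minimal nonzero projection. *)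

theory Defs
  imports "HOL-Analysis.Analysis"
begin

text \<open>
  Complex Hilbert spaces of arbitrary (also finite or zero) dimension. The inner product is linear
  in its first argument, and its real part is the inner product of the underlying real Hilbert
  space, so that norm, topology and bounded operators are those of the library.
\<close>

class complex_hilbert_space = real_inner + banach +
  fixes scaleC :: "complex \<Rightarrow> 'a \<Rightarrow> 'a" (infixr "*\<^sub>C" 75)
    and cinner :: "'a \<Rightarrow> 'a \<Rightarrow> complex"
  assumes scaleC_add_right: "c *\<^sub>C (x + y) = c *\<^sub>C x + c *\<^sub>C y"
    and scaleC_add_left: "(b + c) *\<^sub>C x = b *\<^sub>C x + c *\<^sub>C x"
    and scaleC_scaleC: "b *\<^sub>C c *\<^sub>C x = (b * c) *\<^sub>C x"
    and scaleR_scaleC: "r *\<^sub>R x = complex_of_real r *\<^sub>C x"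
    and cinner_commute: "cinner x y = cnj (cinner y x)"
    and cinner_add_left: "cinner (x + y) z = cinner x z + cinner y z"
    and cinner_scaleC_left: "cinner (c *\<^sub>C x) y = c * cinner x y"
    and Re_cinner: "Re (cinner x y) = inner x y"

instantiation complex :: complex_hilbert_space
begin
definition "scaleC_complex (c::complex) (x::complex) = c * x"
definition "cinner_complex (x::complex) y = x * cnj y"
instance
  by standard
    (auto simp: scaleC_complex_def cinner_complex_def algebra_simps scaleR_conv_of_real inner_complex_def)
end

lemma cinner_self: "cinner x x = complex_of_real ((norm x)\<^sup>2)"
proof (rule complex_eqI)
  show "Re (cinner x x) = Re (complex_of_real ((norm x)\<^sup>2))"
    by (simp add: Re_cinner power2_norm_eq_inner)
  have "Im (cinner x x) = - Im (cinner x x)"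
    by (metis cinner_commute cnj.simps(2))
  then show "Im (cinner x x) = Im (complex_of_real ((norm x)\<^sup>2))"
    by simp
qed

lemma norm_scaleC: "norm (c *\<^sub>C x) = cmod c * norm (x :: 'a::complex_hilbert_space)"
proof -
  have "cinner (c *\<^sub>C x) (c *\<^sub>C x) = c * cnj c * cinner x x"
    by (metis cinner_commute cinner_scaleC_left complex_cnj_mult mult.assoc)
  then have "complex_of_real ((norm (c *\<^sub>C x))\<^sup>2) = complex_of_real ((cmod c * norm x)\<^sup>2)"
    unfolding cinner_self by (simp add: complex_norm_square [symmetric] power_mult_distrib)
  then have "(norm (c *\<^sub>C x))\<^sup>2 = (cmod c * norm x)\<^sup>2"
    using of_real_eq_iff by blast
  then show ?thesis
    by (simp add: power2_eq_iff_nonneg)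
qed

lemma bounded_linear_scaleC: "bounded_linear ((*\<^sub>C) c :: 'a::complex_hilbert_space \<Rightarrow> 'a)"
  by (rule bounded_linear_intro[where K = "cmod c"])
    (simp_all add: scaleC_add_right scaleR_scaleC scaleC_scaleC norm_scaleC mult.commute)


subsection \<open>Bounded operators\<close>

text \<open>
  The library type \<open>'h \<Rightarrow>\<^sub>L 'h\<close> consists of the bounded real-linear operators; \<open>B(H)\<close> is its subset
  of complex-linear ones. Sums, norm, product \<open>o\<^sub>L\<close> and unit \<open>id_blinfun\<close> are the library's.
\<close>

definition bounded_operators :: "('h::complex_hilbert_space \<Rightarrow>\<^sub>L 'h) set" where
  "bounded_operators = {T. \<forall>c x. blinfun_apply T (c *\<^sub>C x) = c *\<^sub>C blinfun_apply T x}"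

lift_definition scale_op ::
  "complex \<Rightarrow> ('h::complex_hilbert_space \<Rightarrow>\<^sub>L 'h) \<Rightarrow> ('h \<Rightarrow>\<^sub>L 'h)" (infixr "\<cdot>\<^sub>C" 75)
  is "\<lambda>c T x. c *\<^sub>C T x"
  by (rule bounded_linear_compose[OF bounded_linear_scaleC])

definition adj_op :: "('h::complex_hilbert_space \<Rightarrow>\<^sub>L 'h) \<Rightarrow> ('h \<Rightarrow>\<^sub>L 'h)" where
  "adj_op T = (THE S. S \<in> bounded_operators \<and>
     (\<forall>x y. cinner (blinfun_apply T x) y = cinner x (blinfun_apply S y)))"

definition positive_op :: "('h::complex_hilbert_space \<Rightarrow>\<^sub>L 'h) \<Rightarrow> bool" where
  "positive_op T \<longleftrightarrow> T \<in> bounded_operators \<and> (\<forall>x. cinner (blinfun_apply T x) x \<in> \<real>\<^sub>\<ge>\<^sub>0)"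


subsection \<open>The weak* topology of \<open>B(H)\<close>\<close>

text \<open>
  The predual of \<open>B(H)\<close> is the space of trace class operators; the functionals
  \<open>T \<mapsto> tr (T S)\<close> with \<open>S\<close> of trace class are exactly those of the form
  \<open>T \<mapsto> \<Sum>n. \<langle>T x\<^sub>n, y\<^sub>n\<rangle>\<close> with \<open>(x\<^sub>n)\<close> and \<open>(y\<^sub>n)\<close> square summable. This holds
  for non-separable \<open>H\<close> as well, since trace class operators have countable rank.
\<close>

definition predual :: "(('h::complex_hilbert_space \<Rightarrow>\<^sub>L 'h) \<Rightarrow> complex) set" where
  "predual = {\<lambda>T. \<Sum>n. cinner (blinfun_apply T (x n)) (y n) | x y :: nat \<Rightarrow> 'h.
     summable (\<lambda>n. (norm (x n))\<^sup>2) \<and> summable (\<lambda>n. (norm (y n))\<^sup>2)}"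

definition weak_star :: "('h::complex_hilbert_space \<Rightarrow>\<^sub>L 'h) topology" where
  "weak_star = topology_generated_by
     {{T \<in> bounded_operators. \<phi> T \<in> U} | \<phi> U. \<phi> \<in> predual \<and> open U}"

lemma topspace_weak_star: "topspace weak_star = bounded_operators"
proof -
  have "(\<lambda>T. \<Sum>n. cinner (blinfun_apply T ((\<lambda>_. 0) n)) ((\<lambda>_. 0) n)) \<in> predual"
    unfolding predual_def by (rule CollectI, intro exI conjI, rule refl) simp_all
  then have "{T \<in> bounded_operators. (\<Sum>n. cinner (blinfun_apply T ((\<lambda>_. 0) n)) ((\<lambda>_. 0) n)) \<in> UNIV}
      \<in> {{T \<in> bounded_operators. \<phi> T \<in> U} | \<phi> U. \<phi> \<in> predual \<and> open U}"
    using open_UNIV by blast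
  then show ?thesis
    unfolding weak_star_def topology_generated_by_topspace by auto
qed


subsection \<open>Operator algebras and maps between them\<close>

definition subalgebra :: "('h::complex_hilbert_space \<Rightarrow>\<^sub>L 'h) set \<Rightarrow> bool" where
  "subalgebra A \<longleftrightarrow> A \<subseteq> bounded_operators \<and> 0 \<in> A \<and>
     (\<forall>S\<in>A. \<forall>T\<in>A. S + T \<in> A) \<and> (\<forall>c. \<forall>T\<in>A. c \<cdot>\<^sub>C T \<in> A) \<and> (\<forall>S\<in>A. \<forall>T\<in>A. S o\<^sub>L T \<in> A)"

definition selfadjoint :: "('h::complex_hilbert_space \<Rightarrow>\<^sub>L 'h) set \<Rightarrow> bool" where
  "selfadjoint A \<longleftrightarrow> (\<forall>T\<in>A. adj_op T \<in> A)"

definition linear_map_on ::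
  "('h::complex_hilbert_space \<Rightarrow>\<^sub>L 'h) set \<Rightarrow> (('h \<Rightarrow>\<^sub>L 'h) \<Rightarrow> ('h \<Rightarrow>\<^sub>L 'h)) \<Rightarrow> bool" where
  "linear_map_on A F \<longleftrightarrow>
     (\<forall>S\<in>A. \<forall>T\<in>A. F (S + T) = F S + F T) \<and> (\<forall>c. \<forall>T\<in>A. F (c \<cdot>\<^sub>C T) = c \<cdot>\<^sub>C F T)"

definition homomorphism_on ::
  "('h::complex_hilbert_space \<Rightarrow>\<^sub>L 'h) set \<Rightarrow> (('h \<Rightarrow>\<^sub>L 'h) \<Rightarrow> ('h \<Rightarrow>\<^sub>L 'h)) \<Rightarrow> bool" where
  "homomorphism_on A F \<longleftrightarrow> linear_map_on A F \<and> (\<forall>S\<in>A. \<forall>T\<in>A. F (S o\<^sub>L T) = F S o\<^sub>L F T)"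

definition bimodule_map_on ::
  "('h::complex_hilbert_space \<Rightarrow>\<^sub>L 'h) set \<Rightarrow> ('h \<Rightarrow>\<^sub>L 'h) set \<Rightarrow> (('h \<Rightarrow>\<^sub>L 'h) \<Rightarrow> ('h \<Rightarrow>\<^sub>L 'h)) \<Rightarrow> bool"
where
  "bimodule_map_on D A F \<longleftrightarrow>
     (\<forall>d\<^sub>1\<in>D. \<forall>a\<in>A. \<forall>d\<^sub>2\<in>D. F (d\<^sub>1 o\<^sub>L a o\<^sub>L d\<^sub>2) = d\<^sub>1 o\<^sub>L F a o\<^sub>L d\<^sub>2)"

definition von_neumann_algebra :: "('h::complex_hilbert_space \<Rightarrow>\<^sub>L 'h) set \<Rightarrow> bool" where
  "von_neumann_algebra D \<longleftrightarrow>
     subalgebra D \<and> selfadjoint D \<and> id_blinfun \<in> D \<and> closedin weak_star D"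


subsection \<open>Atomic von Neumann algebras\<close>

definition closed_csubspace :: "'h::complex_hilbert_space set \<Rightarrow> bool" where
  "closed_csubspace K \<longleftrightarrow> closed K \<and> 0 \<in> K \<and>
     (\<forall>x\<in>K. \<forall>y\<in>K. x + y \<in> K) \<and> (\<forall>c. \<forall>x\<in>K. c *\<^sub>C x \<in> K)"

text \<open>
  For a closed subspace \<open>K\<close> of \<open>H\<close>, an operator on \<open>K\<close> is represented by its extension by zero on
  the orthogonal complement of \<open>K\<close>. This identifies \<open>B(K)\<close> with \<open>P B(H) P\<close>, where \<open>P\<close> is the
  projection onto \<open>K\<close>; the identification respects sum, product, adjoint and norm.
\<close>

definition operators_on :: "'h::complex_hilbert_space set \<Rightarrow> ('h \<Rightarrow>\<^sub>L 'h) set" where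
  "operators_on K = {T \<in> bounded_operators. range (blinfun_apply T) \<subseteq> K \<and>
     (\<forall>x. (\<forall>y\<in>K. cinner x y = 0) \<longrightarrow> blinfun_apply T x = 0)}"

text \<open>The \<open>\<ell>\<^sup>\<infinity>\<close>-direct sum of the \<open>B(K i)\<close>: the bounded families, with pointwise operations.\<close>

definition linf_sum ::
  "'i set \<Rightarrow> ('i \<Rightarrow> 'h::complex_hilbert_space set) \<Rightarrow> ('i \<Rightarrow> ('h \<Rightarrow>\<^sub>L 'h)) set" where
  "linf_sum I K = {T. (\<forall>i\<in>I. T i \<in> operators_on (K i)) \<and> (\<forall>i. i \<notin> I \<longrightarrow> T i = 0) \<and>
     (\<exists>C. \<forall>i\<in>I. norm (T i) \<le> C)}"

definition star_isomorphism ::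
  "('h::complex_hilbert_space \<Rightarrow>\<^sub>L 'h) set \<Rightarrow> ('i \<Rightarrow> ('h \<Rightarrow>\<^sub>L 'h)) set
    \<Rightarrow> (('h \<Rightarrow>\<^sub>L 'h) \<Rightarrow> 'i \<Rightarrow> ('h \<Rightarrow>\<^sub>L 'h)) \<Rightarrow> bool" where
  "star_isomorphism D E \<theta> \<longleftrightarrow> bij_betw \<theta> D E \<and>
     (\<forall>S\<in>D. \<forall>T\<in>D. \<theta> (S + T) = (\<lambda>i. \<theta> S i + \<theta> T i)) \<and>
     (\<forall>c. \<forall>T\<in>D. \<theta> (c \<cdot>\<^sub>C T) = (\<lambda>i. c \<cdot>\<^sub>C \<theta> T i)) \<and>
     (\<forall>S\<in>D. \<forall>T\<in>D. \<theta> (S o\<^sub>L T) = (\<lambda>i. \<theta> S i o\<^sub>L \<theta> T i)) \<and>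
     (\<forall>T\<in>D. \<theta> (adj_op T) = (\<lambda>i. adj_op (\<theta> T i)))"

text \<open>
  \<open>D\<close> is atomic if it is isomorphic to an \<open>\<ell>\<^sup>\<infinity>\<close>-direct sum of algebras \<open>B(H\<^sub>i)\<close>. As types cannot be
  quantified, the Hilbert spaces \<open>H\<^sub>i\<close> range over the closed subspaces of \<open>H\<close> and the indices over
  \<open>H\<close>. This is no restriction for \<open>D \<subseteq> B(H)\<close>: let \<open>e\<close> be the element of \<open>D\<close> corresponding to the
  rank-one projection onto the span of a unit vector \<open>u \<in> H\<^sub>i\<close>, and \<open>\<xi>\<close> a unit vector in \<open>e H\<close>.
  Then \<open>a u \<mapsto> a \<xi>\<close>, for \<open>a\<close> in the \<open>i\<close>-th summand, embeds \<open>H\<^sub>i\<close> isometrically into \<open>H\<close>. The vectors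
  \<open>\<xi>\<close> for different \<open>i\<close> are orthogonal and can serve as indices; summands with \<open>H\<^sub>i = 0\<close> can be
  dropped.
\<close>

definition atomic :: "('h::complex_hilbert_space \<Rightarrow>\<^sub>L 'h) set \<Rightarrow> bool" where
  "atomic D \<longleftrightarrow> (\<exists>(I :: 'h set) (K :: 'h \<Rightarrow> 'h set) \<theta>.
     (\<forall>i\<in>I. closed_csubspace (K i)) \<and> star_isomorphism D (linf_sum I K) \<theta>)"

end

theory Submission
  imports Defs
begin

text \<open>
  Since \<open>\<Phi> d = d \<Phi>(1) = d\<close> for \<open>d \<in> D\<close>, the map \<open>\<Psi>\<close> is a normal positive projection of \<open>B(H)\<close> onto \<open>D\<close>, and
  by Tomiyama's theorem it is a \<open>D\<close>-bimodule map. By normality, every nonzero projection \<open>q \<in> D\<close>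
  contains a vector \<open>\<xi>\<close> with \<open>b = \<Psi>(\<xi>\<xi>\<^sup>*) \<noteq> 0\<close>. Let \<open>p \<in> D\<close> be a nonzero spectral projection of \<open>b\<close> on
  which \<open>b \<ge> \<delta> > 0\<close>. For a nonzero projection \<open>r \<le> p\<close> in \<open>D\<close> the operator
  \<open>r b r = \<Psi>(r\<xi>(r\<xi>)\<^sup>*)\<close> has norm at least \<open>\<delta>\<close> and at most \<open>\<parallel>r\<xi>\<parallel>\<^sup>2\<close>, hence \<open>\<parallel>r\<xi>\<parallel>\<^sup>2 \<ge> \<delta>\<close>. So only
  finitely many such \<open>r\<close> can be mutually orthogonal, and \<open>q\<close> dominates a minimal projection.

  For a minimal projection \<open>e\<close> and a unit vector \<open>\<xi> \<in> e H\<close> with \<open>\<Psi>(\<xi>\<xi>\<^sup>*) = \<mu> e \<noteq> 0\<close>, the orbit \<open>K = D \<xi>\<close> is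
  closed, and \<open>\<mu>\<^sup>-\<^sup>1 \<Psi>(T)\<close> restricts to \<open>T\<close> on \<open>K\<close> for every operator \<open>T\<close> on \<open>K\<close>. Restricting \<open>D\<close> to the orbits
  of a maximal family of minimal projections \<open>e\<close> with \<open>e D f = 0\<close> for \<open>e \<noteq> f\<close> gives the isomorphism
  of \<open>D\<close> with the direct sum of the \<open>B(K)\<close>.
\<close>


section \<open>Real Hilbert spaces\<close>

text \<open>Positivity of \<open>\<Psi>\<close> only gives inequalities between quadratic forms, and
  these see the symmetrized product \<open>d x + x d\<close>, not its two halves. So the bimodule
  property is reached in two stages: first a Jordan identity, from comparisons with multiples of a
  projection \<open>p\<close> and from positivity of \<open>\<Psi>\<close> at the square of
  \<open>p + t x\<close> for all real \<open>t\<close>; then the separation of left from right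
  multiplication, which uses adjoints of values of \<open>\<Psi>\<close>, available because they lie
  in the selfadjoint algebra \<open>D\<close>. All spectral theory rests on one cut,
  \<open>spectral_projection\<close>, applied to shifted selfadjoint elements. It yields the dyadic
  approximation by projections, the scalars on minimal projections, the lower bound on
  \<open>b\<close> and the faithfulness of the restriction to the orbits. The relation
  \<open>e D f = 0\<close> says that \<open>e\<close> and \<open>f\<close> have orthogonal central
  supports, so the maximal family takes one minimal projection from each factor summand. Since every
  nonzero projection of \<open>D\<close> dominates a minimal one, no part of \<open>D\<close> is
  invisible on the orbits. Forms, adjoints and projections are treated over the reals; complex
  linearity is added only where scalars matter.\<close>

lemma linear_term_zero:
  fixes a b :: real
  assumes "\<And>t. 0 \<le> t * b + t\<^sup>2 * a"
  shows "b = 0"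
proof (rule ccontr)
  assume "b \<noteq> 0"
  define c where "c = \<bar>a\<bar> + 1"
  \<comment> \<open>The minimizer of \<open>s * b + s\<^sup>2 * c\<close>; replacing
    \<open>a\<close> by the positive majorant \<open>c\<close> guarantees that it exists.\<close>
  define s where "s = - b / (2 * c)"
  have "0 < c"
    by (simp add: c_def)
  have "s * b + s\<^sup>2 * a \<le> s * b + s\<^sup>2 * c"
    by (intro add_left_mono mult_left_mono) (auto simp: c_def)
  also have "\<dots> = - (b\<^sup>2 / (4 * c))"
    using \<open>0 < c\<close> unfolding s_def by (simp add: field_simps power2_eq_square)
  also have "\<dots> < 0"
    using \<open>b \<noteq> 0\<close> \<open>0 < c\<close> by simp
  finally show False
    using assms[of s] by simp
qed

text \<open>A minimizing sequence for the distance from \<open>x\<close> to \<open>S\<close> is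
  Cauchy by the parallelogram law, because midpoints stay in \<open>S\<close>. Orthogonality is the
  first-order condition at the limit.\<close>

lemma orthogonal_decomposition:
  fixes S :: "'a::{real_inner,complete_space} set"
  assumes "closed S" "subspace S"
  shows "\<exists>y\<in>S. \<forall>z\<in>S. inner (x - y) z = 0"
proof -
  define f where "f z = (norm (x - z))\<^sup>2" for z
  define m where "m = Inf (f ` S)"
  have "S \<noteq> {}"
    using subspace_0[OF assms(2)] by auto
  have bdd: "bdd_below (f ` S)"
    by (rule bdd_belowI[of _ 0]) (auto simp: f_def)
  have m_le: "m \<le> f z" if "z \<in> S" for z
    unfolding m_def using bdd that by (simp add: cINF_lower)
  have "\<exists>z\<in>S. f z < m + 1 / Suc n" for n :: nat
    using cINF_less_iff[OF \<open>S \<noteq> {}\<close> bdd, of "m + 1 / Suc n"] by (simp add: m_def)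
  then obtain u where u: "u n \<in> S" "f (u n) < m + 1 / Suc n" for n :: nat
    by metis
  have para: "(norm (v - w))\<^sup>2 = 2 * f v + 2 * f w - 4 * f ((1/2) *\<^sub>R (v + w))" for v w
    unfolding f_def power2_norm_eq_inner
    by (simp add: algebra_simps inner_commute)
  have dist: "(norm (u k - u l))\<^sup>2 \<le> 2 / Suc k + 2 / Suc l" for k l
  proof -
    have "(1/2) *\<^sub>R (u k + u l) \<in> S"
      using assms(2) u by (simp add: subspace_add subspace_scale)
    then show ?thesis
      using para[of "u k" "u l"] m_le[of "(1/2) *\<^sub>R (u k + u l)"] u(2)[of k] u(2)[of l] by simp
  qed
  have "Cauchy u"
  proof (rule CauchyI)
    fix e :: real
    assume "0 < e"
    then obtain N where N: "4 / e\<^sup>2 < real N"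
      using reals_Archimedean2 by blast
    have "norm (u k - u l) < e" if "k \<ge> N" "l \<ge> N" for k l
    proof -
      have pos: "0 < real N"
        using N \<open>0 < e\<close> by (smt (verit) divide_nonneg_nonneg zero_le_power2)
      have "2 / Suc k + 2 / Suc l < 2 / real N + 2 / real N"
        using that pos by (intro add_strict_mono divide_strict_left_mono) auto
      also have "\<dots> < e\<^sup>2"
        using N \<open>0 < e\<close> pos by (simp add: field_simps)
      finally have "(norm (u k - u l))\<^sup>2 < e\<^sup>2"
        using dist[of k l] by simp
      then show ?thesis
        using \<open>0 < e\<close> by (simp add: power_less_imp_less_base)
    qed
    then show "\<exists>M. \<forall>k\<ge>M. \<forall>l\<ge>M. norm (u k - u l) < e"
      by blast
  qed
  then obtain y where y: "u \<longlonglongrightarrow> y"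
    by (auto simp: Cauchy_convergent_iff convergent_def)
  have "y \<in> S"
    using assms(1) u(1) y closed_sequentially by blast
  have "(\<lambda>n. f (u n)) \<longlonglongrightarrow> f y"
    unfolding f_def by (intro tendsto_intros y)
  moreover have "(\<lambda>n. m + 1 / Suc n) \<longlonglongrightarrow> m + 0"
    by (intro tendsto_intros LIMSEQ_Suc lim_1_over_n)
  ultimately have "f y \<le> m"
    using u(2) by (metis (no_types, lifting) LIMSEQ_le add_0_right less_imp_le)
  have "inner (x - y) z = 0" if "z \<in> S" for z
  proof -
    have "0 \<le> t * (- 2 * inner (x - y) z) + t\<^sup>2 * (norm z)\<^sup>2" for t
    proof -
      have "y + t *\<^sub>R z \<in> S"
        using assms(2) \<open>y \<in> S\<close> that by (simp add: subspace_add subspace_scale)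
      then have "f y \<le> f (y + t *\<^sub>R z)"
        using m_le \<open>f y \<le> m\<close> by fastforce
      then show ?thesis
        unfolding f_def power2_norm_eq_inner
        by (simp add: algebra_simps inner_commute power2_eq_square)
    qed
    from linear_term_zero[OF this] show ?thesis
      by simp
  qed
  then show ?thesis
    using \<open>y \<in> S\<close> by blast
qed

text \<open>A vector \<open>v\<close> orthogonal to the kernel determines \<open>f\<close>, since
  \<open>x - (f x / f v) *\<^sub>R v\<close> always lies in the kernel.\<close>

lemma riesz_representation:
  fixes f :: "'a::{real_inner,complete_space} \<Rightarrow> real"
  assumes "bounded_linear f"
  shows "\<exists>y. \<forall>x. f x = inner x y"
proof (cases "\<forall>x. f x = 0")
  case True
  then show ?thesis
    by (metis inner_zero_right)
next
  case False
  then obtain u where u: "f u \<noteq> 0"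
    by blast
  interpret f: bounded_linear f
    by fact
  have "closed (f -` {0})"
    by (intro closed_vimage continuous_on_id f.continuous_on) auto
  moreover have "subspace (f -` {0})"
    by (auto simp: subspace_def f.add f.scaleR)
  ultimately obtain w where w: "f w = 0" "\<And>z. f z = 0 \<Longrightarrow> inner (u - w) z = 0"
    using orthogonal_decomposition[of "f -` {0}" u] by auto
  define v where "v = u - w"
  have v: "f v \<noteq> 0" "\<And>z. f z = 0 \<Longrightarrow> inner v z = 0"
    using u w by (auto simp: v_def f.diff)
  then have "v \<noteq> 0"
    using f.zero by auto
  have "f x = inner x ((f v / inner v v) *\<^sub>R v)" for x
  proof -
    have "f (x - (f x / f v) *\<^sub>R v) = 0"
      using v by (simp add: f.diff f.scaleR)
    from v(2)[OF this] have "inner v x = f x / f v * inner v v"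
      by (simp add: inner_diff_right)
    then show ?thesis
      using v \<open>v \<noteq> 0\<close> by (simp add: inner_commute)
  qed
  then show ?thesis
    by blast
qed

text \<open>Riesz representation for each fixed \<open>x\<close>. It produces adjoints, and later
  the weak sum of infinitely many operators in \<open>family_sum\<close>.\<close>

lemma bounded_form_representation:
  fixes B :: "'a::{real_inner,complete_space} \<Rightarrow> 'a \<Rightarrow> real"
  assumes "bounded_bilinear B"
  shows "\<exists>R :: 'a \<Rightarrow>\<^sub>L 'a. \<forall>x y. inner (R x) y = B x y"
proof -
  interpret B: bounded_bilinear B
    by fact
  have "\<exists>z. \<forall>y. B x y = inner y z" for x
    by (rule riesz_representation) (rule B.bounded_linear_right)
  then obtain R where R: "inner (R x) y = B x y" for x y
    by (metis inner_commute)
  obtain K where K: "\<And>x y. norm (B x y) \<le> norm x * norm y * K" "0 \<le> K"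
    using B.nonneg_bounded by blast
  have "bounded_linear R"
  proof (rule bounded_linear_intro)
    show "R (x + y) = R x + R y" for x y
      by (rule vector_eq_ldot[THEN iffD1]) (simp add: inner_add_right R B.add_left inner_commute[of _ "R _"])
    show "R (r *\<^sub>R x) = r *\<^sub>R R x" for r x
      by (rule vector_eq_ldot[THEN iffD1]) (simp add: R B.scaleR_left inner_commute[of _ "R _"])
    show "norm (R x) \<le> norm x * K" for x
    proof (cases "R x = 0")
      case False
      have "norm (R x) * norm (R x) \<le> norm (R x) * (norm x * K)"
        using K(1)[of x "R x"] R[of x "R x"] by (simp add: dot_square_norm power2_eq_square mult_ac)
      then show ?thesis
        using False by simp
    qed (simp add: K)
  qed
  then have "\<forall>x y. inner (Blinfun R x) y = B x y"
    by (simp add: bounded_linear_Blinfun_apply R)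
  then show ?thesis
    by blast
qed

section \<open>Adjoints for the real inner product and their quadratic forms\<close>

definition adj :: "('a::{real_inner,complete_space} \<Rightarrow>\<^sub>L 'a) \<Rightarrow> ('a \<Rightarrow>\<^sub>L 'a)" where
  "adj T = (SOME S. \<forall>x y. inner (blinfun_apply S x) y = inner x (blinfun_apply T y))"

lemma inner_adj_left: "inner (adj T x) y = inner x (T y)"
proof -
  have "bounded_bilinear (\<lambda>x y. inner x (T y))"
    using bounded_bilinear.comp[OF bounded_bilinear_inner bounded_linear_ident
        blinfun.bounded_linear_right[of T]] by simp
  from bounded_form_representation[OF this]
  have "\<forall>x y. inner (adj T x) y = inner x (T y)"
    unfolding adj_def by (rule someI_ex)
  then show ?thesis
    by blast
qed

lemma inner_adj_right: "inner x (adj T y) = inner (T x) y"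
  by (metis inner_adj_left inner_commute)

lemma blinfun_eq_innerI:
  fixes S T :: "'a::real_inner \<Rightarrow>\<^sub>L 'a"
  assumes "\<And>x y. inner (S x) y = inner (T x) y"
  shows "S = T"
  by (rule blinfun_eqI, rule vector_eq_rdot[THEN iffD1]) (use assms in blast)

lemma adj_eqI:
  fixes S T :: "'a::{real_inner,complete_space} \<Rightarrow>\<^sub>L 'a"
  assumes "\<And>x y. inner (S x) y = inner x (T y)"
  shows "adj T = S"
  by (rule blinfun_eq_innerI) (simp add: inner_adj_left assms)

lemma adj_adj [simp]: "adj (adj T) = T"
  by (rule adj_eqI) (simp add: inner_adj_right)

lemma adj_add: "adj (S + T) = adj S + adj T"
  by (rule adj_eqI) (simp add: blinfun.bilinear_simps inner_add_left inner_add_right inner_adj_left)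

lemma adj_diff: "adj (S - T) = adj S - adj T"
  by (rule adj_eqI) (simp add: blinfun.bilinear_simps inner_diff_left inner_diff_right inner_adj_left)

lemma adj_minus: "adj (- T) = - adj T"
  by (rule adj_eqI) (simp add: blinfun.bilinear_simps inner_adj_left)

lemma adj_scaleR: "adj (r *\<^sub>R T) = r *\<^sub>R adj T"
  by (rule adj_eqI) (simp add: blinfun.bilinear_simps inner_adj_left)

lemma adj_compose: "adj (S o\<^sub>L T) = adj T o\<^sub>L adj S"
  by (rule adj_eqI) (simp add: inner_adj_left)

lemma adj_0 [simp]: "adj 0 = 0"
  by (rule adj_eqI) simp

lemma adj_id [simp]: "adj id_blinfun = id_blinfun"
  by (rule adj_eqI) simp

lemma selfadjoint_inner: "adj T = T \<Longrightarrow> inner (T x) y = inner x (T y)"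
  by (metis inner_adj_left)

lemma norm_adj [simp]: "norm (adj T) = norm T"
proof -
  have *: "norm (adj S) \<le> norm S" for S :: "'a \<Rightarrow>\<^sub>L 'a"
  proof (rule norm_blinfun_bound)
    fix x
    show "norm (adj S x) \<le> norm S * norm x"
    proof (cases "adj S x = 0")
      case False
      have "norm (adj S x) * norm (adj S x) = inner x (S (adj S x))"
        by (simp add: dot_square_norm flip: inner_adj_left power2_eq_square)
      also have "\<dots> \<le> norm x * norm (S (adj S x))"
        by (rule norm_cauchy_schwarz)
      also have "\<dots> \<le> norm x * (norm S * norm (adj S x))"
        by (intro mult_left_mono norm_blinfun) simp
      finally show ?thesis
        using False by (simp add: mult_ac)
    qed simp
  qed simp
  show ?thesis
    using *[of T] *[of "adj T"] by simp
qed

lemma abs_quadratic_le: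
  fixes T :: "'a::real_inner \<Rightarrow>\<^sub>L 'a"
  shows "\<bar>inner (T x) x\<bar> \<le> norm T * (norm x)\<^sup>2"
proof -
  have "\<bar>inner (T x) x\<bar> \<le> norm (T x) * norm x"
    by (rule Cauchy_Schwarz_ineq2)
  also have "\<dots> \<le> norm T * norm x * norm x"
    by (intro mult_right_mono norm_blinfun) simp
  finally show ?thesis
    by (simp add: power2_eq_square mult_ac)
qed

lemma polarization:
  fixes T :: "'a::{real_inner,complete_space} \<Rightarrow>\<^sub>L 'a"
  assumes "adj T = T"
  shows "4 * inner (T x) y = inner (T (x + y)) (x + y) - inner (T (x - y)) (x - y)"
  using selfadjoint_inner[OF assms, of y x]
  by (simp add: blinfun.bilinear_simps algebra_simps inner_commute)

text \<open>Polarize with \<open>y\<close> equal to \<open>T x\<close> rescaled to the length of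
  \<open>x\<close>: the left side becomes \<open>4 * norm x * norm (T x)\<close>, and the
  parallelogram law turns the right side into \<open>4 * c * (norm x)\<^sup>2\<close>.\<close>

lemma norm_le_quadratic:
  fixes T :: "'a::{real_inner,complete_space} \<Rightarrow>\<^sub>L 'a"
  assumes sa: "adj T = T" and bound: "\<And>x. \<bar>inner (T x) x\<bar> \<le> c * (norm x)\<^sup>2" and "0 \<le> c"
  shows "norm T \<le> c"
proof (rule norm_blinfun_bound[OF \<open>0 \<le> c\<close>])
  fix x
  show "norm (T x) \<le> c * norm x"
  proof (cases "T x = 0 \<or> x = 0")
    case False
    define y where "y = (norm x / norm (T x)) *\<^sub>R T x"
    have ny: "norm y = norm x"
      using False by (simp add: y_def)
    have "4 * inner (T x) y \<le> c * (norm (x + y))\<^sup>2 + c * (norm (x - y))\<^sup>2"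
      unfolding polarization[OF sa] using bound[of "x + y"] bound[of "x - y"] by linarith
    also have "\<dots> = c * (2 * (norm x)\<^sup>2 + 2 * (norm y)\<^sup>2)"
      unfolding power2_norm_eq_inner by (simp add: algebra_simps inner_commute)
    also have "\<dots> = 4 * (c * (norm x)\<^sup>2)"
      by (simp add: ny)
    finally have "inner (T x) y \<le> c * (norm x)\<^sup>2"
      by simp
    moreover have "inner (T x) y = norm x * norm (T x)"
      using False by (simp add: y_def dot_square_norm power2_eq_square)
    ultimately show ?thesis
      using False by (simp add: power2_eq_square mult_ac)
  qed (use \<open>0 \<le> c\<close> in auto)
qed

text \<open>The form attains its minimum 0 at \<open>x\<close>, so its derivative
  \<open>2 * inner (T x) y\<close> vanishes in every direction \<open>y\<close>.\<close>

lemma positive_form_kernel: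
  fixes T :: "'a::{real_inner,complete_space} \<Rightarrow>\<^sub>L 'a"
  assumes sa: "adj T = T" and pos: "\<And>x. 0 \<le> inner (T x) x" and "inner (T x) x \<le> 0"
  shows "T x = 0"
proof -
  have "inner (T x) x = 0"
    using assms(3) pos[of x] by simp
  have "2 * inner (T x) y = 0" for y
  proof (rule linear_term_zero)
    fix t :: real
    show "0 \<le> t * (2 * inner (T x) y) + t\<^sup>2 * inner (T y) y"
      using pos[of "x + t *\<^sub>R y"] selfadjoint_inner[OF sa, of y x] \<open>inner (T x) x = 0\<close>
      by (simp add: blinfun.bilinear_simps algebra_simps inner_commute power2_eq_square)
  qed
  from this[of "T x"] show ?thesis
    by simp
qed

section \<open>Orthogonal projections\<close>

definition projection :: "('a::{real_inner,complete_space} \<Rightarrow>\<^sub>L 'a) \<Rightarrow> bool" where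
  "projection p \<longleftrightarrow> adj p = p \<and> p o\<^sub>L p = p"

lemma projection_adj: "projection p \<Longrightarrow> adj p = p"
  by (simp add: projection_def)

lemma projection_idem: "projection p \<Longrightarrow> p (p x) = p x"
  by (metis blinfun_apply_blinfun_compose projection_def)

lemma projection_inner: "projection p \<Longrightarrow> inner (p x) y = inner x (p y)"
  by (simp add: projection_def selfadjoint_inner)

lemma projection_quadratic: "projection p \<Longrightarrow> inner (p x) x = (norm (p x))\<^sup>2"
  by (metis power2_norm_eq_inner projection_idem projection_inner)

lemma projection_complement: "projection p \<Longrightarrow> projection (id_blinfun - p)"
  unfolding projection_def[of "id_blinfun - p"]
  by (auto simp: adj_diff projection_adj projection_idem blinfun.bilinear_simps intro!: blinfun_eqI)

lemma projection_pythagoras: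
  assumes "projection p"
  shows "(norm x)\<^sup>2 = (norm (p x))\<^sup>2 + (norm (x - p x))\<^sup>2"
proof -
  have "inner (p x) (p x) = inner (p x) x"
    by (metis assms projection_quadratic power2_norm_eq_inner)
  then show ?thesis
    unfolding power2_norm_eq_inner by (simp add: algebra_simps inner_commute)
qed

lemma projection_norm_apply: "projection p \<Longrightarrow> norm (p x) \<le> norm x"
  using projection_pythagoras[of p x] by (simp add: power2_le_imp_le)

lemma norm_projection: "projection p \<Longrightarrow> norm p \<le> 1"
  by (rule norm_blinfun_bound) (auto simp: projection_norm_apply)

text \<open>A selfadjoint operator that leaves the range of \<open>p\<close> invariant also leaves
  its orthogonal complement invariant.\<close>

lemma projection_commute:
  assumes "projection p" "adj a = a" and inv: "\<And>x. p (a (p x)) = a (p x)"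
  shows "p (a x) = a (p x)"
proof -
  have "inner (p (a x)) y = inner (a (p x)) y" for y
  proof -
    have "inner (p (a x)) y = inner x (a (p y))"
      by (simp add: projection_inner[OF assms(1)] selfadjoint_inner[OF assms(2)])
    also have "\<dots> = inner x (p (a (p y)))"
      by (simp add: inv)
    also have "\<dots> = inner (p (a (p x))) y"
      by (simp add: projection_inner[OF assms(1)] selfadjoint_inner[OF assms(2)])
    finally show ?thesis
      by (simp add: inv)
  qed
  then show ?thesis
    using vector_eq_rdot by blast
qed

section \<open>Operators on complex Hilbert spaces\<close>

lemma scaleC_one [simp]: "1 *\<^sub>C x = (x :: 'a::complex_hilbert_space)"
  using scaleR_scaleC[of 1 x] by simp

lemma scaleC_zero_left [simp]: "0 *\<^sub>C x = (0 :: 'a::complex_hilbert_space)"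
  using scaleR_scaleC[of 0 x] by simp

lemma scaleC_zero_right [simp]: "c *\<^sub>C 0 = (0 :: 'a::complex_hilbert_space)"
  using scaleC_scaleC[of c 0 "0 :: 'a"] by simp

lemma scaleC_diff_right: "c *\<^sub>C (x - y) = c *\<^sub>C x - c *\<^sub>C (y :: 'a::complex_hilbert_space)"
  using scaleC_add_right[of c "x - y" y] by simp

lemma scaleC_diff_left: "(b - c) *\<^sub>C x = b *\<^sub>C x - c *\<^sub>C (x :: 'a::complex_hilbert_space)"
  using scaleC_add_left[of "b - c" c x] by simp

lemma scaleC_minus_left: "(- c) *\<^sub>C x = - (c *\<^sub>C (x :: 'a::complex_hilbert_space))"
  using scaleC_diff_left[of 0 c x] by simp

lemma scaleC_scaleR: "c *\<^sub>C r *\<^sub>R x = r *\<^sub>R c *\<^sub>C (x :: 'a::complex_hilbert_space)"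
  by (simp add: scaleR_scaleC scaleC_scaleC mult.commute)

lemma cinner_scaleC_right: "cinner x (c *\<^sub>C y) = cnj c * cinner x y"
  by (metis cinner_commute cinner_scaleC_left complex_cnj_mult)

lemma cinner_zero_left [simp]: "cinner 0 x = 0"
  using cinner_scaleC_left[of 0 0 x] by simp

lemma cinner_zero_right [simp]: "cinner x 0 = 0"
  using cinner_scaleC_right[of x 0 0] by simp

lemma cinner_diff_left: "cinner (x - y) z = cinner x z - cinner y z"
  using cinner_add_left[of "x - y" y z] by simp

lemma inner_scaleC: "inner (c *\<^sub>C x) y = inner x (cnj c *\<^sub>C y)"
  by (simp flip: Re_cinner add: cinner_scaleC_left cinner_scaleC_right)

lemma Im_cinner: "Im (cinner x y) = inner x (\<i> *\<^sub>C y)"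
  by (simp flip: Re_cinner add: cinner_scaleC_right)

lemma norm_cinner_le: "cmod (cinner x y) \<le> norm x * norm y"
proof (cases "cinner x y = 0")
  case False
  define u where "u = cnj (cinner x y) / cmod (cinner x y)"
  have "u * cinner x y = cmod (cinner x y)"
    using False unfolding u_def
    by (simp add: mult.commute[of "cnj _"] complex_norm_square[symmetric] power2_eq_square)
  then have "cmod (cinner x y) = inner (u *\<^sub>C x) y"
    by (simp flip: Re_cinner add: cinner_scaleC_left)
  also have "\<dots> \<le> norm (u *\<^sub>C x) * norm y"
    by (rule norm_cauchy_schwarz)
  also have "norm (u *\<^sub>C x) = norm x"
    using False by (simp add: norm_scaleC u_def norm_divide)
  finally show ?thesis .
qed simp

lemma scale_op_apply [simp]: "(c \<cdot>\<^sub>C T) x = c *\<^sub>C T x"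
  by (rule scale_op.rep_eq[THEN fun_cong])

lemma bounded_operators_scaleC: "T \<in> bounded_operators \<Longrightarrow> T (c *\<^sub>C x) = c *\<^sub>C T x"
  by (simp add: bounded_operators_def)

lemma bounded_operators_0 [intro, simp]: "0 \<in> bounded_operators"
  by (simp add: bounded_operators_def)

lemma bounded_operators_id [intro, simp]: "id_blinfun \<in> bounded_operators"
  by (simp add: bounded_operators_def)

lemma bounded_operators_add [intro]:
  "S \<in> bounded_operators \<Longrightarrow> T \<in> bounded_operators \<Longrightarrow> S + T \<in> bounded_operators"
  by (simp add: bounded_operators_def blinfun.bilinear_simps scaleC_add_right)

lemma bounded_operators_diff [intro]:
  "S \<in> bounded_operators \<Longrightarrow> T \<in> bounded_operators \<Longrightarrow> S - T \<in> bounded_operators"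
  by (simp add: bounded_operators_def blinfun.bilinear_simps scaleC_diff_right)

lemma bounded_operators_scaleR [intro]:
  "T \<in> bounded_operators \<Longrightarrow> r *\<^sub>R T \<in> bounded_operators"
  by (simp add: bounded_operators_def blinfun.bilinear_simps scaleC_scaleR)

lemma bounded_operators_scale_op [intro]:
  "T \<in> bounded_operators \<Longrightarrow> c \<cdot>\<^sub>C T \<in> bounded_operators"
  by (simp add: bounded_operators_def scaleC_scaleC mult.commute)

lemma bounded_operators_compose [intro]:
  "S \<in> bounded_operators \<Longrightarrow> T \<in> bounded_operators \<Longrightarrow> S o\<^sub>L T \<in> bounded_operators"
  by (simp add: bounded_operators_def)

lemma bounded_operators_adj [intro]:
  assumes "T \<in> bounded_operators"
  shows "adj T \<in> bounded_operators"
proof -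
  have "inner (adj T (c *\<^sub>C x)) y = inner (c *\<^sub>C adj T x) y" for c x y
    by (simp add: inner_adj_left inner_scaleC bounded_operators_scaleC[OF assms])
  then have "adj T (c *\<^sub>C x) = c *\<^sub>C adj T x" for c x
    using vector_eq_rdot by blast
  then show ?thesis
    by (simp add: bounded_operators_def)
qed

lemma bounded_operators_limit:
  fixes S :: "'a::complex_hilbert_space \<Rightarrow>\<^sub>L 'a"
  assumes "\<And>n. T n \<in> bounded_operators" "\<And>x. (\<lambda>n. T n x) \<longlonglongrightarrow> S x"
  shows "S \<in> bounded_operators"
proof -
  have "S (c *\<^sub>C x) = c *\<^sub>C S x" for c x
  proof (rule LIMSEQ_unique)
    show "(\<lambda>n. T n (c *\<^sub>C x)) \<longlonglongrightarrow> S (c *\<^sub>C x)"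
      by (rule assms)
    show "(\<lambda>n. T n (c *\<^sub>C x)) \<longlonglongrightarrow> c *\<^sub>C S x"
      unfolding bounded_operators_scaleC[OF assms(1)]
      by (rule bounded_linear.tendsto[OF bounded_linear_scaleC assms(2)])
  qed
  then show ?thesis
    by (simp add: bounded_operators_def)
qed

lemma cinner_adj_left:
  assumes "T \<in> bounded_operators"
  shows "cinner (adj T x) y = cinner x (T y)"
proof (rule complex_eqI)
  show "Re (cinner (adj T x) y) = Re (cinner x (T y))"
    by (simp add: Re_cinner inner_adj_left)
  show "Im (cinner (adj T x) y) = Im (cinner x (T y))"
    by (simp add: Im_cinner inner_adj_left bounded_operators_scaleC[OF assms])
qed

lemma cinner_adj_right: "T \<in> bounded_operators \<Longrightarrow> cinner x (adj T y) = cinner (T x) y"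
  by (metis cinner_adj_left cinner_commute)

lemma cinner_selfadjoint: "T \<in> bounded_operators \<Longrightarrow> adj T = T \<Longrightarrow> cinner (T x) y = cinner x (T y)"
  by (metis cinner_adj_left)

text \<open>The real and the complex adjoint agree on complex-linear operators, because the real and
  imaginary parts of \<open>cinner\<close> are both real inner products (\<open>Re_cinner\<close>,
  \<open>Im_cinner\<close>).\<close>

lemma adj_op_eq:
  assumes "T \<in> bounded_operators"
  shows "adj_op T = adj T"
  unfolding adj_op_def
proof (rule the_equality)
  show "adj T \<in> bounded_operators \<and> (\<forall>x y. cinner (T x) y = cinner x (adj T y))"
    using assms by (auto simp: cinner_adj_right)
  fix S :: "'a \<Rightarrow>\<^sub>L 'a"
  assume "S \<in> bounded_operators \<and> (\<forall>x y. cinner (T x) y = cinner x (S y))"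
  then have "inner (S x) y = inner x (T y)" for x y
    by (metis Re_cinner inner_commute)
  then show "S = adj T"
    using adj_eqI by metis
qed

text \<open>For a real form, nonnegativity does not force symmetry, so selfadjointness is listed on
  the right. Over the complex numbers it follows: the vanishing of
  \<open>Im (cinner (T x) x)\<close> polarizes to a skew relation, and replacing \<open>y\<close> by
  \<open>(- \<i>) *\<^sub>C y\<close> turns that into symmetry.\<close>

lemma positive_op_iff:
  "positive_op T \<longleftrightarrow> T \<in> bounded_operators \<and> adj T = T \<and> (\<forall>x. 0 \<le> inner (T x) x)"
proof safe
  assume pos: "positive_op T"
  then show T: "T \<in> bounded_operators"
    by (simp add: positive_op_def)
  have nonneg: "cinner (T x) x \<in> \<real>\<^sub>\<ge>\<^sub>0" for x
    using pos by (simp add: positive_op_def)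
  show "0 \<le> inner (T x) x" for x
    using nonneg[of x] by (auto simp: complex_nonneg_Reals_iff Re_cinner)
  have im: "inner (T x) (\<i> *\<^sub>C x) = 0" for x
    using nonneg[of x] by (auto simp: complex_nonneg_Reals_iff Im_cinner)
  have skew: "inner (T x) (\<i> *\<^sub>C y) = - inner (T y) (\<i> *\<^sub>C x)" for x y
    using im[of "x + y"] im[of x] im[of y]
    by (simp add: blinfun.bilinear_simps scaleC_add_right inner_add_left inner_add_right)
  have "inner (T x) y = inner x (T y)" for x y
  proof -
    have y: "y = \<i> *\<^sub>C (- \<i>) *\<^sub>C y"
      by (simp add: scaleC_scaleC)
    have "inner (T x) y = - inner (T ((- \<i>) *\<^sub>C y)) (\<i> *\<^sub>C x)"
      by (subst y, subst skew) (rule refl)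
    also have "\<dots> = - inner ((- \<i>) *\<^sub>C T y) (\<i> *\<^sub>C x)"
      by (simp add: bounded_operators_scaleC[OF T])
    also have "\<dots> = - inner (T y) (\<i> *\<^sub>C \<i> *\<^sub>C x)"
      by (simp add: inner_scaleC)
    also have "\<dots> = inner x (T y)"
    proof -
      have "\<i> *\<^sub>C \<i> *\<^sub>C x = - x"
        using scaleR_scaleC[of "-1" x] by (simp add: scaleC_scaleC)
      then show ?thesis
        by (simp add: inner_commute)
    qed
    finally show ?thesis .
  qed
  then show "adj T = T"
    by (rule adj_eqI)
next
  assume T: "T \<in> bounded_operators" "adj T = T" and pos: "\<forall>x. 0 \<le> inner (T x) x"
  have "Im (cinner (T x) x) = 0" for x
  proof -
    have "Im (cinner (T x) x) = - Im (cinner (T x) x)"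
      by (metis cinner_commute cinner_selfadjoint[OF T] cnj.simps(2))
    then show ?thesis
      by simp
  qed
  then show "positive_op T"
    using T pos by (auto simp: positive_op_def complex_nonneg_Reals_iff Re_cinner)
qed

lemma scale_op_of_real: "complex_of_real r \<cdot>\<^sub>C T = r *\<^sub>R T"
  by (rule blinfun_eqI) (simp add: blinfun.bilinear_simps scaleR_scaleC)

lemma adj_scale_op: "T \<in> bounded_operators \<Longrightarrow> adj (c \<cdot>\<^sub>C T) = cnj c \<cdot>\<^sub>C adj T"
  by (rule adj_eqI) (simp add: inner_scaleC inner_adj_left bounded_operators_scaleC)

lemma compose_scale_op: "S \<in> bounded_operators \<Longrightarrow> S o\<^sub>L (c \<cdot>\<^sub>C T) = c \<cdot>\<^sub>C (S o\<^sub>L T)"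
  by (rule blinfun_eqI) (simp add: bounded_operators_scaleC)

lemma scale_op_compose: "(c \<cdot>\<^sub>C S) o\<^sub>L T = c \<cdot>\<^sub>C (S o\<^sub>L T)"
  by (rule blinfun_eqI) simp

lemma scale_op_add_right: "c \<cdot>\<^sub>C (S + T) = c \<cdot>\<^sub>C S + c \<cdot>\<^sub>C T"
  by (rule blinfun_eqI) (simp add: blinfun.bilinear_simps scaleC_add_right)

lemma blinfun_compose_assoc: "(a o\<^sub>L b) o\<^sub>L c = a o\<^sub>L (b o\<^sub>L c)"
  by (rule blinfun_eqI) simp

lemmas blinfun_compose_simps =
  bounded_bilinear.add_left[OF bounded_bilinear_blinfun_compose]
  bounded_bilinear.add_right[OF bounded_bilinear_blinfun_compose]
  bounded_bilinear.scaleR_left[OF bounded_bilinear_blinfun_compose]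
  bounded_bilinear.scaleR_right[OF bounded_bilinear_blinfun_compose]

text \<open>Cartesian decomposition: \<open>T\<close> is \<open>R\<close> plus \<open>\<i>\<close>
  times \<open>S\<close>, with both parts selfadjoint and in \<open>X\<close>. It reduces
  complex-linear claims to selfadjoint elements.\<close>

lemma selfadjoint_induct:
  assumes "T \<in> X" and X: "X \<subseteq> bounded_operators" "\<And>S. S \<in> X \<Longrightarrow> adj S \<in> X"
    "\<And>S T. S \<in> X \<Longrightarrow> T \<in> X \<Longrightarrow> S + T \<in> X" "\<And>c S. S \<in> X \<Longrightarrow> c \<cdot>\<^sub>C S \<in> X"
    and sa: "\<And>S. S \<in> X \<Longrightarrow> adj S = S \<Longrightarrow> P S"
    and add: "\<And>S T. S \<in> X \<Longrightarrow> T \<in> X \<Longrightarrow> P S \<Longrightarrow> P T \<Longrightarrow> P (S + T)"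
    and scale: "\<And>c S. S \<in> X \<Longrightarrow> P S \<Longrightarrow> P (c \<cdot>\<^sub>C S)"
  shows "P T"
proof -
  define R where "R = complex_of_real (1/2) \<cdot>\<^sub>C (T + adj T)"
  define S where "S = (- \<i> / 2) \<cdot>\<^sub>C (T + (- 1) \<cdot>\<^sub>C adj T)"
  have BO: "T \<in> bounded_operators" "adj T \<in> bounded_operators"
    using assms(1) X(1) by (auto intro: bounded_operators_adj)
  have "adj R = R"
    unfolding R_def scale_op_of_real by (simp add: adj_scaleR adj_add add.commute)
  moreover have "adj S = S"
    unfolding S_def
    by (rule blinfun_eqI)
      (simp add: adj_scale_op adj_add BO bounded_operators_add bounded_operators_scale_op
        blinfun.bilinear_simps scaleC_add_right scaleC_scaleC add.commute)
  moreover have "R \<in> X" "S \<in> X"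
    unfolding R_def S_def using assms(1) X by simp_all
  ultimately have "P (R + \<i> \<cdot>\<^sub>C S)"
    by (simp add: sa add scale X)
  also have "R + \<i> \<cdot>\<^sub>C S = T"
  proof (rule blinfun_eqI)
    fix x
    have "(1/2) *\<^sub>C y + (1/2) *\<^sub>C y = y" for y :: 'a
      by (simp flip: scaleC_add_left)
    from this[of "T x"] show "(R + \<i> \<cdot>\<^sub>C S) x = T x"
      unfolding R_def S_def
      by (simp add: blinfun.bilinear_simps scaleC_add_right scaleC_scaleC scaleC_minus_left scaleC_diff_right)
  qed
  finally show ?thesis .
qed

section \<open>Rank-one operators\<close>

lift_definition rank_one :: "'a::complex_hilbert_space \<Rightarrow> 'a \<Rightarrow> 'a \<Rightarrow>\<^sub>L 'a"
  is "\<lambda>x y z. cinner z y *\<^sub>C x"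
proof (rule bounded_linear_intro)
  fix x y z w :: 'a and r :: real
  show "cinner (z + w) y *\<^sub>C x = cinner z y *\<^sub>C x + cinner w y *\<^sub>C x"
    by (simp add: cinner_add_left scaleC_add_left)
  show "cinner (r *\<^sub>R z) y *\<^sub>C x = r *\<^sub>R cinner z y *\<^sub>C x"
    by (simp add: scaleR_scaleC cinner_scaleC_left scaleC_scaleC)
  show "norm (cinner z y *\<^sub>C x) \<le> norm z * (norm y * norm x)"
    using mult_right_mono[OF norm_cinner_le norm_ge_zero, of z y x]
    by (simp add: norm_scaleC mult.assoc)
qed

lemma rank_one_apply [simp]: "rank_one x y z = cinner z y *\<^sub>C x"
  by (simp add: rank_one.rep_eq)

lemma rank_one_bounded_operators [intro, simp]: "rank_one x y \<in> bounded_operators"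
  by (simp add: bounded_operators_def cinner_scaleC_left scaleC_scaleC)

lemma compose_rank_one: "S \<in> bounded_operators \<Longrightarrow> S o\<^sub>L rank_one x y = rank_one (S x) y"
  by (rule blinfun_eqI) (simp add: bounded_operators_scaleC)

lemma rank_one_compose: "S \<in> bounded_operators \<Longrightarrow> rank_one x y o\<^sub>L S = rank_one x (adj S y)"
  by (rule blinfun_eqI) (simp add: cinner_adj_right)

lemma rank_one_scaleC: "rank_one (b *\<^sub>C x) (c *\<^sub>C x) = (b * cnj c) \<cdot>\<^sub>C rank_one x x"
  by (rule blinfun_eqI) (simp add: cinner_scaleC_right scaleC_scaleC mult_ac)

lemma inner_rank_one: "inner (rank_one x x z) z = (cmod (cinner z x))\<^sup>2"
proof -
  have "inner (rank_one x x z) z = Re (cinner z x * cnj (cinner z x))"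
    by (simp flip: Re_cinner add: cinner_scaleC_left cinner_commute[of x z])
  then show ?thesis
    by (simp flip: complex_norm_square)
qed

lemma adj_rank_one: "adj (rank_one x y) = rank_one y x"
proof (rule adj_eqI)
  fix u v :: 'a
  have "cinner (cinner u x *\<^sub>C y) v = cinner u (cinner v y *\<^sub>C x)"
    by (simp add: cinner_scaleC_left cinner_scaleC_right cinner_commute[of y v])
  then show "inner (rank_one y x u) v = inner u (rank_one x y v)"
    by (metis Re_cinner rank_one_apply)
qed

lemma positive_rank_one: "positive_op (rank_one x x)"
  by (simp add: positive_op_iff adj_rank_one inner_rank_one del: rank_one_apply)

lemma rank_one_quadratic_le: "inner (rank_one x x z) z \<le> (norm x)\<^sup>2 * (norm z)\<^sup>2"
proof -
  have "(cmod (cinner z x))\<^sup>2 \<le> (norm z * norm x)\<^sup>2"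
    by (rule power_mono[OF norm_cinner_le]) simp
  then show ?thesis
    unfolding inner_rank_one by (simp add: power_mult_distrib mult.commute)
qed

lemma norm_rank_one_le: "norm (rank_one x x) \<le> (norm x)\<^sup>2"
  using positive_rank_one[of x] rank_one_quadratic_le[of x]
  by (intro norm_le_quadratic) (auto simp: positive_op_iff abs_of_nonneg simp del: rank_one_apply)

lemma orthogonal_projection_exists:
  assumes K: "closed_csubspace K"
  shows "\<exists>P\<in>bounded_operators. projection P \<and> (\<forall>x. P x \<in> K) \<and> (\<forall>x\<in>K. P x = x)"
proof -
  have scaleC: "c *\<^sub>C x \<in> K" if "x \<in> K" for c x
    using K that by (simp add: closed_csubspace_def)
  have sub: "subspace K"
    using K scaleC by (auto simp: subspace_def closed_csubspace_def scaleR_scaleC)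
  have "\<exists>y\<in>K. \<forall>z\<in>K. inner (x - y) z = 0" for x
    using orthogonal_decomposition[OF _ sub] K by (simp add: closed_csubspace_def)
  then obtain f where f: "\<And>x. f x \<in> K" "\<And>x z. z \<in> K \<Longrightarrow> inner (x - f x) z = 0"
    by metis
  \<comment> \<open>Additivity, homogeneity and complex linearity of \<open>f\<close> are all read
    off from this uniqueness.\<close>
  have unique: "f x = y" if "y \<in> K" "\<And>z. z \<in> K \<Longrightarrow> inner (x - y) z = 0" for x y
  proof -
    have "f x - y \<in> K"
      using sub f(1) that(1) by (rule subspace_diff)
    from f(2)[OF this, of x] that(2)[OF this] have "inner (f x - y) (f x - y) = 0"
      by (simp add: inner_diff_left)
    then show ?thesis
      by simp
  qed
  have "norm (f x) \<le> norm x" for x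
  proof -
    have "inner x (f x) = inner (f x) (f x)"
      using f(2)[OF f(1), of x x] by (simp add: inner_diff_left)
    then have "norm (f x) * norm (f x) \<le> norm x * norm (f x)"
      using norm_cauchy_schwarz[of x "f x"] by (simp add: dot_square_norm power2_eq_square)
    then show ?thesis
      by (cases "f x = 0") auto
  qed
  then have "bounded_linear f"
    by (intro bounded_linear_intro[where K = 1] unique)
      (use f sub in \<open>auto simp: subspace_add subspace_scale add_diff_add inner_add_left
        simp flip: scaleR_diff_right\<close>)
  then have Blinfun_f: "Blinfun f x = f x" for x
    by (simp add: bounded_linear_Blinfun_apply)
  have "f (c *\<^sub>C x) = c *\<^sub>C f x" for c x
  proof (rule unique)
    fix z
    assume "z \<in> K"
    then show "inner (c *\<^sub>C x - c *\<^sub>C f x) z = 0"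
      by (simp flip: scaleC_diff_right add: inner_scaleC f(2) scaleC)
  qed (simp add: scaleC f)
  then have "Blinfun f \<in> bounded_operators"
    by (simp add: bounded_operators_def Blinfun_f)
  moreover have id: "f x = x" if "x \<in> K" for x
    using that by (intro unique) auto
  have "adj (Blinfun f) = Blinfun f"
  proof (rule adj_eqI)
    fix x y
    have "inner x (f y) = inner (f x) (f y)" "inner y (f x) = inner (f y) (f x)"
      using f(2)[OF f(1), of x y] f(2)[OF f(1), of y x] by (simp_all add: inner_diff_left)
    then show "inner (Blinfun f x) y = inner x (Blinfun f y)"
      unfolding Blinfun_f by (metis inner_commute)
  qed
  then have "projection (Blinfun f)"
    by (auto simp: projection_def Blinfun_f id f intro: blinfun_eqI)
  ultimately show ?thesis
    using f(1) id by (auto simp: Blinfun_f)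
qed

definition orthogonal_projection :: "'h::complex_hilbert_space set \<Rightarrow> 'h \<Rightarrow>\<^sub>L 'h" where
  "orthogonal_projection K = (SOME P. P \<in> bounded_operators \<and> projection P \<and>
     (\<forall>x. blinfun_apply P x \<in> K) \<and> (\<forall>x\<in>K. blinfun_apply P x = x))"

lemma orthogonal_projection:
  assumes "closed_csubspace K"
  shows "orthogonal_projection K \<in> bounded_operators" "projection (orthogonal_projection K)"
    "orthogonal_projection K x \<in> K" "x \<in> K \<Longrightarrow> orthogonal_projection K x = x"
proof -
  have "\<exists>P. P \<in> bounded_operators \<and> projection P \<and>
     (\<forall>x. blinfun_apply P x \<in> K) \<and> (\<forall>x\<in>K. blinfun_apply P x = x)"
    using orthogonal_projection_exists[OF assms] by blast
  from someI_ex[OF this] show "orthogonal_projection K \<in> bounded_operators"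
    "projection (orthogonal_projection K)"
    "orthogonal_projection K x \<in> K" "x \<in> K \<Longrightarrow> orthogonal_projection K x = x"
    unfolding orthogonal_projection_def by auto
qed

text \<open>The difference of \<open>x\<close> and its projection is orthogonal to \<open>K\<close>,
  where \<open>T\<close> is zero by the encoding in \<open>operators_on\<close>.\<close>

lemma operators_on_factor:
  assumes K: "closed_csubspace K" and T: "T \<in> operators_on K"
  shows "T (orthogonal_projection K x) = T x"
proof -
  let ?P = "orthogonal_projection K"
  have "cinner (x - ?P x) y = 0" if "y \<in> K" for y
  proof -
    have "cinner (?P x) y = cinner x (?P y)"
      by (rule cinner_selfadjoint[OF orthogonal_projection(1)[OF K]
            projection_adj[OF orthogonal_projection(2)[OF K]]])
    then show ?thesis
      using orthogonal_projection(4)[OF K that] by (simp add: cinner_diff_left)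
  qed
  then have "T (x - ?P x) = 0"
    using T by (simp add: operators_on_def)
  then show ?thesis
    by (simp add: blinfun.bilinear_simps)
qed

text \<open>A weak* neighbourhood only restricts the operators at countably many vectors. Since \<open>H\<close> need
  not be separable, this is what makes it possible to work with sequences.\<close>

lemma weak_star_sequential_neighbourhood:
  assumes "openin weak_star U" "q \<in> U"
  shows "\<exists>V. countable V \<and> (\<forall>T C. (\<forall>n::nat. T n \<in> bounded_operators \<and> norm (T n) \<le> C) \<longrightarrow>
      (\<forall>v\<in>V. (\<lambda>n. T n v) \<longlonglongrightarrow> q v) \<longrightarrow> (\<forall>\<^sub>F n in sequentially. T n \<in> U))"
proof -
  define near where "near V X \<longleftrightarrow> (\<forall>T C. (\<forall>n::nat. T n \<in> bounded_operators \<and> norm (T n) \<le> C) \<longrightarrow>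
      (\<forall>v\<in>V. (\<lambda>n. T n v) \<longlonglongrightarrow> q v) \<longrightarrow> (\<forall>\<^sub>F n in sequentially. T n \<in> X))" for V X
  \<comment> \<open>Induction on how the open set is generated. A subbasic set contributes the
    countable range of the sequence \<open>x\<close> of its functional, an intersection the union of
    two countable sets, and a union needs only one of its members.\<close>
  have "generate_topology_on {{T \<in> bounded_operators. \<phi> T \<in> U} | \<phi> U. \<phi> \<in> predual \<and> open U} U"
    using assms(1) by (simp add: weak_star_def openin_topology_generated_by_iff)
  then have "\<exists>V. countable V \<and> near V U"
    using assms(2)
  proof (induction U)
    case (Int X Y)
    then obtain V W where "countable V" "near V X" "countable W" "near W Y"
      by blast
    then have "countable (V \<union> W) \<and> near (V \<union> W) (X \<inter> Y)"
      unfolding near_def by (simp add: eventually_conj_iff)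
    then show ?case
      by blast
  next
    case (UN K)
    then obtain X V where "X \<in> K" "countable V" "near V X"
      by blast
    have "near V (\<Union>K)"
      unfolding near_def
    proof (intro allI impI)
      fix T :: "nat \<Rightarrow> 'a \<Rightarrow>\<^sub>L 'a" and C
      assume "\<forall>n. T n \<in> bounded_operators \<and> norm (T n) \<le> C" "\<forall>v\<in>V. (\<lambda>n. T n v) \<longlonglongrightarrow> q v"
      then have "\<forall>\<^sub>F n in sequentially. T n \<in> X"
        using \<open>near V X\<close> unfolding near_def by blast
      then show "\<forall>\<^sub>F n in sequentially. T n \<in> \<Union>K"
        by (rule eventually_mono) (use \<open>X \<in> K\<close> in auto)
    qed
    then show ?case
      using \<open>countable V\<close> by blast
  next
    case (Basis X)
    then obtain x y :: "nat \<Rightarrow> 'a" and W where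
      X: "X = {T \<in> bounded_operators. (\<Sum>n. cinner (T (x n)) (y n)) \<in> W}" "open W"
      and sx: "summable (\<lambda>n. (norm (x n))\<^sup>2)" and sy: "summable (\<lambda>n. (norm (y n))\<^sup>2)"
      unfolding predual_def by auto
    have sxy: "summable (\<lambda>n. norm (x n) * norm (y n))"
    proof (rule summable_comparison_test')
      show "summable (\<lambda>n. (norm (x n))\<^sup>2 + (norm (y n))\<^sup>2)"
        by (intro summable_add sx sy)
      show "norm (norm (x n) * norm (y n)) \<le> (norm (x n))\<^sup>2 + (norm (y n))\<^sup>2" for n
      proof -
        have "0 \<le> norm (x n) * norm (y n)"
          by simp
        then show ?thesis
          using sum_squares_bound[of "norm (x n)" "norm (y n)"]
          unfolding real_norm_def abs_of_nonneg[OF \<open>0 \<le> norm (x n) * norm (y n)\<close>] by linarith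
      qed
    qed
    have "\<forall>\<^sub>F n in sequentially. T n \<in> X"
      if T: "\<forall>n::nat. T n \<in> bounded_operators \<and> norm (T n) \<le> C"
        and lim: "\<forall>v\<in>range x. (\<lambda>n. T n v) \<longlonglongrightarrow> q v" for T C
    proof -
      \<comment> \<open>Dominated convergence for series. The uniform bound \<open>C\<close> on the
        operators supplies the summable majorant.\<close>
      have "(\<lambda>n. \<Sum>k. cinner (T n (x k)) (y k)) \<longlonglongrightarrow> (\<Sum>k. cinner (q (x k)) (y k))"
      proof (rule tannerys_theorem[THEN conjunct2, THEN conjunct2])
        show "\<forall>\<^sub>F (k, n) in at_top \<times>\<^sub>F sequentially. norm (cinner (T n (x k)) (y k)) \<le> C * (norm (x k) * norm (y k))"
        proof (rule always_eventually, safe)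
          fix k n
          have "norm (cinner (T n (x k)) (y k)) \<le> norm (T n (x k)) * norm (y k)"
            by (rule norm_cinner_le)
          also have "\<dots> \<le> norm (T n) * norm (x k) * norm (y k)"
            by (intro mult_right_mono norm_blinfun) simp
          also have "\<dots> \<le> C * norm (x k) * norm (y k)"
            using T by (intro mult_right_mono) auto
          finally show "norm (cinner (T n (x k)) (y k)) \<le> C * (norm (x k) * norm (y k))"
            by (simp add: mult.assoc)
        qed
        show "summable (\<lambda>k. C * (norm (x k) * norm (y k)))"
          by (intro summable_mult sxy)
        fix k
        have "(\<lambda>n. cinner (T n (x k)) (y k) - cinner (q (x k)) (y k)) \<longlonglongrightarrow> 0"
        proof (rule Lim_null_comparison)
          show "\<forall>\<^sub>F n in sequentially. norm (cinner (T n (x k)) (y k) - cinner (q (x k)) (y k))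
              \<le> norm (T n (x k) - q (x k)) * norm (y k)"
            by (simp flip: cinner_diff_left add: norm_cinner_le)
          show "(\<lambda>n. norm (T n (x k) - q (x k)) * norm (y k)) \<longlonglongrightarrow> 0"
            using lim by (intro tendsto_mult_left_zero tendsto_norm_zero LIM_zero) auto
        qed
        then show "(\<lambda>n. cinner (T n (x k)) (y k)) \<longlonglongrightarrow> cinner (q (x k)) (y k)"
          by (rule LIM_zero_cancel)
      qed simp
      moreover have "(\<Sum>k. cinner (q (x k)) (y k)) \<in> W"
        using Basis.prems X by simp
      ultimately have "\<forall>\<^sub>F n in sequentially. (\<Sum>k. cinner (T n (x k)) (y k)) \<in> W"
        using X(2) topological_tendstoD by blast
      then show ?thesis
        by (rule eventually_mono) (use T X in auto)
    qed
    then have "near (range x) X"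
      unfolding near_def by blast
    then show ?case
      by (intro exI[of _ "range x"]) simp
  qed simp
  then show ?thesis
    unfolding near_def .
qed

text \<open>If \<open>S\<close> were outside \<open>D\<close>, the complement of \<open>D\<close>
  would be a weak* neighbourhood of \<open>S\<close>, and the bounded sequence would eventually
  enter it.\<close>

lemma closedin_weak_star_strong_limit:
  fixes S :: "'a::complex_hilbert_space \<Rightarrow>\<^sub>L 'a"
  assumes "closedin weak_star D" "\<And>n. T n \<in> D" "\<And>n. norm (T n) \<le> C" "\<And>x. (\<lambda>n. T n x) \<longlonglongrightarrow> S x"
  shows "S \<in> D"
proof (rule ccontr)
  assume "S \<notin> D"
  have D: "D \<subseteq> bounded_operators"
    using closedin_subset[OF assms(1)] by (simp add: topspace_weak_star)
  then have T: "\<forall>n. T n \<in> bounded_operators \<and> norm (T n) \<le> C"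
    using assms(2,3) by blast
  have "S \<in> bounded_operators"
    using bounded_operators_limit[of T S] T assms(4) by blast
  then have "S \<in> topspace weak_star - D"
    using \<open>S \<notin> D\<close> by (simp add: topspace_weak_star)
  from weak_star_sequential_neighbourhood[OF _ this] obtain V where
    "(\<forall>v\<in>V. (\<lambda>n. T n v) \<longlonglongrightarrow> S v) \<longrightarrow> (\<forall>\<^sub>F n in sequentially. T n \<in> topspace weak_star - D)"
    using assms(1) T by (meson closedin_def)
  then have "\<forall>\<^sub>F n in sequentially. T n \<in> topspace weak_star - D"
    using assms(4) by blast
  then show False
    using assms(2) by (simp add: eventually_sequentially)
qed

section \<open>Projections in a von Neumann algebra\<close>

locale von_neumann =
  fixes D :: "('h::complex_hilbert_space \<Rightarrow>\<^sub>L 'h) set"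
  assumes vN: "von_neumann_algebra D"
begin

lemma D_bounded_operators: "T \<in> D \<Longrightarrow> T \<in> bounded_operators"
  using vN by (auto simp: von_neumann_algebra_def subalgebra_def)

lemma D_0 [intro!, simp]: "0 \<in> D"
  using vN by (simp add: von_neumann_algebra_def subalgebra_def)

lemma D_id [intro!, simp]: "id_blinfun \<in> D"
  using vN by (simp add: von_neumann_algebra_def)

lemma D_add [intro!]: "S \<in> D \<Longrightarrow> T \<in> D \<Longrightarrow> S + T \<in> D"
  using vN by (simp add: von_neumann_algebra_def subalgebra_def)

lemma D_compose [intro!]: "S \<in> D \<Longrightarrow> T \<in> D \<Longrightarrow> S o\<^sub>L T \<in> D"
  using vN by (simp add: von_neumann_algebra_def subalgebra_def)

lemma D_scale_op [intro!]: "T \<in> D \<Longrightarrow> c \<cdot>\<^sub>C T \<in> D"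
  using vN by (simp add: von_neumann_algebra_def subalgebra_def)

lemma D_scaleR [intro!]: "T \<in> D \<Longrightarrow> r *\<^sub>R T \<in> D"
  by (simp flip: scale_op_of_real add: D_scale_op)

lemma D_diff [intro!]: "S \<in> D \<Longrightarrow> T \<in> D \<Longrightarrow> S - T \<in> D"
  using D_add[of S "(- 1) *\<^sub>R T"] D_scaleR[of T "- 1"] by simp

lemma D_adj [intro!]: "T \<in> D \<Longrightarrow> adj T \<in> D"
  using vN D_bounded_operators adj_op_eq
  by (metis selfadjoint_def von_neumann_algebra_def)

lemma D_sum [intro!]: "(\<And>i. i \<in> F \<Longrightarrow> f i \<in> D) \<Longrightarrow> sum f F \<in> D"
  by (induction F rule: infinite_finite_induct) auto

lemma D_strong_limit:
  fixes S :: "'h \<Rightarrow>\<^sub>L 'h"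
  assumes "\<And>n. T n \<in> D" "\<And>n. norm (T n) \<le> C" "\<And>x. (\<lambda>n. T n x) \<longlonglongrightarrow> S x"
  shows "S \<in> D"
  using closedin_weak_star_strong_limit[OF _ assms] vN by (simp add: von_neumann_algebra_def)

lemma D_norm_limit:
  assumes "\<And>n. T n \<in> D" "T \<longlonglongrightarrow> S"
  shows "S \<in> D"
proof -
  obtain C where "\<And>n. norm (T n) \<le> C"
    using convergent_imp_Bseq[OF convergentI[OF assms(2)]] by (auto simp: Bseq_def)
  moreover have "(\<lambda>n. T n x) \<longlonglongrightarrow> S x" for x
    by (intro tendsto_intros assms(2))
  ultimately show ?thesis
    using D_strong_limit assms(1) by blast
qed

text \<open>The projection onto the kernel of \<open>a\<close> is the strong limit of \<open>b\<^sup>2\<^sup>n\<close> for the contraction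
  \<open>b = 1 - \<epsilon> a\<^sup>2\<close>.\<close>

lemma kernel_projection:
  assumes a: "a \<in> D" "adj a = a"
  shows "\<exists>q\<in>D. projection q \<and> (\<forall>x. q x = x \<longleftrightarrow> a x = 0) \<and>
    (\<forall>c. adj c = c \<longrightarrow> a o\<^sub>L c = c o\<^sub>L a \<longrightarrow> q o\<^sub>L c = c o\<^sub>L q)"
proof -
  \<comment> \<open>Small enough for \<open>\<epsilon> * (norm a)\<^sup>2 \<le> 1\<close>, which
    makes \<open>b\<close> a contraction; the summand 1 covers \<open>a = 0\<close>.\<close>
  define \<epsilon> where "\<epsilon> = 1 / (1 + (norm a)\<^sup>2)"
  have pos1: "0 < 1 + (norm a)\<^sup>2"
    by (simp add: add_pos_nonneg)
  then have \<epsilon>: "0 < \<epsilon>" "\<epsilon> * (norm a)\<^sup>2 \<le> 1"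
    by (auto simp: \<epsilon>_def field_simps)
  define b where "b = id_blinfun - \<epsilon> *\<^sub>R (a o\<^sub>L a)"
  have b: "b \<in> D" "adj b = b"
    unfolding b_def using a by (auto simp: adj_diff adj_scaleR adj_compose)
  have b_apply: "b x = x - \<epsilon> *\<^sub>R a (a x)" for x
    by (simp add: b_def blinfun.bilinear_simps)
  \<comment> \<open>The explicit loss of norm is needed, not only contractivity: a vector whose norm
    \<open>b\<close> preserves must lie in the kernel of \<open>a\<close>.\<close>
  have contr: "(norm (b x))\<^sup>2 \<le> (norm x)\<^sup>2 - \<epsilon> * (norm (a x))\<^sup>2" for x
  proof -
    have ip: "inner (a (a x)) x = (norm (a x))\<^sup>2" "inner x (a (a x)) = (norm (a x))\<^sup>2"
      using selfadjoint_inner[OF a(2), of "a x" x] selfadjoint_inner[OF a(2), of x "a x"]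
      by (simp_all add: power2_norm_eq_inner)
    have "(norm (b x))\<^sup>2 = inner x x - 2 * \<epsilon> * (norm (a x))\<^sup>2 + \<epsilon>\<^sup>2 * inner (a (a x)) (a (a x))"
      unfolding b_apply power2_norm_eq_inner[of "x - _"]
      by (simp add: inner_diff_left inner_diff_right ip power2_eq_square algebra_simps)
    moreover have "\<epsilon>\<^sup>2 * inner (a (a x)) (a (a x)) \<le> \<epsilon> * (norm (a x))\<^sup>2"
    proof -
      have "(norm (a (a x)))\<^sup>2 \<le> (norm a * norm (a x))\<^sup>2"
        by (intro power_mono norm_blinfun) simp
      then have "\<epsilon>\<^sup>2 * (norm (a (a x)))\<^sup>2 \<le> \<epsilon>\<^sup>2 * (norm a * norm (a x))\<^sup>2"
        by (intro mult_left_mono) auto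
      also have "\<dots> = (\<epsilon> * (norm a)\<^sup>2) * (\<epsilon> * (norm (a x))\<^sup>2)"
        by (simp add: power2_eq_square mult_ac)
      also have "\<dots> \<le> 1 * (\<epsilon> * (norm (a x))\<^sup>2)"
        using \<epsilon> by (intro mult_right_mono) auto
      finally show ?thesis
        by (simp add: power2_norm_eq_inner)
    qed
    ultimately show ?thesis
      by (simp add: power2_norm_eq_inner)
  qed
  have b_le: "norm (b x) \<le> norm x" for x
  proof -
    have "0 \<le> \<epsilon> * (norm (a x))\<^sup>2"
      using \<epsilon> by simp
    then have "(norm (b x))\<^sup>2 \<le> (norm x)\<^sup>2"
      using contr[of x] by linarith
    then show ?thesis
      by (rule power2_le_imp_le) simp
  qed
  define B where "B n = ((o\<^sub>L) b ^^ n) id_blinfun" for n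
  have B_0: "B 0 = id_blinfun" and B_Suc: "B (Suc n) = b o\<^sub>L B n" for n
    by (simp_all add: B_def)
  have B_D: "B n \<in> D" for n
    by (induction n) (auto simp: B_0 B_Suc b)
  have B_comm: "B n (b x) = b (B n x)" for n x
    by (induction n) (simp_all add: B_0 B_Suc)
  have B_sa: "inner (B n x) y = inner x (B n y)" for n x y
    by (induction n arbitrary: x y) (simp_all add: B_0 B_Suc selfadjoint_inner[OF b(2)] B_comm)
  have B_plus: "B (m + n) x = B m (B n x)" for m n x
    by (induction m) (simp_all add: B_0 B_Suc)
  have B_contr: "norm (B n x) \<le> norm x" for n x
    by (induction n) (auto simp: B_0 B_Suc intro: order_trans[OF b_le])
  \<comment> \<open>Even powers are taken because \<open>inner (B (2 * m) x) (B (2 * n) x)\<close>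
    is the square \<open>d (m + n)\<close>. As \<open>d\<close> decreases to a limit, distances
    between even powers tend to 0.\<close>
  have Cauchy: "Cauchy (\<lambda>n. B (2 * n) x)" for x
  proof -
    define d where "d n = (norm (B n x))\<^sup>2" for n
    have inner_B: "inner (B (2 * m) x) (B (2 * n) x) = d (m + n)" for m n
    proof -
      have "inner (B (2 * m) x) (B (2 * n) x) = inner x (B (2 * m + 2 * n) x)"
        by (simp add: B_sa B_plus)
      also have "2 * m + 2 * n = (m + n) + (m + n)"
        by simp
      also have "inner x (B \<dots> x) = d (m + n)"
        unfolding d_def power2_norm_eq_inner B_plus[of "m + n" "m + n"] B_sa ..
      finally show ?thesis .
    qed
    have "decseq d"
      by (rule decseq_SucI) (auto simp: d_def B_Suc intro: power_mono b_le)
    moreover have "bounded (range d)"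
      by (rule bounded_subset[of "{0..d 0}"])
        (use decseqD[OF \<open>decseq d\<close>] in \<open>auto simp: d_def\<close>)
    ultimately obtain l where l: "d \<longlonglongrightarrow> l" "\<And>n. l \<le> d n"
      by (metis decseq_convergent decseq_ge bounded_imp_bdd_below bdd_below.E rangeI)
    have dist: "(norm (B (2 * m) x - B (2 * n) x))\<^sup>2 \<le> (d (2 * m) - l) + (d (2 * n) - l)" for m n
    proof -
      have "(norm (B (2 * m) x - B (2 * n) x))\<^sup>2 = d (2 * m) - 2 * d (m + n) + d (2 * n)"
        using inner_B[of m n] inner_B[of n m] inner_B[of m m] inner_B[of n n]
        unfolding power2_norm_eq_inner inner_diff_left inner_diff_right mult_2
        by (simp add: add.commute)
      then show ?thesis
        using l(2)[of "m + n"] by simp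
    qed
    show ?thesis
    proof (rule CauchyI)
      fix e :: real
      assume "0 < e"
      then have "\<forall>\<^sub>F n in sequentially. d n < l + e\<^sup>2 / 2"
        using order_tendstoD(2)[OF l(1), of "l + e\<^sup>2 / 2"] by simp
      then obtain N where N: "\<And>n. N \<le> n \<Longrightarrow> d n < l + e\<^sup>2 / 2"
        by (auto simp: eventually_sequentially)
      have "norm (B (2 * m) x - B (2 * n) x) < e" if "N \<le> m" "N \<le> n" for m n
      proof -
        have "(norm (B (2 * m) x - B (2 * n) x))\<^sup>2 < e\<^sup>2"
          using dist[of m n] N[of "2 * m"] N[of "2 * n"] that by simp
        then show ?thesis
          using \<open>0 < e\<close> by (simp add: power_less_imp_less_base)
      qed
      then show "\<exists>M. \<forall>m\<ge>M. \<forall>n\<ge>M. norm (B (2 * m) x - B (2 * n) x) < e"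
        by blast
    qed
  qed
  define L where "L x = lim (\<lambda>n. B (2 * n) x)" for x
  have L: "(\<lambda>n. B (2 * n) x) \<longlonglongrightarrow> L x" for x
    unfolding L_def using Cauchy by (simp add: Cauchy_convergent convergent_LIMSEQ_iff[THEN iffD1])
  have "bounded_linear L"
  proof (rule bounded_linear_intro)
    show "L (x + y) = L x + L y" for x y
      by (rule LIMSEQ_unique[OF L]) (simp add: blinfun.bilinear_simps tendsto_add L)
    show "L (r *\<^sub>R x) = r *\<^sub>R L x" for r x
      by (rule LIMSEQ_unique[OF L]) (simp add: blinfun.bilinear_simps tendsto_scaleR L)
    show "norm (L x) \<le> norm x * 1" for x
      by (rule LIMSEQ_le_const2[OF tendsto_norm[OF L]]) (auto simp: B_contr)
  qed
  then have q_apply: "Blinfun L x = L x" for x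
    by (simp add: bounded_linear_Blinfun_apply)
  define q where "q = Blinfun L"
  have q_lim: "(\<lambda>n. B (2 * n) x) \<longlonglongrightarrow> q x" for x
    by (simp add: q_def q_apply L)
  have "q \<in> D"
    by (rule D_strong_limit[of "\<lambda>n. B (2 * n)" 1])
      (auto simp: B_D q_lim B_contr intro!: norm_blinfun_bound)
  have a_q: "a (q x) = 0" for x
  proof -
    have "b (b (q x)) = q x"
    proof (rule LIMSEQ_unique)
      show "(\<lambda>n. B (2 * Suc n) x) \<longlonglongrightarrow> b (b (q x))"
        by (simp add: B_Suc tendsto_intros q_lim blinfun.tendsto)
      show "(\<lambda>n. B (2 * Suc n) x) \<longlonglongrightarrow> q x"
        by (rule LIMSEQ_Suc[OF q_lim])
    qed
    then have "(norm (q x))\<^sup>2 \<le> (norm (b (q x)))\<^sup>2"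
      using b_le[of "b (q x)"] by (simp add: power_mono)
    with contr[of "q x"] have "\<epsilon> * (norm (a (q x)))\<^sup>2 \<le> 0"
      by linarith
    then show ?thesis
      using \<epsilon>(1) by (simp add: mult_le_0_iff)
  qed
  have q_ker: "q x = x" if "a x = 0" for x
  proof -
    have "B n x = x" for n
      using that by (induction n) (simp_all add: B_0 B_Suc b_apply)
    then show ?thesis
      using q_lim[of x] by (simp add: LIMSEQ_const_iff)
  qed
  have "adj q = q"
  proof (rule adj_eqI)
    fix x y
    have "(\<lambda>n. inner (B (2 * n) x) y) \<longlonglongrightarrow> inner (q x) y"
      by (intro tendsto_intros q_lim)
    moreover have "(\<lambda>n. inner x (B (2 * n) y)) \<longlonglongrightarrow> inner x (q y)"
      by (intro tendsto_intros q_lim)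
    ultimately show "inner (q x) y = inner x (q y)"
      unfolding B_sa by (rule LIMSEQ_unique)
  qed
  then have "projection q"
    unfolding projection_def by (auto intro!: blinfun_eqI simp: q_ker a_q)
  moreover have "q o\<^sub>L c = c o\<^sub>L q" if c: "adj c = c" "a o\<^sub>L c = c o\<^sub>L a" for c
  proof -
    have "a (c (q x)) = 0" for x
      using a_q[of x] c(2) by (metis blinfun.zero_right blinfun_apply_blinfun_compose)
    then have "q (c (q x)) = c (q x)" for x
      by (rule q_ker)
    then show ?thesis
      by (intro blinfun_eqI) (simp add: projection_commute[OF \<open>projection q\<close> c(1)])
  qed
  ultimately show ?thesis
    using \<open>q \<in> D\<close> by (metis a_q q_ker)
qed

text \<open>The root of \<open>a = 1 - z\<close> is \<open>1 - y\<close>, where \<open>y = (z + y\<^sup>2) / 2\<close> is found by iteration; the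
  scalar iteration for \<open>z = 1\<close>, which converges, majorizes it.\<close>

lemma positive_square_root:
  assumes a: "a \<in> D" "adj a = a" "norm (id_blinfun - a) \<le> 1"
  shows "\<exists>s\<in>D. adj s = s \<and> s o\<^sub>L s = a \<and> (\<forall>x. 0 \<le> inner (s x) x) \<and>
    (\<forall>c. a o\<^sub>L c = c o\<^sub>L a \<longrightarrow> s o\<^sub>L c = c o\<^sub>L s)"
proof -
  define z where "z = id_blinfun - a"
  define y where "y = rec_nat (0 :: 'h \<Rightarrow>\<^sub>L 'h) (\<lambda>_ u. (1/2) *\<^sub>R (z + (u o\<^sub>L u)))"
  define t where "t = rec_nat (0 :: real) (\<lambda>_ u. (1 + u\<^sup>2) / 2)"
  have y_0: "y 0 = 0" and y_Suc: "y (Suc n) = (1/2) *\<^sub>R (z + (y n o\<^sub>L y n))" for n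
    by (simp_all add: y_def)
  have t_0: "t 0 = 0" and t_Suc: "t (Suc n) = (1 + (t n)\<^sup>2) / 2" for n
    by (simp_all add: t_def)
  have z: "z \<in> D" "adj z = z" "norm z \<le> 1"
    using a by (auto simp: z_def adj_diff)
  have t_bounds: "0 \<le> t n" "t n \<le> 1" for n
  proof (induction n)
    case (Suc n)
    then have "(t n)\<^sup>2 \<le> 1"
      by (simp add: power_le_one)
    {
      case 1
      show ?case
        by (simp add: t_Suc)
    next
      case 2
      show ?case
        using \<open>(t n)\<^sup>2 \<le> 1\<close> by (simp add: t_Suc)
    }
  qed (simp_all add: t_0)
  have t_mono: "t n \<le> t (Suc n)" for n
    using zero_le_power2[of "t n - 1"] by (simp add: t_Suc power2_eq_square algebra_simps)
  then have "incseq t"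
    by (rule incseq_SucI)
  moreover have "bounded (range t)"
    by (rule bounded_subset[of "{0..1}"]) (auto simp: t_bounds)
  ultimately have "convergent t"
    using t_bounds by (metis incseq_convergent convergentI)
  have y_D: "y n \<in> D" for n
    by (induction n) (auto simp: y_0 y_Suc z)
  have y_sa: "adj (y n) = y n" for n
    by (induction n) (simp_all add: y_0 y_Suc adj_add adj_scaleR adj_compose z)
  have y_norm: "norm (y n) \<le> t n" for n
  proof (induction n)
    case (Suc n)
    have "norm (y (Suc n)) \<le> (1/2) * (norm z + norm (y n o\<^sub>L y n))"
      by (simp add: y_Suc norm_triangle_ineq)
    also have "norm (y n o\<^sub>L y n) \<le> norm (y n) * norm (y n)"
      by (rule norm_blinfun_compose)
    also have "\<dots> \<le> t n * t n"
      using Suc t_bounds by (intro mult_mono) auto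
    finally show ?case
      using z(3) by (simp add: t_Suc power2_eq_square)
  qed (simp add: y_0 t_0)
  have y_step: "norm (y (Suc n) - y n) \<le> t (Suc n) - t n" for n
  proof (induction n)
    case 0
    then show ?case
      using y_norm[of 1] by (simp add: y_0 t_0)
  next
    case (Suc n)
    let ?d = "y (Suc n) - y n"
    \<comment> \<open>Splitting the difference of squares in this order avoids commuting the
      iterates; the scalar counterpart of the bound telescopes to the difference of squares of
      \<open>t\<close>.\<close>
    have "y (Suc (Suc n)) - y (Suc n) = (1/2) *\<^sub>R ((?d o\<^sub>L y (Suc n)) + (y n o\<^sub>L ?d))"
      by (rule blinfun_eqI, unfold y_Suc[of "Suc n"], subst (2) y_Suc[of n])
        (simp add: blinfun.bilinear_simps algebra_simps)
    then have "norm (y (Suc (Suc n)) - y (Suc n)) \<le> (1/2) * (norm (?d o\<^sub>L y (Suc n)) + norm (y n o\<^sub>L ?d))"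
      by (simp add: norm_triangle_ineq)
    also have "\<dots> \<le> (1/2) * (norm ?d * norm (y (Suc n)) + norm (y n) * norm ?d)"
      by (intro mult_left_mono add_mono norm_blinfun_compose) auto
    also have "\<dots> \<le> (1/2) * ((t (Suc n) - t n) * t (Suc n) + t n * (t (Suc n) - t n))"
      using Suc y_norm t_bounds t_mono by (intro mult_left_mono add_mono mult_mono) auto
    also have "\<dots> = ((t (Suc n))\<^sup>2 - (t n)\<^sup>2) / 2"
      by (simp add: power2_eq_square algebra_simps)
    also have "\<dots> = t (Suc (Suc n)) - t (Suc n)"
      by (simp add: t_Suc[of "Suc n"]) (simp add: t_Suc[of n] diff_divide_distrib add_divide_distrib)
    finally show ?case .
  qed
  have y_dist: "norm (y (n + k) - y n) \<le> t (n + k) - t n" for n k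
  proof (induction k)
    case (Suc k)
    have "norm (y (n + Suc k) - y n) \<le> norm (y (Suc (n + k)) - y (n + k)) + norm (y (n + k) - y n)"
      using norm_triangle_ineq[of "y (Suc (n + k)) - y (n + k)" "y (n + k) - y n"] by simp
    also have "\<dots> \<le> t (n + Suc k) - t n"
      using y_step[of "n + k"] Suc by simp
    finally show ?case .
  qed simp
  have "Cauchy y"
  proof (rule CauchyI')
    fix e :: real
    assume "0 < e"
    then obtain M where M: "\<And>m n. M \<le> m \<Longrightarrow> M \<le> n \<Longrightarrow> norm (t m - t n) < e"
      using CauchyD[OF convergent_Cauchy[OF \<open>convergent t\<close>]] by metis
    have "dist (y m) (y n) < e" if "M \<le> m" "m < n" for m n
    proof -
      obtain k where k: "n = m + k"
        using \<open>m < n\<close> less_imp_add_positive by blast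
      have "norm (y n - y m) \<le> t n - t m"
        unfolding k by (rule y_dist)
      also have "\<dots> < e"
        using M[of n m] that by simp
      finally show ?thesis
        by (simp add: dist_norm norm_minus_commute)
    qed
    then show "\<exists>M. \<forall>m\<ge>M. \<forall>n>m. dist (y m) (y n) < e"
      by blast
  qed
  then obtain u where u: "y \<longlonglongrightarrow> u"
    by (auto simp: Cauchy_convergent_iff convergent_def)
  have "u \<in> D"
    using D_norm_limit[OF y_D u] .
  have u_eq: "u = (1/2) *\<^sub>R (z + (u o\<^sub>L u))"
  proof (rule LIMSEQ_unique)
    show "(\<lambda>n. y (Suc n)) \<longlonglongrightarrow> u"
      by (rule LIMSEQ_Suc[OF u])
    show "(\<lambda>n. y (Suc n)) \<longlonglongrightarrow> (1/2) *\<^sub>R (z + (u o\<^sub>L u))"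
      unfolding y_Suc
      by (intro tendsto_intros bounded_bilinear.tendsto[OF bounded_bilinear_blinfun_compose] u)
  qed
  have "adj u = u"
  proof (rule adj_eqI)
    fix v w
    have "(\<lambda>n. inner (y n v) w) \<longlonglongrightarrow> inner (u v) w" "(\<lambda>n. inner v (y n w)) \<longlonglongrightarrow> inner v (u w)"
      by (intro tendsto_intros u)+
    then show "inner (u v) w = inner v (u w)"
      by (simp add: selfadjoint_inner[OF y_sa] LIMSEQ_unique)
  qed
  have "norm u \<le> 1"
    using y_norm t_bounds(2) order_trans by (intro LIMSEQ_le_const2[OF tendsto_norm[OF u]]) blast
  define s where "s = id_blinfun - u"
  have "s \<in> D" "adj s = s"
    using \<open>u \<in> D\<close> \<open>adj u = u\<close> by (auto simp: s_def adj_diff)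
  moreover have "s o\<^sub>L s = a"
  proof (rule blinfun_eqI)
    fix x
    have "2 *\<^sub>R u x = 2 *\<^sub>R ((1/2) *\<^sub>R (z + (u o\<^sub>L u))) x"
      by (subst u_eq) (rule refl)
    then have "2 *\<^sub>R u x = z x + u (u x)"
      by (simp add: blinfun.bilinear_simps)
    then show "(s o\<^sub>L s) x = a x"
      by (simp add: s_def z_def blinfun.bilinear_simps scaleR_2 algebra_simps)
  qed
  moreover have "0 \<le> inner (s x) x" for x
  proof -
    have "norm u * (norm x)\<^sup>2 \<le> 1 * (norm x)\<^sup>2"
      by (intro mult_right_mono \<open>norm u \<le> 1\<close>) simp
    then show ?thesis
      using abs_quadratic_le[of u x]
      by (simp add: s_def blinfun.bilinear_simps inner_diff_left flip: power2_norm_eq_inner)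
  qed
  moreover have "s o\<^sub>L c = c o\<^sub>L s" if c: "a o\<^sub>L c = c o\<^sub>L a" for c
  proof -
    have ac: "a (c x) = c (a x)" for x
      using c by (metis blinfun_apply_blinfun_compose)
    have yc: "y n (c x) = c (y n x)" for n x
      by (induction n arbitrary: x) (simp_all add: y_0 y_Suc z_def blinfun.bilinear_simps ac)
    have "u (c x) = c (u x)" for x
    proof (rule LIMSEQ_unique)
      show "(\<lambda>n. y n (c x)) \<longlonglongrightarrow> u (c x)"
        by (intro tendsto_intros u)
      show "(\<lambda>n. y n (c x)) \<longlonglongrightarrow> c (u x)"
        unfolding yc by (intro tendsto_intros u)
    qed
    then show ?thesis
      by (intro blinfun_eqI) (simp add: s_def blinfun.bilinear_simps)
  qed
  ultimately show ?thesis
    by blast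
qed

text \<open>With \<open>k\<close> a positive multiple of \<open>a\<close> and \<open>s\<close> the
  root of \<open>k o\<^sub>L k\<close>, the operator \<open>s\<close> is the absolute value of
  \<open>k\<close>. The projection \<open>q\<close> onto the kernel of \<open>s + k\<close> is where
  \<open>k = - s \<le> 0\<close>, and on the range of its complement \<open>p\<close> one has
  \<open>k = s \<ge> 0\<close>.\<close>

lemma spectral_projection:
  assumes a: "a \<in> D" "adj a = a"
  shows "\<exists>p\<in>D. projection p \<and> (\<forall>c. adj c = c \<longrightarrow> a o\<^sub>L c = c o\<^sub>L a \<longrightarrow> p o\<^sub>L c = c o\<^sub>L p) \<and>
    (\<forall>x. p x = x \<longrightarrow> 0 \<le> inner (a x) x) \<and> (\<forall>x. p x = 0 \<longrightarrow> inner (a x) x \<le> 0)"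
proof -
  \<comment> \<open>Scaling \<open>a\<close> to a contraction \<open>k\<close> brings
    \<open>k o\<^sub>L k\<close> into the range of \<open>positive_square_root\<close>.\<close>
  define r where "r = 1 / (1 + norm a)"
  have "0 < r" "r * norm a \<le> 1"
    by (auto simp: r_def add_pos_nonneg divide_le_eq)
  define k where "k = r *\<^sub>R a"
  have k: "k \<in> D" "adj k = k" "norm k \<le> 1"
    using a \<open>0 < r\<close> \<open>r * norm a \<le> 1\<close> by (auto simp: k_def adj_scaleR)
  have "norm (id_blinfun - (k o\<^sub>L k)) \<le> 1"
  proof (rule norm_le_quadratic)
    show "adj (id_blinfun - (k o\<^sub>L k)) = id_blinfun - (k o\<^sub>L k)"
      by (simp add: adj_diff adj_compose k)
    fix x
    have "inner ((id_blinfun - (k o\<^sub>L k)) x) x = (norm x)\<^sup>2 - (norm (k x))\<^sup>2"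
      by (simp add: blinfun.bilinear_simps inner_diff_left power2_norm_eq_inner selfadjoint_inner[OF k(2)])
    moreover have "norm (k x) \<le> norm x"
      using norm_blinfun[of k x] mult_right_mono[OF k(3), of "norm x"] by simp
    then have "(norm (k x))\<^sup>2 \<le> (norm x)\<^sup>2"
      by (simp add: power_mono)
    ultimately show "\<bar>inner ((id_blinfun - (k o\<^sub>L k)) x) x\<bar> \<le> 1 * (norm x)\<^sup>2"
      by simp
  qed simp
  moreover have "k o\<^sub>L k \<in> D" "adj (k o\<^sub>L k) = k o\<^sub>L k"
    using k by (auto simp: adj_compose)
  ultimately obtain s where s: "s \<in> D" "adj s = s" "s o\<^sub>L s = k o\<^sub>L k"
    "\<And>x. 0 \<le> inner (s x) x" and s_comm: "\<And>c. (k o\<^sub>L k) o\<^sub>L c = c o\<^sub>L (k o\<^sub>L k) \<Longrightarrow> s o\<^sub>L c = c o\<^sub>L s"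
    using positive_square_root by metis
  have sk: "s o\<^sub>L k = k o\<^sub>L s"
    by (rule s_comm) (auto intro: blinfun_eqI)
  have "s + k \<in> D" "adj (s + k) = s + k"
    using s k by (auto simp: adj_add)
  from kernel_projection[OF this] obtain q where q: "q \<in> D" "projection q"
    "\<And>x. q x = x \<longleftrightarrow> (s + k) x = 0"
    "\<And>c. adj c = c \<Longrightarrow> (s + k) o\<^sub>L c = c o\<^sub>L (s + k) \<Longrightarrow> q o\<^sub>L c = c o\<^sub>L q"
    by blast
  define p where "p = id_blinfun - q"
  have "p \<in> D" "projection p"
    using q projection_complement by (auto simp: p_def)
  moreover have "p o\<^sub>L c = c o\<^sub>L p" if c: "adj c = c" "a o\<^sub>L c = c o\<^sub>L a" for c
  proof -
    have ac: "a (c x) = c (a x)" for x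
      using c(2) by (metis blinfun_apply_blinfun_compose)
    then have kc: "k (c x) = c (k x)" for x
      by (simp add: k_def blinfun.bilinear_simps)
    have "s o\<^sub>L c = c o\<^sub>L s"
      by (rule s_comm) (auto intro!: blinfun_eqI simp: kc)
    then have "s (c x) = c (s x)" for x
      by (metis blinfun_apply_blinfun_compose)
    then have "q o\<^sub>L c = c o\<^sub>L q"
      by (intro q(4) c(1) blinfun_eqI) (simp add: blinfun.bilinear_simps kc)
    then have "q (c x) = c (q x)" for x
      by (metis blinfun_apply_blinfun_compose)
    then show ?thesis
      by (intro blinfun_eqI) (simp add: p_def blinfun.bilinear_simps)
  qed
  moreover have "0 \<le> inner (a x) x" if "p x = x" for x
  proof -
    have "q x = 0"
      using that by (simp add: p_def blinfun.bilinear_simps)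
    \<comment> \<open>As \<open>s\<close> and \<open>k\<close> commute and have equal squares,
      \<open>s - k\<close> maps into the kernel of \<open>s + k\<close>, which is the range of
      \<open>q\<close>; and \<open>x\<close> is orthogonal to that.\<close>
    have "inner ((s - k) x) y = 0" for y
    proof -
      have sk_apply: "s (k v) = k (s v)" "s (s v) = k (k v)" for v
        using sk s(3) by (metis blinfun_apply_blinfun_compose)+
      have "(s + k) ((s - k) y) = 0"
        by (simp add: blinfun.bilinear_simps sk_apply)
      then have "q ((s - k) y) = (s - k) y"
        using q(3) by blast
      then have "inner x ((s - k) y) = inner (q x) ((s - k) y)"
        by (metis projection_inner[OF q(2)])
      then show ?thesis
        using \<open>q x = 0\<close> selfadjoint_inner[of "s - k" x y] s k by (simp add: adj_diff)
    qed
    then have "(s - k) x = 0"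
      using inner_eq_zero_iff by blast
    then have "s x = r *\<^sub>R a x"
      by (simp add: k_def blinfun.bilinear_simps)
    then show ?thesis
      using s(4)[of x] \<open>0 < r\<close> by (simp add: zero_le_mult_iff)
  qed
  moreover have "inner (a x) x \<le> 0" if "p x = 0" for x
  proof -
    have "q x = x"
      using that by (simp add: p_def blinfun.bilinear_simps)
    then have "s x = - (r *\<^sub>R a x)"
      using q(3) by (simp add: k_def blinfun.bilinear_simps eq_neg_iff_add_eq_0)
    then show ?thesis
      using s(4)[of x] \<open>0 < r\<close> by (simp add: mult_le_0_iff)
  qed
  ultimately show ?thesis
    by blast
qed

text \<open>Every selfadjoint element is a norm convergent combination of projections, by dyadic
  expansion.\<close>

lemma functional_vanishes:
  fixes f :: "('h \<Rightarrow>\<^sub>L 'h) \<Rightarrow> real"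
  assumes add: "\<And>a b. a \<in> D \<Longrightarrow> b \<in> D \<Longrightarrow> f (a + b) = f a + f b"
    and scale: "\<And>r a. a \<in> D \<Longrightarrow> f (r *\<^sub>R a) = r * f a"
    and bound: "\<And>a. a \<in> D \<Longrightarrow> adj a = a \<Longrightarrow> \<bar>f a\<bar> \<le> C * norm a"
    and proj: "\<And>p. p \<in> D \<Longrightarrow> projection p \<Longrightarrow> f p = 0"
    and a: "a \<in> D" "adj a = a"
  shows "f a = 0"
proof -
  have C: "0 \<le> \<bar>C\<bar>" "\<And>a. a \<in> D \<Longrightarrow> adj a = a \<Longrightarrow> \<bar>f a\<bar> \<le> \<bar>C\<bar> * norm a"
    using order_trans[OF bound mult_right_mono[OF abs_ge_self norm_ge_zero]] by auto
  have dyadic: "\<bar>f a\<bar> \<le> \<bar>C\<bar> * c / 2 ^ n"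
    if "a \<in> D" "adj a = a" "0 \<le> c" "\<And>x. 0 \<le> inner (a x) x" "\<And>x. inner (a x) x \<le> c * (norm x)\<^sup>2"
    for a c n
    using that
  proof (induction n arbitrary: a c)
    case 0
    have "norm a \<le> c"
      using 0 by (intro norm_le_quadratic) auto
    then show ?case
      using order_trans[OF C(2)[OF 0(1,2)] mult_left_mono[OF \<open>norm a \<le> c\<close> C(1)]] by simp
  next
    case (Suc n)
    \<comment> \<open>If \<open>0 \<le> a \<le> c\<close> and \<open>p\<close> cuts \<open>a\<close>
      at \<open>c/2\<close>, then \<open>a - (c/2) *\<^sub>R p\<close> lies between 0 and
      \<open>c/2\<close>. Since \<open>f\<close> vanishes on \<open>p\<close>, the value of
      \<open>f\<close> is unchanged while the bound is halved.\<close>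
    define h where "h = a - (c/2) *\<^sub>R id_blinfun"
    have "h \<in> D" "adj h = h"
      using Suc.prems by (auto simp: h_def adj_diff adj_scaleR)
    from spectral_projection[OF this] obtain p where p: "p \<in> D" "projection p"
      "\<And>c. adj c = c \<Longrightarrow> h o\<^sub>L c = c o\<^sub>L h \<Longrightarrow> p o\<^sub>L c = c o\<^sub>L p"
      "\<And>x. p x = x \<Longrightarrow> 0 \<le> inner (h x) x" "\<And>x. p x = 0 \<Longrightarrow> inner (h x) x \<le> 0"
      by blast
    have "p o\<^sub>L a = a o\<^sub>L p"
      using Suc.prems by (intro p(3) blinfun_eqI) (auto simp: h_def blinfun.bilinear_simps)
    then have pa: "p (a x) = a (p x)" for x
      by (metis blinfun_apply_blinfun_compose)
    define b where "b = a - (c/2) *\<^sub>R p"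
    have b: "b \<in> D" "adj b = b"
      using Suc.prems p by (auto simp: b_def adj_diff adj_scaleR projection_adj)
    have "0 \<le> inner (b x) x \<and> inner (b x) x \<le> (c/2) * (norm x)\<^sup>2" for x
    proof -
      let ?v = "x - p x"
      have pv: "p ?v = 0" "p (p x) = p x"
        by (simp_all add: blinfun.bilinear_simps projection_idem[OF p(2)])
      have "inner (a (p x)) ?v = 0" "inner (a ?v) (p x) = 0"
        by (metis pa pv inner_zero_left inner_zero_right projection_inner[OF p(2)] blinfun.zero_right)+
      then have split: "inner (a x) x = inner (a (p x)) (p x) + inner (a ?v) ?v"
        by (simp add: blinfun.bilinear_simps inner_diff_left inner_diff_right)
      have h: "inner (h u) u = inner (a u) u - (c/2) * (norm u)\<^sup>2" for u
        by (simp add: h_def blinfun.diff_left blinfun.scaleR_left inner_diff_left power2_norm_eq_inner)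
      have "(c/2) * (norm (p x))\<^sup>2 \<le> inner (a (p x)) (p x)"
        using p(4)[OF pv(2)] h[of "p x"] by simp
      moreover have "inner (a ?v) ?v \<le> (c/2) * (norm ?v)\<^sup>2"
        using p(5)[OF pv(1)] h[of ?v] by simp
      moreover have "inner (b x) x = inner (a x) x - (c/2) * (norm (p x))\<^sup>2"
        by (simp add: b_def blinfun.bilinear_simps inner_diff_left projection_quadratic[OF p(2)])
      moreover have "(norm x)\<^sup>2 = (norm (p x))\<^sup>2 + (norm ?v)\<^sup>2"
        by (rule projection_pythagoras[OF p(2)])
      ultimately show ?thesis
        using Suc.prems(4)[of ?v] Suc.prems(5)[of "p x"] split by (auto simp: algebra_simps)
    qed
    then have "\<bar>f b\<bar> \<le> \<bar>C\<bar> * (c/2) / 2 ^ n"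
      using Suc.prems b by (intro Suc.IH) auto
    moreover have "f a = f b + (c/2) * f p"
      using add[of b "(c/2) *\<^sub>R p"] scale[of p "c/2"] b p by (auto simp: b_def)
    ultimately show ?case
      by (simp add: proj p)
  qed
  have zero: "f a = 0"
    if "a \<in> D" "adj a = a" "0 \<le> c" "\<And>x. 0 \<le> inner (a x) x" "\<And>x. inner (a x) x \<le> c * (norm x)\<^sup>2"
    for a c
  proof -
    have "(\<lambda>n. \<bar>C\<bar> * c / 2 ^ n) \<longlonglongrightarrow> 0"
      by (rule LIMSEQ_divide_realpow_zero) simp
    then have "\<bar>f a\<bar> \<le> 0"
      by (rule LIMSEQ_le_const) (use dyadic[OF that] in blast)
    then show ?thesis
      by simp
  qed
  \<comment> \<open>A selfadjoint \<open>a\<close> becomes positive after adding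
    \<open>norm a\<close> times the identity, so the positive case is applied to the sum and to the
    shift.\<close>
  have id: "f (norm a *\<^sub>R id_blinfun) = 0"
    by (rule zero[where c = "norm a"])
      (auto simp: adj_scaleR blinfun.bilinear_simps power2_norm_eq_inner)
  have "f (a + norm a *\<^sub>R id_blinfun) = 0"
  proof (rule zero[where c = "2 * norm a"])
    fix x
    have "inner ((a + norm a *\<^sub>R id_blinfun) x) x = inner (a x) x + norm a * (norm x)\<^sup>2"
      by (simp add: blinfun.bilinear_simps inner_add_left power2_norm_eq_inner)
    then show "0 \<le> inner ((a + norm a *\<^sub>R id_blinfun) x) x"
      and "inner ((a + norm a *\<^sub>R id_blinfun) x) x \<le> 2 * norm a * (norm x)\<^sup>2"
      using abs_quadratic_le[of a x] by auto
  qed (use a in \<open>auto simp: adj_add adj_scaleR\<close>)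
  moreover have "f (a + norm a *\<^sub>R id_blinfun) = f a + f (norm a *\<^sub>R id_blinfun)"
    using a by (intro add) auto
  ultimately show ?thesis
    using id by simp
qed

end

section \<open>Positive projections onto a von Neumann algebra are bimodule maps\<close>

locale normal_expectation = von_neumann D for D :: "('h::complex_hilbert_space \<Rightarrow>\<^sub>L 'h) set" +
  fixes \<Psi> :: "('h \<Rightarrow>\<^sub>L 'h) \<Rightarrow> ('h \<Rightarrow>\<^sub>L 'h)"
  assumes in_D: "T \<in> bounded_operators \<Longrightarrow> \<Psi> T \<in> D"
    and linear: "linear_map_on bounded_operators \<Psi>"
    and positive: "positive_op T \<Longrightarrow> positive_op (\<Psi> T)"
    and normal: "continuous_map weak_star (subtopology weak_star D) \<Psi>"
    and fixes_D: "d \<in> D \<Longrightarrow> \<Psi> d = d"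
begin

section \<open>Order and norm estimates for the positive projection\<close>

lemma \<Psi>_add: "S \<in> bounded_operators \<Longrightarrow> T \<in> bounded_operators \<Longrightarrow> \<Psi> (S + T) = \<Psi> S + \<Psi> T"
  using linear by (simp add: linear_map_on_def)

lemma \<Psi>_scale_op: "T \<in> bounded_operators \<Longrightarrow> \<Psi> (c \<cdot>\<^sub>C T) = c \<cdot>\<^sub>C \<Psi> T"
  using linear by (simp add: linear_map_on_def)

lemma \<Psi>_scaleR: "T \<in> bounded_operators \<Longrightarrow> \<Psi> (r *\<^sub>R T) = r *\<^sub>R \<Psi> T"
  by (simp add: \<Psi>_scale_op flip: scale_op_of_real)

lemma \<Psi>_diff:
  assumes "S \<in> bounded_operators" "T \<in> bounded_operators"
  shows "\<Psi> (S - T) = \<Psi> S - \<Psi> T"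
  using \<Psi>_add[of "S - T" T] assms by (simp add: bounded_operators_diff)

lemma \<Psi>_bounded_operators [simp]: "T \<in> bounded_operators \<Longrightarrow> \<Psi> T \<in> bounded_operators"
  using D_bounded_operators in_D by blast

lemma \<Psi>_0: "\<Psi> 0 = 0"
  by (simp add: fixes_D)

lemma \<Psi>_nonneg:
  assumes "T \<in> bounded_operators" "adj T = T" "\<And>x. 0 \<le> inner (T x) x"
  shows "adj (\<Psi> T) = \<Psi> T" "0 \<le> inner (\<Psi> T x) x"
  using positive[of T] assms by (auto simp: positive_op_iff)

lemma \<Psi>_selfadjoint:
  assumes T: "T \<in> bounded_operators" "adj T = T"
  shows "adj (\<Psi> T) = \<Psi> T"
proof -
  let ?S = "T + norm T *\<^sub>R id_blinfun"
  have S: "?S \<in> bounded_operators"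
    using T by (intro bounded_operators_add bounded_operators_scaleR) auto
  have "adj (\<Psi> ?S) = \<Psi> ?S"
  proof (rule \<Psi>_nonneg)
    show "0 \<le> inner (?S x) x" for x
      using abs_quadratic_le[of T x]
      by (simp add: blinfun.bilinear_simps inner_add_left power2_norm_eq_inner)
  qed (use S T in \<open>auto simp: adj_add adj_scaleR\<close>)
  moreover have "\<Psi> ?S = \<Psi> T + norm T *\<^sub>R id_blinfun"
    using T by (simp add: \<Psi>_add \<Psi>_scaleR fixes_D bounded_operators_scaleR)
  ultimately show ?thesis
    by (simp add: adj_add adj_scaleR)
qed

lemma \<Psi>_mono:
  assumes "S \<in> bounded_operators" "T \<in> bounded_operators" "adj S = S" "adj T = T"
    and "\<And>x. inner (S x) x \<le> inner (T x) x"
  shows "inner (\<Psi> S x) x \<le> inner (\<Psi> T x) x"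
proof -
  have "0 \<le> inner (\<Psi> (T - S) x) x"
    using assms by (intro \<Psi>_nonneg) (auto simp: adj_diff blinfun.bilinear_simps inner_diff_left)
  then show ?thesis
    using assms by (simp add: \<Psi>_diff blinfun.bilinear_simps inner_diff_left)
qed

text \<open>The operator lies between \<open>- norm T\<close> and \<open>norm T\<close> times the
  identity, and \<open>\<Psi>\<close> preserves order and fixes the identity.\<close>

lemma norm_\<Psi>_selfadjoint:
  assumes T: "T \<in> bounded_operators" "adj T = T"
  shows "norm (\<Psi> T) \<le> norm T"
proof (rule norm_le_quadratic)
  fix x
  have bound: "inner (S x) x \<le> inner ((norm S *\<^sub>R id_blinfun) x) x" for S :: "'h \<Rightarrow>\<^sub>L 'h" and x
    using abs_quadratic_le[of S x] by (simp add: blinfun.bilinear_simps power2_norm_eq_inner)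
  have \<Psi>_id: "\<Psi> (r *\<^sub>R id_blinfun) = r *\<^sub>R id_blinfun" for r
    by (simp add: fixes_D D_scaleR)
  have le: "inner (\<Psi> S x) x \<le> norm S * (norm x)\<^sup>2"
    if "S \<in> bounded_operators" "adj S = S" for S :: "'h \<Rightarrow>\<^sub>L 'h"
  proof -
    have "inner (\<Psi> S x) x \<le> inner (\<Psi> (norm S *\<^sub>R id_blinfun) x) x"
      by (intro \<Psi>_mono bound that bounded_operators_scaleR) (simp_all add: adj_scaleR)
    then show ?thesis
      by (simp add: \<Psi>_id blinfun.bilinear_simps power2_norm_eq_inner)
  qed
  have "inner (\<Psi> ((- 1) *\<^sub>R T) x) x \<le> norm T * (norm x)\<^sup>2"
    using le[of "(- 1) *\<^sub>R T"] T by (auto simp: adj_minus bounded_operators_scaleR[of _ "- 1", simplified])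
  then show "\<bar>inner (\<Psi> T x) x\<bar> \<le> norm T * (norm x)\<^sup>2"
    using le[OF T] T unfolding \<Psi>_scaleR[OF T(1)] by (simp add: blinfun.bilinear_simps)
qed (use T \<Psi>_selfadjoint in auto)

text \<open>The crude factor 2 counts the real and the imaginary part. Boundedness suffices for
  passing from projections to all of \<open>D\<close>.\<close>

lemma norm_\<Psi>:
  assumes "T \<in> bounded_operators"
  shows "norm (\<Psi> T) \<le> 2 * norm T"
proof -
  define R where "R = (1/2) *\<^sub>R (T + adj T)"
  define S where "S = \<i> \<cdot>\<^sub>C ((1/2) *\<^sub>R (adj T - T))"
  have BO: "T \<in> bounded_operators" "adj T \<in> bounded_operators" "adj T - T \<in> bounded_operators"
    using assms by (auto intro: bounded_operators_adj)
  have R: "R \<in> bounded_operators" "adj R = R"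
    unfolding R_def using BO
    by (auto intro!: bounded_operators_scaleR bounded_operators_add simp: adj_scaleR adj_add add.commute)
  have S: "S \<in> bounded_operators" "adj S = S"
    unfolding S_def using BO
    by (auto intro!: bounded_operators_scale_op bounded_operators_scaleR blinfun_eqI
        simp: adj_scale_op bounded_operators_scaleR adj_scaleR adj_diff blinfun.bilinear_simps
          scaleC_scaleR scaleC_diff_right scaleC_minus_left)
  have "norm R \<le> norm T"
    unfolding R_def using norm_triangle_ineq[of T "adj T"] by simp
  moreover have "norm S \<le> norm T"
  proof (rule norm_blinfun_bound)
    fix x
    have "norm (S x) = (1/2) * norm ((adj T - T) x)"
      by (simp add: S_def norm_scaleC blinfun.scaleR_left)
    also have "\<dots> \<le> (1/2) * (norm (adj T - T) * norm x)"
      by (intro mult_left_mono norm_blinfun) simp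
    also have "\<dots> \<le> (1/2) * ((norm (adj T) + norm T) * norm x)"
      by (intro mult_left_mono mult_right_mono norm_triangle_ineq4) auto
    finally show "norm (S x) \<le> norm T * norm x"
      by simp
  qed simp
  moreover have "T = R + \<i> \<cdot>\<^sub>C S"
  proof (rule blinfun_eqI)
    fix x
    have "\<i> *\<^sub>C \<i> *\<^sub>C y = - y" for y :: 'h
      using scaleR_scaleC[of "-1" y] by (simp add: scaleC_scaleC)
    then show "T x = (R + \<i> \<cdot>\<^sub>C S) x"
      unfolding R_def S_def
      by (simp add: blinfun.bilinear_simps algebra_simps flip: scaleR_add_left scaleR_2)
  qed
  then have "\<Psi> T = \<Psi> R + \<i> \<cdot>\<^sub>C \<Psi> S"
    by (simp add: \<Psi>_add \<Psi>_scale_op R S bounded_operators_scale_op)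
  moreover have "norm (\<i> \<cdot>\<^sub>C \<Psi> S) \<le> norm (\<Psi> S)"
    by (rule norm_blinfun_bound) (simp_all add: norm_scaleC norm_blinfun)
  ultimately show ?thesis
    using norm_triangle_ineq[of "\<Psi> R" "\<i> \<cdot>\<^sub>C \<Psi> S"] norm_\<Psi>_selfadjoint[OF R] norm_\<Psi>_selfadjoint[OF S]
    by simp
qed

text \<open>The compression lies between multiples of \<open>p\<close>, and
  \<open>\<Psi> p = p\<close>. Adding \<open>norm x *\<^sub>R p\<close> makes it positive, so that
  vanishing of the form at \<open>v\<close> gives vanishing of the vector.\<close>

lemma compression_vanishes:
  assumes p: "p \<in> D" "projection p" and x: "x \<in> bounded_operators" "adj x = x" and "p v = 0"
  shows "\<Psi> (p o\<^sub>L x o\<^sub>L p) v = 0"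
proof -
  let ?y = "p o\<^sub>L x o\<^sub>L p"
  let ?S = "?y + norm x *\<^sub>R p"
  have BO: "p \<in> bounded_operators" "?y \<in> bounded_operators" "?S \<in> bounded_operators"
    using p x by (auto intro: D_bounded_operators bounded_operators_compose bounded_operators_add
      bounded_operators_scaleR)
  have y: "inner (?y u) u = inner (x (p u)) (p u)" for u
    by (simp add: projection_inner[OF p(2)])
  have adj: "adj ?S = ?S"
    by (simp add: adj_add adj_scaleR adj_compose projection_adj[OF p(2)] x blinfun_compose_assoc)
  have S: "inner (?S u) u = inner (x (p u)) (p u) + norm x * (norm (p u))\<^sup>2" for u
    using y[of u] by (simp add: blinfun.bilinear_simps inner_add_left projection_quadratic[OF p(2)])
  have \<Psi>S: "\<Psi> ?S = \<Psi> ?y + norm x *\<^sub>R p"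
    using p by (simp add: \<Psi>_add BO bounded_operators_scaleR fixes_D D_scaleR)
  have "0 \<le> inner (?S u) u" for u
    using abs_quadratic_le[of x "p u"] S[of u] by linarith
  note pos = \<Psi>_nonneg[OF BO(3) adj this]
  have "inner (\<Psi> ?S v) v \<le> inner (\<Psi> ((2 * norm x) *\<^sub>R p) v) v"
  proof (rule \<Psi>_mono)
    show "inner (?S u) u \<le> inner (((2 * norm x) *\<^sub>R p) u) u" for u
      using abs_quadratic_le[of x "p u"] S[of u]
      by (simp add: blinfun.bilinear_simps projection_quadratic[OF p(2)])
  qed (use BO adj p in \<open>auto simp: adj_scaleR projection_adj\<close>)
  also have "\<dots> = 0"
    using p \<open>p v = 0\<close> by (simp add: fixes_D D_scaleR blinfun.bilinear_simps)
  finally have "\<Psi> ?S v = 0"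
    by (rule positive_form_kernel[OF pos])
  then show ?thesis
    using \<open>p v = 0\<close> by (simp add: \<Psi>S blinfun.bilinear_simps)
qed

text \<open>Applying \<open>\<Psi>\<close> to the square of \<open>p + t *\<^sub>R x\<close> gives a
  positive operator for every real \<open>t\<close>. At a vector killed by \<open>p\<close> the
  constant term is zero, so the linear term is zero as well; polarization passes to two
  vectors.\<close>

lemma off_corner_vanishes:
  assumes p: "p \<in> D" "projection p" and x: "x \<in> bounded_operators" "adj x = x" and "p u = 0" "p v = 0"
  shows "inner (\<Psi> ((p o\<^sub>L x) + (x o\<^sub>L p)) u) v = 0"
proof -
  let ?y = "(p o\<^sub>L x) + (x o\<^sub>L p)"
  have BO: "p \<in> bounded_operators" "?y \<in> bounded_operators" "x o\<^sub>L x \<in> bounded_operators"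
    using p x by (auto intro: D_bounded_operators)
  have diag: "inner (\<Psi> ?y w) w = 0" if "p w = 0" for w
  proof (rule linear_term_zero)
    fix t :: real
    let ?k = "p + t *\<^sub>R x"
    let ?S = "p + t *\<^sub>R ?y + t\<^sup>2 *\<^sub>R (x o\<^sub>L x)"
    have k: "adj ?k = ?k"
      by (simp add: adj_add adj_scaleR projection_adj[OF p(2)] x)
    have S: "?S = ?k o\<^sub>L ?k"
      by (rule blinfun_eqI)
        (simp add: blinfun.bilinear_simps projection_idem[OF p(2)] algebra_simps power2_eq_square)
    have "0 \<le> inner (\<Psi> ?S w) w"
    proof (rule \<Psi>_nonneg)
      show "?S \<in> bounded_operators"
        using BO by (auto intro: bounded_operators_add bounded_operators_scaleR)
      show "adj ?S = ?S"
        unfolding S by (simp add: adj_compose k)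
      show "0 \<le> inner (?S z) z" for z
        unfolding S using selfadjoint_inner[OF k, of "?k z" z] by simp
    qed
    also have "\<Psi> ?S = p + t *\<^sub>R \<Psi> ?y + t\<^sup>2 *\<^sub>R \<Psi> (x o\<^sub>L x)"
      using BO p by (simp add: \<Psi>_add \<Psi>_scaleR fixes_D bounded_operators_add bounded_operators_scaleR)
    finally show "0 \<le> t * inner (\<Psi> ?y w) w + t\<^sup>2 * inner (\<Psi> (x o\<^sub>L x) w) w"
      using that by (simp add: blinfun.bilinear_simps inner_add_left)
  qed
  have "adj ?y = ?y"
    by (simp add: adj_add adj_compose projection_adj[OF p(2)] x add.commute)
  from polarization[OF \<Psi>_selfadjoint[OF BO(2) this], of u v] show ?thesis
    using diag[of "u + v"] diag[of "u - v"] assms(5,6) by (simp add: blinfun.bilinear_simps)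
qed

text \<open>The defect \<open>E\<close> is tested on its four corners. The diagonal ones are
  \<open>off_corner_vanishes\<close>, for \<open>p\<close> and for \<open>q = 1 - p\<close>. The
  mixed ones follow from \<open>compression_vanishes\<close> after writing \<open>p x + x p\<close>
  as \<open>x + p x p - q x q\<close>.\<close>

lemma jordan_module_projection:
  assumes p: "p \<in> D" "projection p" and x: "x \<in> bounded_operators" "adj x = x"
  shows "\<Psi> ((p o\<^sub>L x) + (x o\<^sub>L p)) = (p o\<^sub>L \<Psi> x) + (\<Psi> x o\<^sub>L p)"
proof -
  let ?y = "(p o\<^sub>L x) + (x o\<^sub>L p)"
  define q where "q = id_blinfun - p"
  have q: "q \<in> D" "projection q"
    using p projection_complement by (auto simp: q_def)
  have q_apply: "q v = v - p v" for v
    by (simp add: q_def blinfun.bilinear_simps)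
  have BO: "p \<in> bounded_operators" "q \<in> bounded_operators" "?y \<in> bounded_operators"
    using p q x by (auto intro: D_bounded_operators)
  note pq = projection_inner[OF p(2)]
  have sa: "adj (p o\<^sub>L x o\<^sub>L p) = p o\<^sub>L x o\<^sub>L p" "adj (q o\<^sub>L x o\<^sub>L q) = q o\<^sub>L x o\<^sub>L q"
    by (simp_all add: adj_compose projection_adj p q x blinfun_compose_assoc)
  note sa\<Psi> = selfadjoint_inner[OF \<Psi>_selfadjoint[OF _ sa(1)]] selfadjoint_inner[OF \<Psi>_selfadjoint[OF _ sa(2)]]
  have y: "\<Psi> ?y = \<Psi> x + \<Psi> (p o\<^sub>L x o\<^sub>L p) - \<Psi> (q o\<^sub>L x o\<^sub>L q)"
  proof -
    have "?y = x + (p o\<^sub>L x o\<^sub>L p) - (q o\<^sub>L x o\<^sub>L q)"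
      by (rule blinfun_eqI) (simp add: blinfun.bilinear_simps q_apply)
    then show ?thesis
      using BO x by (simp add: \<Psi>_add \<Psi>_diff bounded_operators_add bounded_operators_compose)
  qed
  define E where "E = \<Psi> ?y - ((p o\<^sub>L \<Psi> x) + (\<Psi> x o\<^sub>L p))"
  have E: "inner (E u) v = inner (\<Psi> ?y u) v - inner (\<Psi> x u) (p v) - inner (\<Psi> x (p u)) v" for u v
    by (simp add: E_def blinfun.bilinear_simps inner_diff_left inner_add_left pq)
  have pp: "inner (E u) v = 0" if "p u = u" "p v = v" for u v
  proof -
    have "inner (\<Psi> ((q o\<^sub>L x) + (x o\<^sub>L q)) u) v = 0"
      using that by (intro off_corner_vanishes q x) (simp_all add: q_apply)
    also have "(q o\<^sub>L x) + (x o\<^sub>L q) = 2 *\<^sub>R x - ?y"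
      by (rule blinfun_eqI) (simp add: blinfun.bilinear_simps q_apply scaleR_2)
    also have "\<Psi> \<dots> = 2 *\<^sub>R \<Psi> x - \<Psi> ?y"
      using BO x by (simp add: \<Psi>_diff \<Psi>_scaleR bounded_operators_scaleR)
    finally show ?thesis
      using that by (simp add: E blinfun.bilinear_simps inner_diff_left)
  qed
  have pq: "inner (E u) v = 0" if "p u = u" "p v = 0" for u v
  proof -
    have "\<Psi> (p o\<^sub>L x o\<^sub>L p) v = 0" "\<Psi> (q o\<^sub>L x o\<^sub>L q) u = 0"
      using that by (intro compression_vanishes p q x; simp add: q_apply)+
    then have "inner (\<Psi> ?y u) v = inner (\<Psi> x u) v"
      using BO x unfolding y
      by (simp add: blinfun.bilinear_simps inner_add_left inner_diff_left sa\<Psi> bounded_operators_compose)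
    then show ?thesis
      using that by (simp add: E)
  qed
  have qp: "inner (E u) v = 0" if "p u = 0" "p v = v" for u v
  proof -
    have "\<Psi> (p o\<^sub>L x o\<^sub>L p) u = 0" "\<Psi> (q o\<^sub>L x o\<^sub>L q) v = 0"
      using that by (intro compression_vanishes p q x; simp add: q_apply)+
    then have "inner (\<Psi> ?y u) v = inner (\<Psi> x u) v"
      using BO x unfolding y
      by (simp add: blinfun.bilinear_simps inner_add_left inner_diff_left sa\<Psi> bounded_operators_compose)
    then show ?thesis
      using that by (simp add: E)
  qed
  have qq: "inner (E u) v = 0" if "p u = 0" "p v = 0" for u v
    using that off_corner_vanishes[OF p x that] by (simp add: E)
  have "inner (E u) v = inner (blinfun_apply 0 u) v" for u v
  proof -
    have pu: "p (p u) = p u" "p (u - p u) = 0" for u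
      by (simp_all add: blinfun.bilinear_simps projection_idem[OF p(2)])
    have "E u = E (p u) + E (u - p u)"
      by (simp flip: blinfun.add_right)
    then have "inner (E u) v = inner (E (p u)) (p v) + inner (E (p u)) (v - p v)
        + (inner (E (u - p u)) (p v) + inner (E (u - p u)) (v - p v))"
      unfolding inner_add_right[symmetric] by (simp add: inner_add_left)
    then show ?thesis
      by (simp add: pp pq qp qq pu)
  qed
  then have "E = 0"
    by (rule blinfun_eq_innerI)
  then show ?thesis
    by (simp add: E_def)
qed

text \<open>For selfadjoint \<open>d\<close> and \<open>x\<close> the defect is a bounded functional
  of \<open>d\<close> that vanishes on projections. Complex combinations are then taken in
  \<open>d\<close> first and in \<open>x\<close> second.\<close>

lemma jordan_module:
  assumes d: "d \<in> D" and x: "x \<in> bounded_operators"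
  shows "\<Psi> ((d o\<^sub>L x) + (x o\<^sub>L d)) = (d o\<^sub>L \<Psi> x) + (\<Psi> x o\<^sub>L d)"
proof -
  have BO: "(d o\<^sub>L x) + (x o\<^sub>L d) \<in> bounded_operators"
    if "d \<in> bounded_operators" "x \<in> bounded_operators" for d x :: "'h \<Rightarrow>\<^sub>L 'h"
    using that by (intro bounded_operators_add bounded_operators_compose)
  have step1: "\<Psi> ((d o\<^sub>L x) + (x o\<^sub>L d)) = (d o\<^sub>L \<Psi> x) + (\<Psi> x o\<^sub>L d)"
    if d: "d \<in> D" "adj d = d" and x: "x \<in> bounded_operators" "adj x = x" for d x
  proof (rule blinfun_eq_innerI)
    fix u v
    define J where "J d = \<Psi> ((d o\<^sub>L x) + (x o\<^sub>L d)) - ((d o\<^sub>L \<Psi> x) + (\<Psi> x o\<^sub>L d))" for d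
    \<comment> \<open>In the constant, \<open>4 * norm x\<close> combines the two products with the
      factor 2 of \<open>norm_\<Psi>\<close>.\<close>
    have "inner (J d u) v = 0"
    proof (rule functional_vanishes[where f = "\<lambda>d. inner (J d u) v"
          and C = "(4 * norm x + 2 * norm (\<Psi> x)) * norm u * norm v"])
      fix a b
      assume a: "a \<in> D"
      then have aB: "a \<in> bounded_operators"
        by (rule D_bounded_operators)
      {
        assume b: "b \<in> D"
        have eq: "((a + b) o\<^sub>L x) + (x o\<^sub>L (a + b)) = ((a o\<^sub>L x) + (x o\<^sub>L a)) + ((b o\<^sub>L x) + (x o\<^sub>L b))"
          by (simp add: blinfun_compose_simps)
        have "J (a + b) = J a + J b"
          unfolding J_def eq \<Psi>_add[OF BO[OF aB x(1)] BO[OF D_bounded_operators[OF b] x(1)]]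
          by (simp add: blinfun_compose_simps)
        then show "inner (J (a + b) u) v = inner (J a u) v + inner (J b u) v"
          by (simp add: blinfun.add_left inner_add_left)
      next
        fix r
        have eq: "((r *\<^sub>R a) o\<^sub>L x) + (x o\<^sub>L (r *\<^sub>R a)) = r *\<^sub>R ((a o\<^sub>L x) + (x o\<^sub>L a))"
          by (simp add: blinfun_compose_simps scaleR_add_right)
        have "J (r *\<^sub>R a) = r *\<^sub>R J a"
          unfolding J_def eq \<Psi>_scaleR[OF BO[OF aB x(1)]]
          by (simp add: blinfun_compose_simps algebra_simps)
        then show "inner (J (r *\<^sub>R a) u) v = r * inner (J a u) v"
          by (simp add: blinfun.scaleR_left)
      next
        have n1: "norm ((a o\<^sub>L b) + (b o\<^sub>L a)) \<le> 2 * (norm a * norm b)" for b :: "'h \<Rightarrow>\<^sub>L 'h"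
          using norm_triangle_ineq[of "a o\<^sub>L b" "b o\<^sub>L a"] norm_blinfun_compose[of a b] norm_blinfun_compose[of b a]
          by (simp add: mult.commute)
        have "norm (J a) \<le> 2 * (2 * (norm a * norm x)) + 2 * (norm a * norm (\<Psi> x))"
          unfolding J_def
          using norm_triangle_ineq4[of "\<Psi> ((a o\<^sub>L x) + (x o\<^sub>L a))" "(a o\<^sub>L \<Psi> x) + (\<Psi> x o\<^sub>L a)"]
            norm_\<Psi>[OF BO[OF aB x(1)]] n1[of x] n1[of "\<Psi> x"] by linarith
        then have nJ: "norm (J a) \<le> (4 * norm x + 2 * norm (\<Psi> x)) * norm a"
          by (simp add: algebra_simps)
        have "\<bar>inner (J a u) v\<bar> \<le> norm (J a u) * norm v"
          by (rule Cauchy_Schwarz_ineq2)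
        also have "\<dots> \<le> norm (J a) * norm u * norm v"
          by (intro mult_right_mono norm_blinfun) simp
        also have "\<dots> \<le> (4 * norm x + 2 * norm (\<Psi> x)) * norm a * norm u * norm v"
          by (intro mult_right_mono nJ) auto
        finally show "\<bar>inner (J a u) v\<bar> \<le> (4 * norm x + 2 * norm (\<Psi> x)) * norm u * norm v * norm a"
          by (simp add: mult_ac)
      }
    next
      fix p
      assume "p \<in> D" "projection p"
      then show "inner (J p u) v = 0"
        by (simp add: J_def jordan_module_projection x)
    qed (use d in auto)
    then show "inner (\<Psi> ((d o\<^sub>L x) + (x o\<^sub>L d)) u) v = inner (((d o\<^sub>L \<Psi> x) + (\<Psi> x o\<^sub>L d)) u) v"
      by (simp add: J_def blinfun.diff_left inner_diff_left)
  qed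
  have step2: "\<Psi> ((d o\<^sub>L x) + (x o\<^sub>L d)) = (d o\<^sub>L \<Psi> x) + (\<Psi> x o\<^sub>L d)"
    if x: "x \<in> bounded_operators" "adj x = x" for x
    using d
  proof (rule selfadjoint_induct)
    fix S T
    assume "S \<in> D" "T \<in> D"
      and IH: "\<Psi> ((S o\<^sub>L x) + (x o\<^sub>L S)) = (S o\<^sub>L \<Psi> x) + (\<Psi> x o\<^sub>L S)"
        "\<Psi> ((T o\<^sub>L x) + (x o\<^sub>L T)) = (T o\<^sub>L \<Psi> x) + (\<Psi> x o\<^sub>L T)"
    then have ST: "S \<in> bounded_operators" "T \<in> bounded_operators"
      using D_bounded_operators by auto
    have eq: "((S + T) o\<^sub>L x) + (x o\<^sub>L (S + T)) = ((S o\<^sub>L x) + (x o\<^sub>L S)) + ((T o\<^sub>L x) + (x o\<^sub>L T))"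
      by (simp add: blinfun_compose_simps)
    show "\<Psi> (((S + T) o\<^sub>L x) + (x o\<^sub>L (S + T))) = ((S + T) o\<^sub>L \<Psi> x) + (\<Psi> x o\<^sub>L (S + T))"
      unfolding eq \<Psi>_add[OF BO[OF ST(1) x(1)] BO[OF ST(2) x(1)]] IH
      by (simp add: blinfun_compose_simps)
  next
    fix c S
    assume "S \<in> D" and IH: "\<Psi> ((S o\<^sub>L x) + (x o\<^sub>L S)) = (S o\<^sub>L \<Psi> x) + (\<Psi> x o\<^sub>L S)"
    then have S: "S \<in> bounded_operators"
      using D_bounded_operators by auto
    have eq: "((c \<cdot>\<^sub>C S) o\<^sub>L x) + (x o\<^sub>L (c \<cdot>\<^sub>C S)) = c \<cdot>\<^sub>C ((S o\<^sub>L x) + (x o\<^sub>L S))"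
      by (simp add: scale_op_compose compose_scale_op x scale_op_add_right)
    show "\<Psi> (((c \<cdot>\<^sub>C S) o\<^sub>L x) + (x o\<^sub>L (c \<cdot>\<^sub>C S))) = ((c \<cdot>\<^sub>C S) o\<^sub>L \<Psi> x) + (\<Psi> x o\<^sub>L (c \<cdot>\<^sub>C S))"
      unfolding eq \<Psi>_scale_op[OF BO[OF S x(1)]] IH
      by (simp add: scale_op_compose compose_scale_op x scale_op_add_right)
  qed (use D_bounded_operators x step1 in auto)
  have dB: "d \<in> bounded_operators"
    using d by (rule D_bounded_operators)
  show ?thesis
    using x
  proof (rule selfadjoint_induct)
    fix S T
    assume ST: "S \<in> bounded_operators" "T \<in> bounded_operators"
      and IH: "\<Psi> ((d o\<^sub>L S) + (S o\<^sub>L d)) = (d o\<^sub>L \<Psi> S) + (\<Psi> S o\<^sub>L d)"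
        "\<Psi> ((d o\<^sub>L T) + (T o\<^sub>L d)) = (d o\<^sub>L \<Psi> T) + (\<Psi> T o\<^sub>L d)"
    have eq: "(d o\<^sub>L (S + T)) + ((S + T) o\<^sub>L d) = ((d o\<^sub>L S) + (S o\<^sub>L d)) + ((d o\<^sub>L T) + (T o\<^sub>L d))"
      by (simp add: blinfun_compose_simps)
    show "\<Psi> ((d o\<^sub>L (S + T)) + ((S + T) o\<^sub>L d)) = (d o\<^sub>L \<Psi> (S + T)) + (\<Psi> (S + T) o\<^sub>L d)"
      unfolding eq \<Psi>_add[OF BO[OF dB ST(1)] BO[OF dB ST(2)]] IH
      by (simp add: blinfun_compose_simps \<Psi>_add ST)
  next
    fix c S
    assume S: "S \<in> bounded_operators" and IH: "\<Psi> ((d o\<^sub>L S) + (S o\<^sub>L d)) = (d o\<^sub>L \<Psi> S) + (\<Psi> S o\<^sub>L d)"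
    have eq: "(d o\<^sub>L (c \<cdot>\<^sub>C S)) + ((c \<cdot>\<^sub>C S) o\<^sub>L d) = c \<cdot>\<^sub>C ((d o\<^sub>L S) + (S o\<^sub>L d))"
      by (simp add: scale_op_compose compose_scale_op dB scale_op_add_right)
    show "\<Psi> ((d o\<^sub>L (c \<cdot>\<^sub>C S)) + ((c \<cdot>\<^sub>C S) o\<^sub>L d)) = (d o\<^sub>L \<Psi> (c \<cdot>\<^sub>C S)) + (\<Psi> (c \<cdot>\<^sub>C S) o\<^sub>L d)"
      unfolding eq \<Psi>_scale_op[OF BO[OF dB S]] IH
      by (simp add: \<Psi>_scale_op S scale_op_compose compose_scale_op dB scale_op_add_right)
  qed (use step2 in auto)
qed

text \<open>Jordan's identity for \<open>p\<close> leaves the two off-diagonal corners of \<open>\<Psi> y\<close>. The unwanted one, \<open>w\<close>,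
  lies in \<open>D\<close> and satisfies \<open>w\<^sup>* y = y w\<^sup>* = 0\<close>, so Jordan's identity for \<open>w\<^sup>*\<close> yields \<open>w\<^sup>* w = 0\<close>.\<close>

lemma corner:
  assumes p: "p \<in> D" "projection p" and y: "y \<in> bounded_operators"
    and py: "\<And>v. p (y v) = y v" and yp: "\<And>v. y (p v) = 0"
  shows "p (\<Psi> y v) = \<Psi> y v"
proof -
  define Z where "Z = \<Psi> y"
  have Z: "Z \<in> D"
    using y in_D by (simp add: Z_def)
  have "(p o\<^sub>L y) + (y o\<^sub>L p) = y"
    by (rule blinfun_eqI) (simp add: blinfun.bilinear_simps py yp)
  then have "Z = (p o\<^sub>L Z) + (Z o\<^sub>L p)"
    using jordan_module[OF p(1) y] by (simp add: Z_def)
  then have Z_split: "Z v = p (Z v) + Z (p v)" for v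
    by (metis blinfun.add_left blinfun_apply_blinfun_compose)
  \<comment> \<open>Multiplying the splitting of \<open>Z\<close> by \<open>p\<close> cancels
    \<open>p Z\<close> and leaves \<open>p Z p = 0\<close>; the same then holds for
    \<open>adj Z\<close>.\<close>
  have pZp: "p (Z (p v)) = 0" for v
  proof -
    have "p (Z v) = p (p (Z v) + Z (p v))"
      using Z_split[of v] by simp
    then show ?thesis
      by (simp add: blinfun.bilinear_simps projection_idem[OF p(2)])
  qed
  define w where "w = Z o\<^sub>L p"
  have w: "w \<in> D" "adj w = p o\<^sub>L adj Z"
    using Z p by (auto simp: w_def adj_compose projection_adj)
  have pZ'p: "p (adj Z (p v)) = 0" for v
  proof -
    have "inner (p (adj Z (p v))) u = 0" for u
      by (simp add: projection_inner[OF p(2)] inner_adj_left pZp)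
    then show ?thesis
      using inner_eq_zero_iff by blast
  qed
  have "p (adj Z (y v)) = 0" for v
    using pZ'p[of "y v"] by (simp add: py)
  \<comment> \<open>The first product vanishes because \<open>y\<close> has range in that of
    \<open>p\<close> and \<open>p (adj Z) p = 0\<close>, the second because \<open>adj w\<close>
    begins with \<open>p\<close> and \<open>y p = 0\<close>.\<close>
  then have "(adj w o\<^sub>L y) + (y o\<^sub>L adj w) = 0"
    by (intro blinfun_eqI) (simp add: w blinfun.bilinear_simps yp)
  with jordan_module[OF D_adj[OF w(1)] y] have "(adj w o\<^sub>L Z) + (Z o\<^sub>L adj w) = 0"
    by (simp add: Z_def \<Psi>_0)
  \<comment> \<open>On the range of \<open>p\<close> the first summand becomes
    \<open>adj w (w v)\<close>, while the second dies by \<open>p (adj Z) p = 0\<close>.\<close>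
  then have "((adj w o\<^sub>L Z) + (Z o\<^sub>L adj w)) (p v) = 0" for v
    by simp
  then have "adj w (w v) = 0" for v
    by (simp add: w_def[symmetric] w blinfun.bilinear_simps pZ'p) (simp add: w_def)
  then have "inner (w v) (w v) = 0" for v
    using inner_adj_left[of w "w v" v] by simp
  then have "Z (p v) = 0"
    by (simp add: w_def)
  then show ?thesis
    using Z_split[of v] by (simp add: Z_def)
qed

text \<open>It suffices that \<open>\<Psi> (p o\<^sub>L x)\<close> has range in that of
  \<open>p\<close>: the same for \<open>1 - p\<close> shows that \<open>p\<close> kills the
  remaining part of \<open>\<Psi> x\<close>. For the range claim, Jordan's identity treats
  \<open>p x p\<close> and \<open>corner\<close> treats \<open>p x (1 - p)\<close>.\<close>

lemma left_module_projection:
  assumes p: "p \<in> D" "projection p" and x: "x \<in> bounded_operators"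
  shows "\<Psi> (p o\<^sub>L x) = p o\<^sub>L \<Psi> x"
proof -
  have range: "p (\<Psi> (p o\<^sub>L x) v) = \<Psi> (p o\<^sub>L x) v" if p: "p \<in> D" "projection p" for p v
  proof -
    have BO: "p \<in> bounded_operators" "id_blinfun - p \<in> bounded_operators"
      using p by (auto intro: D_bounded_operators)
    let ?y = "p o\<^sub>L x o\<^sub>L p" and ?z = "p o\<^sub>L x o\<^sub>L (id_blinfun - p)"
    have yz: "?y \<in> bounded_operators" "?z \<in> bounded_operators"
      using BO x by (auto intro: bounded_operators_compose)
    have "(p o\<^sub>L ?y) + (?y o\<^sub>L p) = 2 *\<^sub>R ?y"
      by (rule blinfun_eqI) (simp add: blinfun.bilinear_simps projection_idem[OF p(2)] scaleR_2)
    with jordan_module[OF p(1) yz(1)] have "2 *\<^sub>R \<Psi> ?y = (p o\<^sub>L \<Psi> ?y) + (\<Psi> ?y o\<^sub>L p)"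
      by (simp add: \<Psi>_scaleR yz)
    then have two: "2 *\<^sub>R \<Psi> ?y v = p (\<Psi> ?y v) + \<Psi> ?y (p v)" for v
      by (metis blinfun.add_left blinfun.scaleR_left blinfun_apply_blinfun_compose)
    have a: "p (\<Psi> ?y v) = p (\<Psi> ?y (p v))" for v
    proof -
      have "p (2 *\<^sub>R \<Psi> ?y v) = p (p (\<Psi> ?y v) + \<Psi> ?y (p v))"
        by (simp only: two)
      then show ?thesis
        by (simp add: blinfun.bilinear_simps projection_idem[OF p(2)] scaleR_2)
    qed
    have "\<Psi> ?y (p v) = p (\<Psi> ?y (p v))" for v
      using two[of "p v"] by (simp add: projection_idem[OF p(2)] scaleR_2)
    then have "2 *\<^sub>R p (\<Psi> ?y v) = 2 *\<^sub>R \<Psi> ?y v" for v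
      using two[of v] a[of v] by (simp add: scaleR_2)
    then have "p (\<Psi> ?y v) = \<Psi> ?y v" for v
      by simp
    moreover have "p (\<Psi> ?z v) = \<Psi> ?z v" for v
      by (rule corner[OF p yz(2)]) (simp_all add: blinfun.bilinear_simps projection_idem[OF p(2)])
    moreover have eq: "p o\<^sub>L x = ?y + ?z"
      by (rule blinfun_eqI) (simp add: blinfun.bilinear_simps)
    have "\<Psi> (p o\<^sub>L x) = \<Psi> ?y + \<Psi> ?z"
      using trans[OF arg_cong[OF eq, of \<Psi>] \<Psi>_add[OF yz]] .
    ultimately show ?thesis
      by (simp add: blinfun.bilinear_simps)
  qed
  define q where "q = id_blinfun - p"
  have q: "q \<in> D" "projection q"
    using p projection_complement by (auto simp: q_def)
  have BO: "p o\<^sub>L x \<in> bounded_operators" "q o\<^sub>L x \<in> bounded_operators"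
    using p q x by (auto intro: D_bounded_operators)
  have "x = (p o\<^sub>L x) + (q o\<^sub>L x)"
    by (rule blinfun_eqI) (simp add: q_def blinfun.bilinear_simps)
  then have \<Psi>x: "\<Psi> x = \<Psi> (p o\<^sub>L x) + \<Psi> (q o\<^sub>L x)"
    using \<Psi>_add[OF BO] by simp
  have "p (\<Psi> (q o\<^sub>L x) v) = 0" for v
  proof -
    have "q (\<Psi> (q o\<^sub>L x) v) = \<Psi> (q o\<^sub>L x) v"
      by (rule range[OF q])
    then show ?thesis
      by (simp add: q_def blinfun.bilinear_simps)
  qed
  then show ?thesis
    by (intro blinfun_eqI) (simp add: \<Psi>x blinfun.bilinear_simps range[OF p])
qed

lemma left_module:
  assumes d: "d \<in> D" and x: "x \<in> bounded_operators"
  shows "\<Psi> (d o\<^sub>L x) = d o\<^sub>L \<Psi> x"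
proof -
  have step: "\<Psi> (d o\<^sub>L x) = d o\<^sub>L \<Psi> x" if d: "d \<in> D" "adj d = d" for d
  proof (rule blinfun_eq_innerI)
    fix u v
    define J where "J d = \<Psi> (d o\<^sub>L x) - (d o\<^sub>L \<Psi> x)" for d
    have "inner (J d u) v = 0"
    proof (rule functional_vanishes[where f = "\<lambda>d. inner (J d u) v"
          and C = "(2 * norm x + norm (\<Psi> x)) * norm u * norm v"])
      fix a b
      assume a: "a \<in> D"
      then have ax: "a o\<^sub>L x \<in> bounded_operators"
        using x by (auto intro: D_bounded_operators)
      {
        assume "b \<in> D"
        then have "b o\<^sub>L x \<in> bounded_operators"
          using x by (auto intro: D_bounded_operators)
        then have "J (a + b) = J a + J b"
          using ax by (simp add: J_def \<Psi>_add blinfun_compose_simps)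
        then show "inner (J (a + b) u) v = inner (J a u) v + inner (J b u) v"
          by (simp add: blinfun.add_left inner_add_left)
      next
        fix r
        have "J (r *\<^sub>R a) = r *\<^sub>R J a"
          using ax by (simp add: J_def \<Psi>_scaleR blinfun_compose_simps algebra_simps)
        then show "inner (J (r *\<^sub>R a) u) v = r * inner (J a u) v"
          by (simp add: blinfun.scaleR_left)
      next
        have "norm (J a) \<le> 2 * (norm a * norm x) + norm a * norm (\<Psi> x)"
          unfolding J_def
          using norm_triangle_ineq4[of "\<Psi> (a o\<^sub>L x)" "a o\<^sub>L \<Psi> x"]
            norm_\<Psi>[OF ax] norm_blinfun_compose[of a x] norm_blinfun_compose[of a "\<Psi> x"] by linarith
        then have nJ: "norm (J a) \<le> (2 * norm x + norm (\<Psi> x)) * norm a"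
          by (simp add: algebra_simps)
        have "\<bar>inner (J a u) v\<bar> \<le> norm (J a u) * norm v"
          by (rule Cauchy_Schwarz_ineq2)
        also have "\<dots> \<le> norm (J a) * norm u * norm v"
          by (intro mult_right_mono norm_blinfun) simp
        also have "\<dots> \<le> (2 * norm x + norm (\<Psi> x)) * norm a * norm u * norm v"
          by (intro mult_right_mono nJ) auto
        finally show "\<bar>inner (J a u) v\<bar> \<le> (2 * norm x + norm (\<Psi> x)) * norm u * norm v * norm a"
          by (simp add: mult_ac)
      }
    next
      fix p
      assume "p \<in> D" "projection p"
      then show "inner (J p u) v = 0"
        by (simp add: J_def left_module_projection x)
    qed (use d in auto)
    then show "inner (\<Psi> (d o\<^sub>L x) u) v = inner ((d o\<^sub>L \<Psi> x) u) v"
      by (simp add: J_def blinfun.diff_left inner_diff_left)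
  qed
  show ?thesis
    using d
  proof (rule selfadjoint_induct)
    fix S T
    assume "S \<in> D" "T \<in> D" and IH: "\<Psi> (S o\<^sub>L x) = S o\<^sub>L \<Psi> x" "\<Psi> (T o\<^sub>L x) = T o\<^sub>L \<Psi> x"
    then have "S o\<^sub>L x \<in> bounded_operators" "T o\<^sub>L x \<in> bounded_operators"
      using x by (auto intro: D_bounded_operators)
    then show "\<Psi> ((S + T) o\<^sub>L x) = (S + T) o\<^sub>L \<Psi> x"
      by (simp add: blinfun_compose_simps \<Psi>_add IH)
  next
    fix c S
    assume "S \<in> D" and IH: "\<Psi> (S o\<^sub>L x) = S o\<^sub>L \<Psi> x"
    then have "S o\<^sub>L x \<in> bounded_operators"
      using x by (auto intro: D_bounded_operators)
    then show "\<Psi> ((c \<cdot>\<^sub>C S) o\<^sub>L x) = (c \<cdot>\<^sub>C S) o\<^sub>L \<Psi> x"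
      by (simp add: scale_op_compose \<Psi>_scale_op IH)
  qed (use D_bounded_operators step in auto)
qed

text \<open>What remains of Jordan's identity after subtracting \<open>left_module\<close>.\<close>

lemma right_module:
  assumes d: "d \<in> D" and x: "x \<in> bounded_operators"
  shows "\<Psi> (x o\<^sub>L d) = \<Psi> x o\<^sub>L d"
proof -
  have "d o\<^sub>L x \<in> bounded_operators" "x o\<^sub>L d \<in> bounded_operators"
    using d x by (auto intro: D_bounded_operators)
  then show ?thesis
    using jordan_module[OF assms] left_module[OF assms] by (simp add: \<Psi>_add)
qed

end

section \<open>Minimal projections\<close>

context von_neumann
begin

definition minimal_projection :: "('h \<Rightarrow>\<^sub>L 'h) \<Rightarrow> bool" where
  "minimal_projection e \<longleftrightarrow> e \<in> D \<and> projection e \<and> e \<noteq> 0 \<and>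
     (\<forall>p\<in>D. projection p \<longrightarrow> e o\<^sub>L p = p \<longrightarrow> p = 0 \<or> p = e)"

lemma minimal_projectionD:
  assumes "minimal_projection e"
  shows "e \<in> D" "projection e" "e \<noteq> 0"
  using assms by (auto simp: minimal_projection_def)

text \<open>Below \<open>e\<close> the algebra has only the projections 0 and \<open>e\<close>, so
  every spectral cut of \<open>k\<close> is trivial: at each level \<open>t\<close> its form on the
  range of \<open>e\<close> is entirely above or entirely below. Normalizing \<open>k\<close> to
  vanish at \<open>u\<close> squeezes it to 0.\<close>

lemma minimal_scalar_selfadjoint:
  assumes e: "minimal_projection e" and a: "a \<in> D" "adj a = a"
  shows "\<exists>r. e o\<^sub>L a o\<^sub>L e = r *\<^sub>R e"
proof -
  note eD = minimal_projectionD(1)[OF e] and ep = minimal_projectionD(2)[OF e]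
  obtain w where "e w \<noteq> 0"
    using minimal_projectionD(3)[OF e] by (metis blinfun_eqI zero_blinfun.rep_eq)
  define u where "u = (1 / norm (e w)) *\<^sub>R e w"
  have u: "e u = u" "norm u = 1"
    using \<open>e w \<noteq> 0\<close> by (auto simp: u_def blinfun.bilinear_simps projection_idem[OF ep])
  define r where "r = inner (a u) u"
  define k where "k = (e o\<^sub>L a o\<^sub>L e) - r *\<^sub>R e"
  have k: "k \<in> D" "adj k = k"
    using eD a
    by (auto simp: k_def adj_diff adj_scaleR adj_compose projection_adj[OF ep] blinfun_compose_assoc)
  have k_apply: "k x = e (a (e x)) - r *\<^sub>R e x" for x
    by (simp add: k_def blinfun.bilinear_simps)
  have ek: "e (k x) = k x" "k (e x) = k x" for x
    by (simp_all add: k_apply blinfun.bilinear_simps projection_idem[OF ep])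
  have ku: "inner (k u) u = 0"
    using u by (simp add: k_apply inner_diff_left projection_inner[OF ep] r_def power2_norm_eq_inner[symmetric])
  have dichotomy: "(\<forall>x. e x = x \<longrightarrow> t * (norm x)\<^sup>2 \<le> inner (k x) x) \<or>
      (\<forall>x. e x = x \<longrightarrow> inner (k x) x \<le> t * (norm x)\<^sup>2)" for t
  proof -
    define h where "h = k - t *\<^sub>R e"
    have "h \<in> D" "adj h = h"
      using k eD by (auto simp: h_def adj_diff adj_scaleR projection_adj[OF ep])
    from spectral_projection[OF this] obtain p where p: "p \<in> D" "projection p"
      "\<And>c. adj c = c \<Longrightarrow> h o\<^sub>L c = c o\<^sub>L h \<Longrightarrow> p o\<^sub>L c = c o\<^sub>L p"
      "\<And>x. p x = x \<Longrightarrow> 0 \<le> inner (h x) x" "\<And>x. p x = 0 \<Longrightarrow> inner (h x) x \<le> 0"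
      by blast
    \<comment> \<open>Commutation makes \<open>e o\<^sub>L p\<close> a projection of
      \<open>D\<close> below \<open>e\<close>, to which minimality applies.\<close>
    have "p o\<^sub>L e = e o\<^sub>L p"
      by (intro p(3) projection_adj[OF ep] blinfun_eqI)
        (simp add: h_def blinfun.bilinear_simps ek projection_idem[OF ep])
    then have pe: "p (e x) = e (p x)" for x
      by (metis blinfun_apply_blinfun_compose)
    have "projection (e o\<^sub>L p)"
      using \<open>p o\<^sub>L e = e o\<^sub>L p\<close> unfolding projection_def
      by (auto simp: adj_compose projection_adj[OF ep] projection_adj[OF p(2)] pe
          projection_idem[OF ep] projection_idem[OF p(2)] intro!: blinfun_eqI)
    moreover have "e o\<^sub>L (e o\<^sub>L p) = e o\<^sub>L p" "e o\<^sub>L p \<in> D"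
      using eD p(1) by (auto simp: projection_idem[OF ep] intro!: blinfun_eqI)
    ultimately consider "e o\<^sub>L p = 0" | "e o\<^sub>L p = e"
      using e by (auto simp: minimal_projection_def)
    then show ?thesis
    proof cases
      case 1
      have "inner (k x) x \<le> t * (norm x)\<^sup>2" if "e x = x" for x
      proof -
        have "p x = (e o\<^sub>L p) x"
          using pe[of x] that by simp
        then show ?thesis
          using p(5)[of x] 1 that
          by (simp add: h_def blinfun.bilinear_simps inner_diff_left power2_norm_eq_inner)
      qed
      then show ?thesis
        by blast
    next
      case 2
      have "t * (norm x)\<^sup>2 \<le> inner (k x) x" if "e x = x" for x
      proof -
        have "p x = (e o\<^sub>L p) x"
          using pe[of x] that by simp
        then show ?thesis
          using p(4)[of x] 2 that
          by (simp add: h_def blinfun.bilinear_simps inner_diff_left power2_norm_eq_inner)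
      qed
      then show ?thesis
        by blast
    qed
  qed
  \<comment> \<open>The value 0 at the unit vector \<open>u\<close> excludes one alternative at
    level \<open>t\<close> and the other at level \<open>- t\<close>.\<close>
  have small: "inner (k x) x \<le> t * (norm x)\<^sup>2 \<and> - t * (norm x)\<^sup>2 \<le> inner (k x) x" if "0 < t" "e x = x" for t x
  proof -
    have "\<not> (\<forall>x. e x = x \<longrightarrow> t * (norm x)\<^sup>2 \<le> inner (k x) x)"
      "\<not> (\<forall>x. e x = x \<longrightarrow> inner (k x) x \<le> - t * (norm x)\<^sup>2)"
      using u ku \<open>0 < t\<close> by (auto intro!: exI[of _ u])
    then show ?thesis
      using dichotomy[of t] dichotomy[of "- t"] \<open>e x = x\<close> by blast
  qed
  have zero: "inner (k x) x = 0" for x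
  proof -
    have "\<bar>inner (k (e x)) (e x)\<bar> \<le> t" if "0 < t" for t
    proof (cases "e x = 0")
      case False
      then show ?thesis
        using small[of "t / (norm (e x))\<^sup>2" "e x"] \<open>0 < t\<close> projection_idem[OF ep] by auto
    qed (use \<open>0 < t\<close> in simp)
    then have "\<bar>inner (k (e x)) (e x)\<bar> \<le> 0"
      by (rule field_le_epsilon[of _ 0, simplified]) simp
    then show ?thesis
      using projection_inner[OF ep, of "k x" x] by (simp add: ek)
  qed
  have "norm k \<le> 0"
    by (rule norm_le_quadratic[OF k(2)]) (simp_all add: zero)
  then have "e o\<^sub>L a o\<^sub>L e = r *\<^sub>R e"
    by (simp add: k_def)
  then show ?thesis ..
qed

lemma minimal_scalar:
  assumes e: "minimal_projection e" and a: "a \<in> D" and u: "e u = u" "norm u = 1"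
  shows "e (a (e x)) = cinner (a u) u *\<^sub>C e x"
proof -
  note eD = minimal_projectionD(1)[OF e] and ep = minimal_projectionD(2)[OF e]
  have eB: "e \<in> bounded_operators"
    using eD by (rule D_bounded_operators)
  have "\<exists>c. \<forall>x. e (a (e x)) = c *\<^sub>C e x"
    using a
  proof (rule selfadjoint_induct)
    fix S
    assume "S \<in> D" "adj S = S"
    then obtain r where "e o\<^sub>L S o\<^sub>L e = r *\<^sub>R e"
      using minimal_scalar_selfadjoint[OF e] by blast
    then have "\<forall>x. e (S (e x)) = complex_of_real r *\<^sub>C e x"
      by (metis blinfun.scaleR_left blinfun_apply_blinfun_compose scaleR_scaleC)
    then show "\<exists>c. \<forall>x. e (S (e x)) = c *\<^sub>C e x" ..
  next
    fix S T :: "'h \<Rightarrow>\<^sub>L 'h"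
    assume "\<exists>c. \<forall>x. e (S (e x)) = c *\<^sub>C e x" "\<exists>c. \<forall>x. e (T (e x)) = c *\<^sub>C e x"
    then obtain b c where "\<And>x. e (S (e x)) = b *\<^sub>C e x" "\<And>x. e (T (e x)) = c *\<^sub>C e x"
      by blast
    then have "\<forall>x. e ((S + T) (e x)) = (b + c) *\<^sub>C e x"
      by (simp add: blinfun.bilinear_simps scaleC_add_left)
    then show "\<exists>c. \<forall>x. e ((S + T) (e x)) = c *\<^sub>C e x" ..
  next
    fix b and S :: "'h \<Rightarrow>\<^sub>L 'h"
    assume "\<exists>c. \<forall>x. e (S (e x)) = c *\<^sub>C e x"
    then obtain c where "\<And>x. e (S (e x)) = c *\<^sub>C e x"
      by blast
    then have "\<forall>x. e ((b \<cdot>\<^sub>C S) (e x)) = (b * c) *\<^sub>C e x"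
      by (simp add: bounded_operators_scaleC[OF eB] scaleC_scaleC)
    then show "\<exists>c. \<forall>x. e ((b \<cdot>\<^sub>C S) (e x)) = c *\<^sub>C e x" ..
  qed (use D_bounded_operators in auto)
  then obtain c where c: "\<And>x. e (a (e x)) = c *\<^sub>C e x"
    by blast
  have "cinner (a u) u = cinner (e (a u)) u"
    using cinner_selfadjoint[OF eB projection_adj[OF ep], of "a u" u] u by simp
  also have "\<dots> = c"
    using c[of u] u by (simp add: cinner_scaleC_left cinner_self)
  finally show ?thesis
    using c by simp
qed

text \<open>\<open>a \<mapsto> a u\<close> is isometric on \<open>D e\<close>, so that its range, the orbit of \<open>u\<close>, is closed.\<close>

lemma minimal_norm:
  assumes e: "minimal_projection e" and a: "a \<in> D" and u: "e u = u" "norm u = 1"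
  shows "norm (a (e x)) = norm (a u) * norm (e x)"
proof -
  note eD = minimal_projectionD(1)[OF e] and ep = minimal_projectionD(2)[OF e]
  have aB: "a \<in> bounded_operators" "e \<in> bounded_operators"
    using a eD by (auto intro: D_bounded_operators)
  have "adj a o\<^sub>L a \<in> D"
    using a by auto
  \<comment> \<open>For \<open>adj a o\<^sub>L a\<close> the scalar on \<open>e\<close> is the
    square of \<open>norm (a u)\<close>.\<close>
  from minimal_scalar[OF e this u, of x]
  have *: "e (adj a (a (e x))) = cinner (a u) (a u) *\<^sub>C e x"
    by (simp add: cinner_adj_left[OF aB(1)])
  have "cinner (a (e x)) (a (e x)) = cinner (adj a (a (e x))) (e x)"
    by (simp add: cinner_adj_left[OF aB(1)])
  also have "\<dots> = cinner (e (adj a (a (e x)))) (e x)"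
    using cinner_selfadjoint[OF aB(2) projection_adj[OF ep], of "adj a (a (e x))" "e x"]
    by (simp add: projection_idem[OF ep])
  also have "\<dots> = cinner (a u) (a u) * cinner (e x) (e x)"
    by (simp add: * cinner_scaleC_left)
  finally have "complex_of_real ((norm (a (e x)))\<^sup>2) = complex_of_real ((norm (a u) * norm (e x))\<^sup>2)"
    by (simp add: cinner_self power_mult_distrib)
  then have "(norm (a (e x)))\<^sup>2 = (norm (a u) * norm (e x))\<^sup>2"
    using of_real_eq_iff by blast
  then show ?thesis
    by (simp add: power2_eq_iff_nonneg)
qed

section \<open>Orbits of vectors under minimal projections\<close>

definition orbit :: "'h \<Rightarrow> 'h set" where
  "orbit u = (\<lambda>a. blinfun_apply a u) ` D"

lemma orbitI [intro]: "a \<in> D \<Longrightarrow> a u \<in> orbit u"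
  by (auto simp: orbit_def)

lemma orbit_base [simp]: "u \<in> orbit u"
  using orbitI[OF D_id, of u] by simp

lemma orbit_invariant: "a \<in> D \<Longrightarrow> x \<in> orbit u \<Longrightarrow> a x \<in> orbit u"
  using orbitI[OF D_compose, of a _ u] by (auto simp: orbit_def)

text \<open>By \<open>minimal_norm\<close>, a convergent sequence \<open>a n u\<close> lifts to a
  norm Cauchy sequence \<open>a n o\<^sub>L e\<close> in \<open>D\<close>. Its limit, applied to
  \<open>u\<close>, is the limit of the vectors.\<close>

lemma closed_csubspace_orbit:
  assumes e: "minimal_projection e" and u: "e u = u" "norm u = 1"
  shows "closed_csubspace (orbit u)"
  unfolding closed_csubspace_def
proof safe
  note eD = minimal_projectionD(1)[OF e] and ep = minimal_projectionD(2)[OF e]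
  show "closed (orbit u)"
    unfolding closed_sequential_limits
  proof safe
    fix x l
    assume "\<forall>n. x n \<in> orbit u" and lim: "x \<longlonglongrightarrow> l"
    then have "\<forall>n. \<exists>a\<in>D. x n = a u"
      by (auto simp: orbit_def)
    then obtain a where a: "\<And>n. a n \<in> D" "\<And>n. x n = a n u"
      by metis
    have dist: "norm ((a m o\<^sub>L e) - (a n o\<^sub>L e)) \<le> norm (x m - x n)" for m n
    proof (rule norm_blinfun_bound)
      fix y
      have "((a m o\<^sub>L e) - (a n o\<^sub>L e)) y = (a m - a n) (e y)"
        by (simp add: blinfun.bilinear_simps)
      also have "norm \<dots> = norm ((a m - a n) u) * norm (e y)"
        by (rule minimal_norm[OF e _ u]) (simp add: a D_diff)
      also have "\<dots> \<le> norm (x m - x n) * norm y"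
        by (simp add: a blinfun.bilinear_simps mult_left_mono projection_norm_apply[OF ep])
      finally show "norm (((a m o\<^sub>L e) - (a n o\<^sub>L e)) y) \<le> norm (x m - x n) * norm y" .
    qed simp
    have "Cauchy (\<lambda>n. a n o\<^sub>L e)"
    proof (rule CauchyI)
      fix \<epsilon> :: real
      assume "0 < \<epsilon>"
      then obtain N where "\<And>m n. N \<le> m \<Longrightarrow> N \<le> n \<Longrightarrow> norm (x m - x n) < \<epsilon>"
        using CauchyD[OF LIMSEQ_imp_Cauchy[OF lim]] by metis
      then show "\<exists>M. \<forall>m\<ge>M. \<forall>n\<ge>M. norm ((a m o\<^sub>L e) - (a n o\<^sub>L e)) < \<epsilon>"
        using dist le_less_trans by metis
    qed
    then obtain b where b: "(\<lambda>n. a n o\<^sub>L e) \<longlonglongrightarrow> b"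
      by (auto simp: Cauchy_convergent_iff convergent_def)
    have "b \<in> D"
      by (rule D_norm_limit[OF _ b]) (use a eD in auto)
    moreover have "(\<lambda>n. (a n o\<^sub>L e) u) \<longlonglongrightarrow> b u"
      by (intro tendsto_intros b)
    then have "b u = l"
      using lim u by (simp add: a(2)[symmetric] LIMSEQ_unique)
    ultimately show "l \<in> orbit u"
      by blast
  qed
  show "0 \<in> orbit u"
    using orbitI[OF D_0, of u] by simp
  show "x + y \<in> orbit u" if xy: "x \<in> orbit u" "y \<in> orbit u" for x y
  proof -
    obtain a b where "a \<in> D" "b \<in> D" "x = a u" "y = b u"
      using xy by (auto simp: orbit_def)
    then show ?thesis
      using orbitI[of "a + b" u] by (auto simp: blinfun.bilinear_simps)
  qed
  show "c *\<^sub>C x \<in> orbit u" if x: "x \<in> orbit u" for c x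
  proof -
    obtain a where "a \<in> D" "x = a u"
      using x by (auto simp: orbit_def)
    then show ?thesis
      using orbitI[of "c \<cdot>\<^sub>C a" u] by auto
  qed
qed

text \<open>Both \<open>a\<close> and \<open>adj a\<close> lie in \<open>D\<close> and leave the
  orbit invariant.\<close>

lemma orbit_projection_commute:
  assumes K: "closed_csubspace (orbit u)" and a: "a \<in> D"
  shows "orthogonal_projection (orbit u) (a x) = a (orthogonal_projection (orbit u) x)"
proof -
  let ?P = "orthogonal_projection (orbit u)"
  note P = orthogonal_projection[OF K]
  have inv: "?P (b (?P y)) = b (?P y)" if "b \<in> D" for b y
    by (intro P(4) orbit_invariant that P(3))
  have "inner (?P (a x)) y = inner (a (?P x)) y" for y
  proof -
    have "inner (?P (a x)) y = inner x (adj a (?P y))"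
      by (simp add: projection_inner[OF P(2)] inner_adj_right)
    also have "\<dots> = inner x (?P (adj a (?P y)))"
      by (simp add: inv[OF D_adj[OF a]])
    also have "\<dots> = inner (?P (a (?P x))) y"
      by (simp add: projection_inner[OF P(2), symmetric] inner_adj_right)
    finally show ?thesis
      by (simp add: inv[OF a])
  qed
  then show ?thesis
    using vector_eq_rdot by blast
qed

text \<open>The orbit meets the range of \<open>e\<close> only in the line through \<open>u\<close>,
  since \<open>e (a u)\<close> is a multiple of \<open>u\<close> for \<open>a\<close> in
  \<open>D\<close>. This is the source of the rank-one operators in
  \<open>orbit_operator_lift\<close>.\<close>

lemma orbit_projection_minimal:
  assumes e: "minimal_projection e" and u: "e u = u" "norm u = 1"
  shows "orthogonal_projection (orbit u) (e x) = cinner x u *\<^sub>C u"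
proof -
  let ?P = "orthogonal_projection (orbit u)"
  note K = closed_csubspace_orbit[OF e u]
  note P = orthogonal_projection[OF K]
  note eD = minimal_projectionD(1)[OF e] and ep = minimal_projectionD(2)[OF e]
  have eB: "e \<in> bounded_operators"
    using eD by (rule D_bounded_operators)
  obtain a where a: "a \<in> D" "?P (e x) = a u"
    using P(3)[of "e x"] by (auto simp: orbit_def)
  have "?P (e x) = e (?P (e x))"
    using orbit_projection_commute[OF K eD, of "e x"] by (simp add: projection_idem[OF ep])
  also have "\<dots> = cinner (a u) u *\<^sub>C u"
    using minimal_scalar[OF e a(1) u, of u] a(2) u by simp
  also have "cinner (a u) u = cinner (e x) (?P u)"
    using cinner_selfadjoint[OF P(1) projection_adj[OF P(2)], of "e x" u] a(2) by simp
  also have "\<dots> = cinner x u"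
    using cinner_selfadjoint[OF eB projection_adj[OF ep], of x u] P(4)[OF orbit_base] u by simp
  finally show ?thesis .
qed

text \<open>The projection \<open>f\<close> annihilates the orbit, because
  \<open>a u = a (e u)\<close>.\<close>

lemma orbit_projection_orthogonal:
  assumes e: "minimal_projection e" and u: "e u = u" "norm u = 1"
    and f: "f \<in> D" "projection f" and ef: "\<And>a. a \<in> D \<Longrightarrow> f o\<^sub>L a o\<^sub>L e = 0"
  shows "orthogonal_projection (orbit u) (f x) = 0"
proof -
  let ?P = "orthogonal_projection (orbit u)"
  note K = closed_csubspace_orbit[OF e u]
  obtain a where a: "a \<in> D" "?P (f x) = a u"
    using orthogonal_projection(3)[OF K, of "f x"] by (auto simp: orbit_def)
  have "?P (f x) = f (?P (f x))"
    using orbit_projection_commute[OF K f(1), of "f x"] by (simp add: projection_idem[OF f(2)])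
  also have "\<dots> = (f o\<^sub>L a o\<^sub>L e) u"
    using a(2) u by simp
  finally show ?thesis
    by (simp add: ef[OF a(1)])
qed

end

section \<open>Atomicity\<close>

context normal_expectation
begin

text \<open>Normality enters only here: otherwise \<open>\<Psi>\<close> could vanish on all operators of finite rank.\<close>

lemma nonzero_on_rank_one:
  assumes q: "q \<in> D" "projection q" "q \<noteq> 0"
  shows "\<exists>\<xi>. q \<xi> = \<xi> \<and> \<Psi> (rank_one \<xi> \<xi>) \<noteq> 0"
proof (rule ccontr)
  assume "\<not> ?thesis"
  then have zero: "\<Psi> (rank_one \<xi> \<xi>) = 0" if "q \<xi> = \<xi>" for \<xi>
    using that by blast
  obtain v where v: "q v \<noteq> 0"
    using q(3) by (metis blinfun_eqI zero_blinfun.rep_eq)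
  \<comment> \<open>A weak* open set that contains \<open>q\<close> but not 0; its preimage
    \<open>?U\<close> under \<open>\<Psi>\<close> still contains \<open>q\<close>.\<close>
  let ?W = "{T \<in> bounded_operators. cinner (T v) v \<in> {z. 0 < Re z}}"
  let ?U = "{T \<in> topspace weak_star. \<Psi> T \<in> ?W}"
  have "(\<lambda>T. cinner (blinfun_apply T v) v) \<in> predual"
    unfolding predual_def
  proof (intro CollectI exI conjI ext)
    let ?x = "\<lambda>n::nat. if n = 0 then v else 0"
    show "cinner (blinfun_apply T v) v = (\<Sum>n. cinner (blinfun_apply T (?x n)) (?x n))" for T
      by (subst suminf_finite[of "{0}"]) auto
    show "summable (\<lambda>n. (norm (?x n))\<^sup>2)" "summable (\<lambda>n. (norm (?x n))\<^sup>2)"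
      by (rule summable_finite[of "{0}"], auto)+
  qed
  then have "openin weak_star ?W"
    unfolding weak_star_def
    by (intro topology_generated_by_Basis CollectI exI conjI) (rule refl, assumption, rule open_halfspace_Re_gt)
  moreover have "continuous_map weak_star weak_star \<Psi>"
    using normal continuous_map_in_subtopology by blast
  ultimately have open_U: "openin weak_star ?U"
    by (rule openin_continuous_map_preimage[rotated])
  have "cinner (q v) v = complex_of_real ((norm (q v))\<^sup>2)"
    using cinner_selfadjoint[OF D_bounded_operators[OF q(1)] projection_adj[OF q(2)], of "q v" v]
    by (simp add: projection_idem[OF q(2)] cinner_self)
  then have "q \<in> ?U"
    using q v by (simp add: topspace_weak_star D_bounded_operators fixes_D)
  from weak_star_sequential_neighbourhood[OF open_U this] obtain V where V: "countable V"
    "\<forall>T C. (\<forall>n::nat. T n \<in> bounded_operators \<and> norm (T n) \<le> C) \<longrightarrow>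
      (\<forall>v\<in>V. (\<lambda>n. T n v) \<longlonglongrightarrow> q v) \<longrightarrow> (\<forall>\<^sub>F n in sequentially. T n \<in> ?U)"
    by - (elim exE conjE, rule that)
  \<comment> \<open>Only an inclusion is asked for, as \<open>V\<close> may be empty or
    finite.\<close>
  obtain w :: "nat \<Rightarrow> 'h" where w: "V \<subseteq> range w"
    using V(1) by (metis countable_as_injective_image_subset empty_subsetI range_from_nat_into subsetI
        range_eqI from_nat_into_surj)
  \<comment> \<open>Gram-Schmidt on the vectors \<open>q (w k)\<close>: each new direction adds a
    rank-one projection with vector in the range of \<open>q\<close>, on which \<open>\<Psi>\<close>
    vanishes by assumption. The resulting projections converge to \<open>q\<close> on
    \<open>V\<close>, so normality is contradicted.\<close>
  have "\<exists>F\<in>bounded_operators. projection F \<and> (\<forall>x. q (F x) = F x) \<and> \<Psi> F = 0 \<and>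
      (\<forall>k<n. F (q (w k)) = q (w k))" for n
  proof (induction n)
    case 0
    show ?case
      by (rule bexI[of _ 0]) (auto simp: projection_def \<Psi>_0)
  next
    case (Suc n)
    then obtain F where F: "F \<in> bounded_operators" "projection F" "\<And>x. q (F x) = F x" "\<Psi> F = 0"
      "\<And>k. k < n \<Longrightarrow> F (q (w k)) = q (w k)"
      by blast
    define r where "r = q (w n) - F (q (w n))"
    have r: "q r = r" "F r = 0"
      by (simp_all add: r_def blinfun.bilinear_simps F(3) projection_idem[OF q(2)] projection_idem[OF F(2)])
    show ?case
    proof (cases "r = 0")
      case True
      then have "F (q (w n)) = q (w n)"
        by (simp add: r_def)
      then show ?thesis
        using F by (metis less_Suc_eq)
    next
      case False
      define u where "u = (1 / norm r) *\<^sub>R r"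
      have u: "q u = u" "F u = 0" "norm u = 1" "r = norm r *\<^sub>R u"
        using False r by (simp_all add: u_def blinfun.bilinear_simps)
      have uF: "cinner (F x) u = 0" for x
        using cinner_selfadjoint[OF F(1) projection_adj[OF F(2)], of x u] u by simp
      let ?G = "F + rank_one u u"
      have "projection ?G"
        unfolding projection_def
        by (auto intro!: blinfun_eqI simp: adj_add adj_rank_one projection_adj[OF F(2)] blinfun.bilinear_simps
            projection_idem[OF F(2)] uF bounded_operators_scaleC[OF F(1)] u cinner_add_left
            cinner_scaleC_left cinner_self)
      moreover have "q (?G x) = ?G x" for x
        by (simp add: blinfun.bilinear_simps F(3) bounded_operators_scaleC[OF D_bounded_operators[OF q(1)]] u)
      moreover have "\<Psi> ?G = 0"
        using zero[OF u(1)] F by (simp add: \<Psi>_add)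
      moreover have "?G (q (w k)) = q (w k)" if "k < Suc n" for k
      proof (cases "k = n")
        case True
        have qw: "q (w n) = F (q (w n)) + r"
          by (simp add: r_def)
        have "cinner (q (w n)) u = cinner r u"
          by (subst qw) (simp add: cinner_add_left uF)
        also have "\<dots> = norm r"
          by (subst u(4)) (simp add: scaleR_scaleC cinner_scaleC_left cinner_self u(3))
        finally have "cinner (q (w n)) u *\<^sub>C u = r"
          using u(4) by (simp add: scaleR_scaleC[symmetric])
        then show ?thesis
          using True qw by (simp add: blinfun.bilinear_simps)
      next
        case False
        then have "F (q (w k)) = q (w k)"
          using F(5) that by simp
        then show ?thesis
          using uF[of "q (w k)"] by (simp add: blinfun.bilinear_simps)
      qed
      ultimately show ?thesis
        using F(1) by (intro bexI[of _ ?G]) auto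
    qed
  qed
  then obtain F where F: "\<And>n. F n \<in> bounded_operators" "\<And>n. projection (F n)" "\<And>n x. q (F n x) = F n x"
    "\<And>n. \<Psi> (F n) = 0" "\<And>n k. k < n \<Longrightarrow> F n (q (w k)) = q (w k)"
    by metis
  have Fq: "F n (q x) = F n x" for n x
  proof -
    have "inner (F n (q x)) y = inner (F n x) y" for y
      by (simp add: projection_inner[OF F(2)] projection_inner[OF q(2)] F(3))
    then show ?thesis
      using vector_eq_rdot by blast
  qed
  have "\<forall>\<^sub>F n in sequentially. F n \<in> ?U"
  proof (rule V(2)[THEN spec[of _ F], THEN spec[of _ 1], THEN mp, THEN mp])
    show "\<forall>n. F n \<in> bounded_operators \<and> norm (F n) \<le> 1"
      using F norm_projection by blast
    show "\<forall>v\<in>V. (\<lambda>n. F n v) \<longlonglongrightarrow> q v"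
    proof
      fix v
      assume "v \<in> V"
      then obtain k where k: "v = w k"
        using w by blast
      have "\<forall>\<^sub>F n in sequentially. F n v = q v"
        using eventually_gt_at_top[of k] by eventually_elim (use F(5) Fq k in metis)
      then show "(\<lambda>n. F n v) \<longlonglongrightarrow> q v"
        by (rule tendsto_eventually)
    qed
  qed
  then obtain n where "F n \<in> ?U"
    using eventually_happens'[OF sequentially_bot] by blast
  then show False
    by (simp add: F(4))
qed

lemma exists_minimal_projection:
  assumes q: "q \<in> D" "projection q" "q \<noteq> 0"
  shows "\<exists>e. minimal_projection e \<and> (\<forall>x. q (e x) = e x)"
proof -
  have qB: "q \<in> bounded_operators"
    using q(1) by (rule D_bounded_operators)
  obtain \<xi> where \<xi>: "q \<xi> = \<xi>" "\<Psi> (rank_one \<xi> \<xi>) \<noteq> 0"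
    using nonzero_on_rank_one[OF q] by blast
  define b where "b = \<Psi> (rank_one \<xi> \<xi>)"
  have b: "b \<in> D" "adj b = b" "\<And>x. 0 \<le> inner (b x) x"
    using positive[OF positive_rank_one, of \<xi>] by (auto simp: b_def in_D positive_op_iff)
  have "q o\<^sub>L b = b"
    using left_module[OF q(1), of "rank_one \<xi> \<xi>"] by (simp add: compose_rank_one qB \<xi> b_def)
  moreover from this have "b o\<^sub>L q = b"
    using adj_compose[of q b] by (simp add: b projection_adj[OF q(2)])
  ultimately have qb: "q (b x) = b x" "b (q x) = b x" for x
    by (metis blinfun_apply_blinfun_compose)+
  obtain z where z: "0 < inner (b z) z"
  proof -
    obtain x where "b x \<noteq> 0"
      using \<xi>(2) unfolding b_def by (metis blinfun_eqI zero_blinfun.rep_eq)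
    then have "0 < inner (b x) x"
      using positive_form_kernel[OF b(2,3), of x] by (meson not_le)
    then show ?thesis
      using that by blast
  qed
  then have "z \<noteq> 0"
    by auto
  \<comment> \<open>Half the Rayleigh quotient of \<open>b\<close> at \<open>z\<close>, so that
    \<open>b - \<delta>\<close> is still strictly positive at \<open>z\<close> and the cut
    \<open>p\<close> is nonzero.\<close>
  define \<delta> where "\<delta> = inner (b z) z / (2 * (norm z)\<^sup>2)"
  have \<delta>: "0 < \<delta>"
    using z \<open>z \<noteq> 0\<close> by (simp add: \<delta>_def)
  define h where "h = b - \<delta> *\<^sub>R id_blinfun"
  have h_form: "inner (h x) x = inner (b x) x - \<delta> * (norm x)\<^sup>2" for x
    by (simp add: h_def blinfun.bilinear_simps inner_diff_left power2_norm_eq_inner)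
  have "h \<in> D" "adj h = h"
    using b by (auto simp: h_def adj_diff adj_scaleR)
  from spectral_projection[OF this] obtain p where p: "p \<in> D" "projection p"
    "\<And>c. adj c = c \<Longrightarrow> h o\<^sub>L c = c o\<^sub>L h \<Longrightarrow> p o\<^sub>L c = c o\<^sub>L p"
    "\<And>x. p x = x \<Longrightarrow> 0 \<le> inner (h x) x" "\<And>x. p x = 0 \<Longrightarrow> inner (h x) x \<le> 0"
    by blast
  have "p \<noteq> 0"
  proof
    assume "p = 0"
    then have "inner (h z) z \<le> 0"
      using p(5) by simp
    then show False
      using z \<open>z \<noteq> 0\<close> by (simp add: h_form \<delta>_def)
  qed
  have lower: "\<delta> * (norm x)\<^sup>2 \<le> inner (b x) x" if "p x = x" for x
    using p(4)[OF that] by (simp add: h_form)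
  have "p o\<^sub>L q = q o\<^sub>L p"
    by (intro p(3) projection_adj[OF q(2)] blinfun_eqI) (simp add: h_def blinfun.bilinear_simps qb)
  then have pq_comm: "p (q x) = q (p x)" for x
    by (metis blinfun_apply_blinfun_compose)
  \<comment> \<open>The part of \<open>p x\<close> outside the range of \<open>q\<close> stays in
    the range of \<open>p\<close>, where \<open>b\<close> is at least \<open>\<delta>\<close>; but
    \<open>b\<close> kills it.\<close>
  have qp: "q (p x) = p x" for x
  proof -
    let ?y = "p x - q (p x)"
    have "p ?y = ?y" "b ?y = 0"
      by (simp_all add: blinfun.bilinear_simps pq_comm projection_idem[OF p(2)] qb)
    then have "\<delta> * (norm ?y)\<^sup>2 \<le> 0"
      using lower[of ?y] by simp
    then show ?thesis
      using \<delta> by (simp add: mult_le_0_iff)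
  qed
  have size: "\<delta> \<le> (norm (r \<xi>))\<^sup>2" if r: "r \<in> D" "projection r" "r \<noteq> 0" "\<And>x. p (r x) = r x" for r
  proof -
    have rB: "r \<in> bounded_operators"
      using r(1) by (rule D_bounded_operators)
    obtain y where y: "r y \<noteq> 0"
      using r(3) by (metis blinfun_eqI zero_blinfun.rep_eq)
    have "r o\<^sub>L b o\<^sub>L r = \<Psi> (r o\<^sub>L rank_one \<xi> \<xi> o\<^sub>L r)"
      using r rB by (simp add: b_def left_module right_module bounded_operators_compose)
    also have "r o\<^sub>L rank_one \<xi> \<xi> o\<^sub>L r = rank_one (r \<xi>) (r \<xi>)"
      by (simp add: compose_rank_one rank_one_compose rB projection_adj[OF r(2)])
    finally have rbr: "r o\<^sub>L b o\<^sub>L r = \<Psi> (rank_one (r \<xi>) (r \<xi>))" .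
    have "\<delta> * (norm (r y))\<^sup>2 \<le> inner (b (r y)) (r y)"
      using lower[of "r y"] r(4) by simp
    also have "\<dots> = inner ((r o\<^sub>L b o\<^sub>L r) (r y)) (r y)"
      using projection_inner[OF r(2), of "b (r y)" "r y"] by (simp add: projection_idem[OF r(2)])
    also have "\<dots> \<le> norm (\<Psi> (rank_one (r \<xi>) (r \<xi>))) * (norm (r y))\<^sup>2"
      unfolding rbr using abs_quadratic_le abs_le_D1 by blast
    also have "norm (\<Psi> (rank_one (r \<xi>) (r \<xi>))) \<le> (norm (r \<xi>))\<^sup>2"
      using order_trans[OF norm_\<Psi>_selfadjoint norm_rank_one_le] by (simp add: adj_rank_one)
    finally show ?thesis
      using y by (simp add: mult_right_mono)
  qed
  \<comment> \<open>Induction on a bound for the square of \<open>norm (r \<xi>)\<close> in units of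
    \<open>\<delta>\<close>. If \<open>r\<close> is not minimal it splits into \<open>s\<close> and
    \<open>r - s\<close>, and by \<open>size\<close> the part \<open>r - s\<close> takes away at
    least one unit.\<close>
  have descent: "\<exists>e. minimal_projection e \<and> (\<forall>x. r (e x) = e x)"
    if "r \<in> D" "projection r" "r \<noteq> 0" "\<And>x. p (r x) = r x" "(norm (r \<xi>))\<^sup>2 < real n * \<delta>" for r n
    using that
  proof (induction n arbitrary: r)
    case 0
    then show ?case
      using zero_le_power2[of "norm (r \<xi>)"] by simp
  next
    case (Suc n)
    show ?case
    proof (cases "minimal_projection r")
      case True
      then show ?thesis
        using projection_idem[OF Suc.prems(2)] by blast
    next
      case False
      then obtain s where s: "s \<in> D" "projection s" "r o\<^sub>L s = s" "s \<noteq> 0" "s \<noteq> r"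
        using Suc.prems by (auto simp: minimal_projection_def)
      have rs: "r (s x) = s x" for x
        using s(3) by (metis blinfun_apply_blinfun_compose)
      have "s o\<^sub>L r = s"
        using adj_compose[of r s] s by (simp add: projection_adj[OF s(2)] projection_adj[OF Suc.prems(2)])
      then have sr: "s (r x) = s x" for x
        by (metis blinfun_apply_blinfun_compose)
      have "projection (r - s)"
        unfolding projection_def
        by (auto simp: adj_diff projection_adj[OF s(2)] projection_adj[OF Suc.prems(2)] blinfun.bilinear_simps
            rs sr projection_idem[OF s(2)] projection_idem[OF Suc.prems(2)] intro!: blinfun_eqI)
      moreover have "p ((r - s) x) = (r - s) x" for x
      proof -
        have "p (s x) = s x"
          using Suc.prems(4)[of "s x"] by (simp add: rs)
        then show ?thesis
          by (simp add: blinfun.bilinear_simps Suc.prems(4))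
      qed
      ultimately have "\<delta> \<le> (norm ((r - s) \<xi>))\<^sup>2"
        using s Suc.prems(1) by (intro size) auto
      moreover have "(norm (r \<xi>))\<^sup>2 = (norm (s \<xi>))\<^sup>2 + (norm ((r - s) \<xi>))\<^sup>2"
        using projection_pythagoras[OF s(2), of "r \<xi>"] by (simp add: sr blinfun.bilinear_simps)
      ultimately have "(norm (s \<xi>))\<^sup>2 < real n * \<delta>"
        using Suc.prems(5) by (simp add: algebra_simps)
      moreover have "p (s x) = s x" for x
        using Suc.prems(4)[of "s x"] by (simp add: rs)
      ultimately obtain e where "minimal_projection e" "\<And>x. s (e x) = e x"
        using Suc.IH[OF s(1,2,4)] by blast
      then show ?thesis
        by (metis rs)
    qed
  qed
  obtain n where "(norm (p \<xi>))\<^sup>2 < real n * \<delta>"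
    using reals_Archimedean3[OF \<delta>] by blast
  then obtain e where "minimal_projection e" "\<And>x. p (e x) = e x"
    using descent[OF p(1,2) \<open>p \<noteq> 0\<close>] projection_idem[OF p(2)] by blast
  then show ?thesis
    by (metis qp)
qed

definition atom :: "('h \<Rightarrow>\<^sub>L 'h) \<Rightarrow> 'h \<Rightarrow> bool" where
  "atom e u \<longleftrightarrow> minimal_projection e \<and> e u = u \<and> norm u = 1 \<and> \<Psi> (rank_one u u) \<noteq> 0"

lemma atom_exists:
  assumes e: "minimal_projection e"
  shows "\<exists>u. atom e u"
proof -
  obtain \<xi> where \<xi>: "e \<xi> = \<xi>" "\<Psi> (rank_one \<xi> \<xi>) \<noteq> 0"
    using nonzero_on_rank_one minimal_projectionD[OF e] by blast
  then have "\<xi> \<noteq> 0"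
    using \<Psi>_0 by (auto simp: rank_one_def zero_blinfun_def[symmetric] map_fun_def id_def)
  define u where "u = (1 / norm \<xi>) *\<^sub>R \<xi>"
  have "\<xi> = complex_of_real (norm \<xi>) *\<^sub>C u"
    using \<open>\<xi> \<noteq> 0\<close> by (simp add: u_def flip: scaleR_scaleC)
  then have "rank_one \<xi> \<xi> = (complex_of_real (norm \<xi>) * cnj (complex_of_real (norm \<xi>))) \<cdot>\<^sub>C rank_one u u"
    by (metis rank_one_scaleC)
  then have "\<Psi> (rank_one u u) \<noteq> 0"
    using \<xi>(2) by (auto simp: \<Psi>_scale_op intro!: blinfun_eqI)
  then have "atom e u"
    using e \<xi>(1) \<open>\<xi> \<noteq> 0\<close> by (simp add: atom_def u_def blinfun.bilinear_simps)
  then show ?thesis ..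
qed

text \<open>As \<open>u\<close> lies in the range of \<open>e\<close>, the bimodule property puts
  \<open>\<Psi> (rank_one u u)\<close> into \<open>e D e\<close>, which consists of multiples of
  \<open>e\<close>.\<close>

lemma atom_weight:
  assumes "atom e u"
  shows "\<exists>\<mu>. \<mu> \<noteq> 0 \<and> (\<forall>x. \<Psi> (rank_one u u) x = \<mu> *\<^sub>C e x)"
proof -
  have e: "minimal_projection e" and u: "e u = u" "norm u = 1" and nz: "\<Psi> (rank_one u u) \<noteq> 0"
    using assms by (auto simp: atom_def)
  have eD: "e \<in> D" "projection e"
    using minimal_projectionD[OF e] by auto
  then have eB: "e \<in> bounded_operators"
    using D_bounded_operators by blast
  have "rank_one u u = e o\<^sub>L rank_one u u o\<^sub>L e"
    by (simp add: compose_rank_one rank_one_compose eB projection_adj[OF eD(2)] u)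
  then have "\<Psi> (rank_one u u) = e o\<^sub>L \<Psi> (rank_one u u) o\<^sub>L e"
    by (metis left_module right_module eD(1) eB bounded_operators_compose rank_one_bounded_operators)
  then have "\<Psi> (rank_one u u) x = e (\<Psi> (rank_one u u) (e x))" for x
    by (metis blinfun_apply_blinfun_compose)
  then have eq: "\<Psi> (rank_one u u) x = cinner (\<Psi> (rank_one u u) u) u *\<^sub>C e x" for x
    using minimal_scalar[OF e in_D[OF rank_one_bounded_operators] u] by metis
  moreover have "cinner (\<Psi> (rank_one u u) u) u \<noteq> 0"
  proof
    assume 0: "cinner (\<Psi> (rank_one u u) u) u = 0"
    have "\<Psi> (rank_one u u) x = 0" for x
      by (subst eq) (simp only: 0 scaleC_zero_left)
    then have "\<Psi> (rank_one u u) = 0"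
      by (intro blinfun_eqI) simp
    then show False
      using nz by simp
  qed
  ultimately show ?thesis
    by blast
qed

text \<open>Since \<open>T a e\<close> has rank one for \<open>a \<in> D\<close>, the operator \<open>\<Psi> T\<close> is a multiple of \<open>T\<close> on the
  orbit.\<close>

lemma orbit_operator_lift:
  assumes "atom e u" and T: "T \<in> operators_on (orbit u)"
  shows "\<exists>S\<in>D. (\<forall>x\<in>orbit u. S x = T x) \<and>
    (\<forall>f v. atom f v \<longrightarrow> (\<forall>a\<in>D. f o\<^sub>L a o\<^sub>L e = 0) \<longrightarrow> (\<forall>x\<in>orbit v. S x = 0))"
proof -
  have e: "minimal_projection e" and u: "e u = u" "norm u = 1"
    using assms(1) by (auto simp: atom_def)
  have eD: "e \<in> D" "projection e"
    using minimal_projectionD[OF e] by auto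
  let ?P = "orthogonal_projection (orbit u)"
  note K = closed_csubspace_orbit[OF e u]
  note P = orthogonal_projection[OF K]
  obtain \<mu> where \<mu>: "\<mu> \<noteq> 0" "\<And>x. \<Psi> (rank_one u u) x = \<mu> *\<^sub>C e x"
    using atom_weight[OF assms(1)] by blast
  have TB: "T \<in> bounded_operators"
    using T by (simp add: operators_on_def)
  define S where "S = (1 / \<mu>) \<cdot>\<^sub>C \<Psi> T"
  have "S \<in> D"
    using in_D[OF TB] by (auto simp: S_def)
  moreover have "S x = T x" if x: "x \<in> orbit u" for x
  proof -
    obtain a where a: "a \<in> D" "x = a u"
      using x by (auto simp: orbit_def)
    have aB: "a \<in> bounded_operators"
      using a(1) by (rule D_bounded_operators)
    have "T x \<in> orbit u"
      using T by (auto simp: operators_on_def)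
    then obtain c where c: "c \<in> D" "T x = c u"
      by (auto simp: orbit_def)
    \<comment> \<open>On the range of \<open>e\<close> only the component along \<open>u\<close>
      reaches the orbit, so \<open>T a e\<close> is \<open>c\<close> times a rank-one operator.
      Applying \<open>\<Psi>\<close> to both sides and evaluating at \<open>u\<close> produces the
      factor \<open>\<mu>\<close>.\<close>
    have "T o\<^sub>L (a o\<^sub>L e) = c o\<^sub>L rank_one u u"
    proof (rule blinfun_eqI)
      fix y
      have "T (a (e y)) = T (?P (a (e y)))"
        by (simp add: operators_on_factor[OF K T])
      also have "?P (a (e y)) = a (?P (e y))"
        by (rule orbit_projection_commute[OF K a(1)])
      also have "\<dots> = cinner y u *\<^sub>C x"
        by (simp add: orbit_projection_minimal[OF e u] bounded_operators_scaleC[OF aB] a(2))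
      also have "T \<dots> = cinner y u *\<^sub>C c u"
        by (simp add: bounded_operators_scaleC[OF TB] c(2))
      also have "\<dots> = c (cinner y u *\<^sub>C u)"
        by (simp add: bounded_operators_scaleC[OF D_bounded_operators[OF c(1)]])
      finally show "(T o\<^sub>L (a o\<^sub>L e)) y = (c o\<^sub>L rank_one u u) y"
        by simp
    qed
    then have "\<Psi> T o\<^sub>L (a o\<^sub>L e) = c o\<^sub>L \<Psi> (rank_one u u)"
      using right_module[OF _ TB, of "a o\<^sub>L e"] left_module[OF c(1) rank_one_bounded_operators, of u u] a(1) eD(1)
      by (simp add: D_compose)
    then have "(\<Psi> T o\<^sub>L (a o\<^sub>L e)) u = (c o\<^sub>L \<Psi> (rank_one u u)) u"
      by simp
    then have "\<Psi> T x = \<mu> *\<^sub>C T x"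
      using a(2) c(2) u by (simp add: \<mu> bounded_operators_scaleC[OF D_bounded_operators[OF c(1)]])
    then show ?thesis
      using \<mu>(1) by (simp add: S_def scaleC_scaleC)
  qed
  moreover have "S x = 0" if fv: "atom f v" "\<forall>a\<in>D. f o\<^sub>L a o\<^sub>L e = 0" and x: "x \<in> orbit v" for f v x
  proof -
    have f: "f \<in> D" "projection f" "f v = v"
      using fv(1) minimal_projectionD[of f] by (auto simp: atom_def)
    obtain a where a: "a \<in> D" "x = a v"
      using x by (auto simp: orbit_def)
    have "T o\<^sub>L (a o\<^sub>L f) = 0"
    proof (rule blinfun_eqI)
      fix y
      have "T (a (f y)) = T (?P (a (f y)))"
        by (simp add: operators_on_factor[OF K T])
      also have "?P (a (f y)) = a (?P (f y))"
        by (rule orbit_projection_commute[OF K a(1)])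
      also have "?P (f y) = 0"
        using fv(2) by (intro orbit_projection_orthogonal[OF e u f(1,2)]) auto
      finally show "(T o\<^sub>L (a o\<^sub>L f)) y = blinfun_apply 0 y"
        by simp
    qed
    then have "\<Psi> T o\<^sub>L (a o\<^sub>L f) = 0"
      using right_module[OF _ TB, of "a o\<^sub>L f"] a(1) f(1) by (simp add: D_compose \<Psi>_0)
    then have "(\<Psi> T o\<^sub>L (a o\<^sub>L f)) v = 0"
      by simp
    then show ?thesis
      using a(2) f(3) by (simp add: S_def)
  qed
  ultimately show ?thesis
    by blast
qed

text \<open>Zorn's lemma for families with pairwise \<open>e D f = 0\<close>. Maximality is recorded
  as a link from every minimal \<open>g\<close> to some member: otherwise \<open>g\<close> could be
  inserted, and membership would give \<open>g o\<^sub>L g = 0\<close>.\<close>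

lemma maximal_family:
  "\<exists>M. (\<forall>e\<in>M. minimal_projection e) \<and>
    (\<forall>e\<in>M. \<forall>f\<in>M. e \<noteq> f \<longrightarrow> (\<forall>a\<in>D. e o\<^sub>L a o\<^sub>L f = 0)) \<and>
    (\<forall>g. minimal_projection g \<longrightarrow> (\<exists>e\<in>M. \<exists>a\<in>D. g o\<^sub>L a o\<^sub>L e \<noteq> 0))"
proof -
  define \<A> where "\<A> = {M. (\<forall>e\<in>M. minimal_projection e) \<and>
    (\<forall>e\<in>M. \<forall>f\<in>M. e \<noteq> f \<longrightarrow> (\<forall>a\<in>D. e o\<^sub>L a o\<^sub>L f = 0))}"
  have "\<Union>\<C> \<in> \<A>" if chain: "subset.chain \<A> \<C>" for \<C>
  proof -
    have sub: "\<C> \<subseteq> \<A>" and total: "\<And>X Y. X \<in> \<C> \<Longrightarrow> Y \<in> \<C> \<Longrightarrow> X \<subseteq> Y \<or> Y \<subseteq> X"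
      using chain by (auto simp: subset_chain_def)
    show ?thesis
      unfolding \<A>_def
    proof (intro CollectI conjI ballI impI)
      fix e
      assume "e \<in> \<Union>\<C>"
      then show "minimal_projection e"
        using sub by (auto simp: \<A>_def)
    next
      fix e f a
      assume ef: "e \<in> \<Union>\<C>" "f \<in> \<Union>\<C>" "e \<noteq> f" and a: "a \<in> D"
      then obtain X Y where XY: "X \<in> \<C>" "e \<in> X" "Y \<in> \<C>" "f \<in> Y"
        by blast
      obtain Z where Z: "Z \<in> \<C>" "e \<in> Z" "f \<in> Z"
        using total[OF XY(1,3)] XY that by (elim disjE) auto
      then have "Z \<in> \<A>"
        using sub by auto
      then show "e o\<^sub>L a o\<^sub>L f = 0"
        using Z ef(3) a by (simp add: \<A>_def)
    qed
  qed
  from subset_Zorn'[OF this] obtain M where M: "M \<in> \<A>" "\<And>X. X \<in> \<A> \<Longrightarrow> M \<subseteq> X \<Longrightarrow> X = M"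
    by blast
  have "\<exists>e\<in>M. \<exists>a\<in>D. g o\<^sub>L a o\<^sub>L e \<noteq> 0" if g: "minimal_projection g" for g
  proof (rule ccontr)
    assume "\<not> ?thesis"
    then have zero: "g o\<^sub>L a o\<^sub>L e = 0" if "e \<in> M" "a \<in> D" for e a
      using that by blast
    have zero': "e o\<^sub>L a o\<^sub>L g = 0" if "e \<in> M" "a \<in> D" for e a
    proof -
      have "projection e"
        using that(1) M(1) minimal_projectionD(2) by (auto simp: \<A>_def)
      then have "e o\<^sub>L a o\<^sub>L g = adj (g o\<^sub>L adj a o\<^sub>L e)"
        by (simp add: adj_compose projection_adj minimal_projectionD(2)[OF g] blinfun_compose_assoc)
      then show ?thesis
        using zero[OF that(1) D_adj[OF that(2)]] by simp
    qed
    have "insert g M \<in> \<A>"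
      using M(1) g zero zero' by (auto simp: \<A>_def)
    then have "g \<in> M"
      using M(2) by blast
    from zero[OF this D_id] have "g o\<^sub>L id_blinfun o\<^sub>L g = 0" .
    moreover have "g o\<^sub>L id_blinfun o\<^sub>L g = g"
      by (rule blinfun_eqI) (simp add: projection_idem[OF minimal_projectionD(2)[OF g]])
    ultimately show False
      using minimal_projectionD(3)[OF g] by simp
  qed
  moreover have "\<forall>e\<in>M. minimal_projection e"
    "\<forall>e\<in>M. \<forall>f\<in>M. e \<noteq> f \<longrightarrow> (\<forall>a\<in>D. e o\<^sub>L a o\<^sub>L f = 0)"
    using M(1) by (simp_all add: \<A>_def)
  ultimately show ?thesis
    by (intro exI[of _ M] conjI; simp)
qed

end

section \<open>Restriction of \<open>D\<close> to the orbits of a maximal family\<close>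

locale atom_family = normal_expectation D \<Psi>
  for D :: "('h::complex_hilbert_space \<Rightarrow>\<^sub>L 'h) set" and \<Psi> +
  fixes M :: "('h \<Rightarrow>\<^sub>L 'h) set" and \<xi> :: "('h \<Rightarrow>\<^sub>L 'h) \<Rightarrow> 'h"
  assumes orthogonal: "e \<in> M \<Longrightarrow> f \<in> M \<Longrightarrow> e \<noteq> f \<Longrightarrow> a \<in> D \<Longrightarrow> e o\<^sub>L a o\<^sub>L f = 0"
    and maximal: "minimal_projection g \<Longrightarrow> \<exists>e\<in>M. \<exists>a\<in>D. g o\<^sub>L a o\<^sub>L e \<noteq> 0"
    and atoms: "e \<in> M \<Longrightarrow> atom e (\<xi> e)"
begin

lemma M_minimal: "e \<in> M \<Longrightarrow> minimal_projection e"
  and M_fixes: "e \<in> M \<Longrightarrow> e (\<xi> e) = \<xi> e"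
  and M_unit: "e \<in> M \<Longrightarrow> norm (\<xi> e) = 1"
  using atoms by (simp_all add: atom_def)

lemma closed_csubspace_family: "i \<in> \<xi> ` M \<Longrightarrow> closed_csubspace (orbit i)"
  using closed_csubspace_orbit[OF M_minimal M_fixes M_unit] by blast

text \<open>If the form were negative somewhere, a nonzero projection \<open>q\<close> of
  \<open>D\<close> would carry \<open>a \<le> - \<delta>\<close>. It dominates a minimal
  \<open>g\<close>, and a link from \<open>g\<close> to the family moves some \<open>\<xi> e\<close>
  to a nonzero vector of its orbit inside the range of \<open>q\<close>.\<close>

lemma positive_on_orbits:
  assumes a: "a \<in> D" "adj a = a" and pos: "\<And>i y. i \<in> \<xi> ` M \<Longrightarrow> y \<in> orbit i \<Longrightarrow> 0 \<le> inner (a y) y"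
  shows "0 \<le> inner (a x) x"
proof (rule ccontr)
  assume neg: "\<not> ?thesis"
  then have "x \<noteq> 0"
    by auto
  \<comment> \<open>Half the absolute Rayleigh quotient at \<open>x\<close>, which keeps the form of
    \<open>h\<close> negative there and makes \<open>q\<close> nonzero.\<close>
  define \<delta> where "\<delta> = - inner (a x) x / (2 * (norm x)\<^sup>2)"
  have \<delta>: "0 < \<delta>"
    using neg \<open>x \<noteq> 0\<close> by (simp add: \<delta>_def divide_neg_pos)
  define h where "h = a + \<delta> *\<^sub>R id_blinfun"
  have h_form: "inner (h y) y = inner (a y) y + \<delta> * (norm y)\<^sup>2" for y
    by (simp add: h_def blinfun.bilinear_simps inner_add_left power2_norm_eq_inner)
  have "h \<in> D" "adj h = h"
    using a by (auto simp: h_def adj_add adj_scaleR)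
  from spectral_projection[OF this] obtain p where p: "p \<in> D" "projection p"
    "\<And>x. p x = x \<Longrightarrow> 0 \<le> inner (h x) x" "\<And>x. p x = 0 \<Longrightarrow> inner (h x) x \<le> 0"
    by blast
  define q where "q = id_blinfun - p"
  have q: "q \<in> D" "projection q"
    using p projection_complement by (auto simp: q_def)
  have "q \<noteq> 0"
  proof
    assume "q = 0"
    then have "p x = x"
      by (simp add: q_def)
    from p(3)[OF this] have "0 \<le> inner (a x) x + \<delta> * (norm x)\<^sup>2"
      by (simp add: h_form)
    then show False
      using neg \<open>x \<noteq> 0\<close> by (simp add: \<delta>_def)
  qed
  then obtain g where g: "minimal_projection g" "\<And>x. q (g x) = g x"
    using exists_minimal_projection q by blast
  then obtain e c where e: "e \<in> M" and c: "c \<in> D" and ne: "g o\<^sub>L c o\<^sub>L e \<noteq> 0"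
    using maximal by blast
  let ?y = "g (c (\<xi> e))"
  have gc: "g o\<^sub>L c \<in> D"
    using minimal_projectionD(1)[OF g(1)] c by auto
  have "?y \<noteq> 0"
  proof
    assume "?y = 0"
    then have "norm ((g o\<^sub>L c) (e z)) = 0" for z
      using minimal_norm[OF M_minimal[OF e] gc M_fixes[OF e] M_unit[OF e], of z] by simp
    then show False
      using ne by (metis blinfun_apply_blinfun_compose blinfun_eqI norm_eq_zero zero_blinfun.rep_eq)
  qed
  have "p ?y = 0"
    using g(2)[of "c (\<xi> e)"] by (simp add: q_def blinfun.bilinear_simps)
  then have "inner (a ?y) ?y + \<delta> * (norm ?y)\<^sup>2 \<le> 0"
    using p(4) by (simp add: h_form)
  moreover have "0 < \<delta> * (norm ?y)\<^sup>2"
    using \<delta> \<open>?y \<noteq> 0\<close> by simp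
  moreover have "0 \<le> inner (a ?y) ?y"
    using e orbitI[OF gc, of "\<xi> e"] by (intro pos[of "\<xi> e"]) auto
  ultimately show False
    by linarith
qed

text \<open>\<open>positive_on_orbits\<close> for \<open>C\<^sup>2\<close> minus
  \<open>adj S o\<^sub>L S\<close>.\<close>

lemma norm_le_on_orbits:
  assumes S: "S \<in> D" and "0 \<le> C"
    and bound: "\<And>i y. i \<in> \<xi> ` M \<Longrightarrow> y \<in> orbit i \<Longrightarrow> norm (S y) \<le> C * norm y"
  shows "norm S \<le> C"
proof (rule norm_blinfun_bound[OF \<open>0 \<le> C\<close>])
  fix x
  define a where "a = C\<^sup>2 *\<^sub>R id_blinfun - (adj S o\<^sub>L S)"
  have a: "a \<in> D" "adj a = a"
    using S by (auto simp: a_def adj_diff adj_scaleR adj_compose)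
  have a_form: "inner (a y) y = (C * norm y)\<^sup>2 - (norm (S y))\<^sup>2" for y
    by (simp add: a_def blinfun.bilinear_simps inner_diff_left inner_adj_left power_mult_distrib
        power2_norm_eq_inner)
  have "0 \<le> inner (a x) x"
  proof (rule positive_on_orbits[OF a])
    fix i y
    assume "i \<in> \<xi> ` M" "y \<in> orbit i"
    then have "(norm (S y))\<^sup>2 \<le> (C * norm y)\<^sup>2"
      by (intro power_mono bound) auto
    then show "0 \<le> inner (a y) y"
      by (simp add: a_form)
  qed
  then have "(norm (S x))\<^sup>2 \<le> (C * norm x)\<^sup>2"
    by (simp add: a_form)
  then show "norm (S x) \<le> C * norm x"
    by (rule power2_le_imp_le) (use \<open>0 \<le> C\<close> in simp)
qed

lemma eq_on_orbits:
  assumes "S \<in> D" "T \<in> D" "\<And>i y. i \<in> \<xi> ` M \<Longrightarrow> y \<in> orbit i \<Longrightarrow> S y = T y"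
  shows "S = T"
proof -
  have "norm (S - T) \<le> 0"
    by (rule norm_le_on_orbits) (use assms in \<open>auto simp: blinfun.bilinear_simps\<close>)
  then show ?thesis
    by simp
qed

lemma family_lift:
  assumes "i \<in> \<xi> ` M" "T \<in> operators_on (orbit i)"
  shows "\<exists>S\<in>D. (\<forall>y\<in>orbit i. S y = T y) \<and> (\<forall>j\<in>\<xi> ` M. j \<noteq> i \<longrightarrow> (\<forall>y\<in>orbit j. S y = 0))"
proof -
  obtain e where e: "e \<in> M" "i = \<xi> e"
    using assms(1) by blast
  obtain S where S: "S \<in> D" "\<forall>y\<in>orbit i. S y = T y"
    "\<And>f v. atom f v \<Longrightarrow> \<forall>a\<in>D. f o\<^sub>L a o\<^sub>L e = 0 \<Longrightarrow> \<forall>y\<in>orbit v. S y = 0"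
    using orbit_operator_lift[OF atoms[OF e(1)], of T] assms(2) e(2) by blast
  have "\<forall>y\<in>orbit j. S y = 0" if j: "j \<in> \<xi> ` M" "j \<noteq> i" for j
  proof -
    obtain f where f: "f \<in> M" "j = \<xi> f"
      using j(1) by blast
    then have "f \<noteq> e"
      using j(2) e(2) by blast
    then show ?thesis
      using S(3)[OF atoms[OF f(1)]] orthogonal[OF f(1) e(1)] f(2) by blast
  qed
  then show ?thesis
    using S(1,2) by blast
qed

text \<open>The lifts of the components are added up weakly, outside \<open>D\<close>; applying \<open>\<Psi>\<close> to the sum
  brings it back into \<open>D\<close>.\<close>

lemma family_sum:
  assumes T: "T \<in> linf_sum (\<xi> ` M) orbit"
  shows "\<exists>d\<in>D. \<forall>i\<in>\<xi> ` M. \<forall>y\<in>orbit i. d y = T i y"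
proof -
  let ?I = "\<xi> ` M"
  have "\<forall>i\<in>?I. \<exists>S\<in>D. (\<forall>y\<in>orbit i. S y = T i y) \<and> (\<forall>j\<in>?I. j \<noteq> i \<longrightarrow> (\<forall>y\<in>orbit j. S y = 0))"
    using T family_lift by (auto simp: linf_sum_def)
  from bchoice[OF this[unfolded Bex_def]] obtain S where
    "\<forall>i\<in>?I. S i \<in> D \<and> (\<forall>y\<in>orbit i. S i y = T i y) \<and> (\<forall>j\<in>?I. j \<noteq> i \<longrightarrow> (\<forall>y\<in>orbit j. S i y = 0))"
    by blast
  then have S: "\<And>i. i \<in> ?I \<Longrightarrow> S i \<in> D" "\<And>i y. i \<in> ?I \<Longrightarrow> y \<in> orbit i \<Longrightarrow> S i y = T i y"
    "\<And>i j y. i \<in> ?I \<Longrightarrow> j \<in> ?I \<Longrightarrow> j \<noteq> i \<Longrightarrow> y \<in> orbit j \<Longrightarrow> S i y = 0"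
    by blast+
  obtain C where C: "0 \<le> C" "\<And>i. i \<in> ?I \<Longrightarrow> norm (T i) \<le> C"
  proof -
    obtain C where "\<forall>i\<in>?I. norm (T i) \<le> C"
      using T by (auto simp: linf_sum_def)
    then show ?thesis
      using that[of "\<bar>C\<bar>"] by fastforce
  qed
  \<comment> \<open>On a given orbit at most one summand survives, so the bound does not grow with
    \<open>F\<close>.\<close>
  have signed: "norm (\<Sum>i\<in>F. s i *\<^sub>R S i) \<le> C" if F: "finite F" "F \<subseteq> ?I" and s: "\<And>i. \<bar>s i\<bar> \<le> 1"
    for F and s :: "'h \<Rightarrow> real"
  proof (rule norm_le_on_orbits[OF _ C(1)])
    show "(\<Sum>i\<in>F. s i *\<^sub>R S i) \<in> D"
      using F S(1) by auto
    fix j y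
    assume j: "j \<in> ?I" and y: "y \<in> orbit j"
    have "(\<Sum>i\<in>F. s i *\<^sub>R S i) y = (\<Sum>i\<in>F. if i = j then s j *\<^sub>R T j y else 0)"
      unfolding blinfun.sum_left blinfun.scaleR_left
    proof (rule sum.cong)
      fix i
      assume "i \<in> F"
      then have "i \<in> ?I"
        using F(2) by blast
      then show "s i *\<^sub>R S i y = (if i = j then s j *\<^sub>R T j y else 0)"
        using S(2)[OF j y] S(3)[OF _ j _ y, of i] by auto
    qed simp
    also have "\<dots> = (if j \<in> F then s j *\<^sub>R T j y else 0)"
      using F(1) by simp
    finally have eq: "(\<Sum>i\<in>F. s i *\<^sub>R S i) y = (if j \<in> F then s j *\<^sub>R T j y else 0)" .
    have "\<bar>s j\<bar> * norm (T j y) \<le> 1 * (C * norm y)"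
      using s[of j] norm_blinfun[of "T j" y] mult_right_mono[OF C(2)[OF j], of "norm y"]
      by (intro mult_mono) auto
    then show "norm ((\<Sum>i\<in>F. s i *\<^sub>R S i) y) \<le> C * norm y"
      using C(1) by (simp add: eq)
  qed
  \<comment> \<open>Choosing the signs of the matrix coefficients turns the sum of absolute values
    into a single coefficient of a signed sum. The uniform bound makes the weak sum absolutely
    convergent and bounded.\<close>
  have abs_sum: "(\<Sum>i\<in>F. \<bar>inner (S i x) y\<bar>) \<le> C * norm x * norm y" if F: "finite F" "F \<subseteq> ?I" for F x y
  proof -
    define s where "s i = sgn (inner (S i x) y)" for i
    have "(\<Sum>i\<in>F. \<bar>inner (S i x) y\<bar>) = inner ((\<Sum>i\<in>F. s i *\<^sub>R S i) x) y"
      by (simp add: blinfun.sum_left blinfun.scaleR_left inner_sum_left s_def abs_sgn mult.commute)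
    also have "\<dots> \<le> norm ((\<Sum>i\<in>F. s i *\<^sub>R S i) x) * norm y"
      by (rule norm_cauchy_schwarz)
    also have "\<dots> \<le> norm (\<Sum>i\<in>F. s i *\<^sub>R S i) * norm x * norm y"
      by (intro mult_right_mono norm_blinfun) simp
    also have "\<dots> \<le> C * norm x * norm y"
      using signed[OF F, of s] by (intro mult_right_mono) (auto simp: s_def sgn_if)
    finally show ?thesis .
  qed
  have abs_summable: "(\<lambda>i. \<bar>inner (S i x) y\<bar>) summable_on ?I" for x y
  proof (rule nonneg_bdd_above_summable_on)
    show "bdd_above (sum (\<lambda>i. \<bar>inner (S i x) y\<bar>) ` {F. F \<subseteq> ?I \<and> finite F})"
    proof (rule bdd_aboveI2)
      fix F
      assume "F \<in> {F. F \<subseteq> ?I \<and> finite F}"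
      then show "(\<Sum>i\<in>F. \<bar>inner (S i x) y\<bar>) \<le> C * norm x * norm y"
        by (intro abs_sum) auto
    qed
  qed simp
  have summable: "(\<lambda>i. inner (S i x) y) summable_on ?I" for x y
    by (rule abs_summable_summable) (unfold real_norm_def, rule abs_summable)
  define B where "B x y = (\<Sum>\<^sub>\<infinity>i\<in>?I. inner (S i x) y)" for x y
  have "bounded_bilinear B"
  proof
    show "B (x + x') y = B x y + B x' y" "B x (y + y') = B x y + B x y'" for x x' y y'
      unfolding B_def blinfun.add_right inner_add_left inner_add_right
      by (intro infsum_add summable)+
    show "B (r *\<^sub>R x) y = r *\<^sub>R B x y" "B x (r *\<^sub>R y) = r *\<^sub>R B x y" for r x y
      unfolding B_def by (simp_all add: blinfun.scaleR_right infsum_cmult_right')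
    have "norm (B x y) \<le> norm x * norm y * C" for x y
    proof -
      have "norm (B x y) \<le> (\<Sum>\<^sub>\<infinity>i\<in>?I. \<bar>inner (S i x) y\<bar>)"
        unfolding B_def using norm_infsum_bound[of "\<lambda>i. inner (S i x) y" ?I] abs_summable by simp
      also have "\<dots> \<le> C * norm x * norm y"
        by (rule infsum_le_finite_sums[OF abs_summable abs_sum])
      finally show ?thesis
        by (simp add: mult_ac)
    qed
    then show "\<exists>K. \<forall>x y. norm (B x y) \<le> norm x * norm y * K"
      by blast
  qed
  then obtain R :: "'h \<Rightarrow>\<^sub>L 'h" where R: "\<And>x y. inner (R x) y = B x y"
    using bounded_form_representation by blast
  have "R (c *\<^sub>C x) = c *\<^sub>C R x" for c x
  proof -
    have "inner (R (c *\<^sub>C x)) y = inner (c *\<^sub>C R x) y" for y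
      unfolding R inner_scaleC B_def
      by (rule infsum_cong)
        (simp add: bounded_operators_scaleC[OF D_bounded_operators[OF S(1)]] inner_scaleC)
    then show ?thesis
      using vector_eq_rdot by blast
  qed
  then have RB: "R \<in> bounded_operators"
    by (simp add: bounded_operators_def)
  have "\<Psi> R y = T j y" if j: "j \<in> ?I" and y: "y \<in> orbit j" for j y
  proof -
    obtain e where e: "e \<in> M" "j = \<xi> e"
      using j by blast
    obtain a where a: "a \<in> D" "y = a j"
      using y by (auto simp: orbit_def)
    have eD: "e \<in> D"
      using minimal_projectionD(1)[OF M_minimal[OF e(1)]] .
    have ae: "a o\<^sub>L e \<in> D"
      using a(1) eD by auto
    \<comment> \<open>\<open>S i\<close> is known to vanish on the orbit only;
      \<open>minimal_norm\<close> spreads this to all of \<open>a (e z)\<close>.\<close>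
    have vanish: "S i (a (e z)) = 0" if i: "i \<in> ?I" "i \<noteq> j" for i z
    proof -
      have "S i o\<^sub>L a \<in> D"
        using S(1)[OF i(1)] a(1) by auto
      from minimal_norm[OF M_minimal[OF e(1)] this M_fixes[OF e(1)] M_unit[OF e(1)], of z]
      have "norm (S i (a (e z))) = norm (S i (a j)) * norm (e z)"
        by (simp add: e(2))
      moreover have "S i (a j) = 0"
        using S(3)[OF i(1) j] i(2) y a(2) by auto
      ultimately show ?thesis
        by simp
    qed
    \<comment> \<open>After multiplication by \<open>a o\<^sub>L e\<close> a single summand remains,
      and it lies in \<open>D\<close>, so \<open>\<Psi>\<close> fixes the right side; on the left
      \<open>right_module\<close> takes \<open>a o\<^sub>L e\<close> out.\<close>
    have "R o\<^sub>L (a o\<^sub>L e) = S j o\<^sub>L (a o\<^sub>L e)"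
    proof (rule blinfun_eq_innerI)
      fix z w
      have "inner (R (a (e z))) w = (\<Sum>\<^sub>\<infinity>i\<in>{j}. inner (S i (a (e z))) w)"
        unfolding R B_def by (rule infsum_cong_neutral) (use j vanish in auto)
      then show "inner ((R o\<^sub>L (a o\<^sub>L e)) z) w = inner ((S j o\<^sub>L (a o\<^sub>L e)) z) w"
        by simp
    qed
    then have "\<Psi> R o\<^sub>L (a o\<^sub>L e) = S j o\<^sub>L (a o\<^sub>L e)"
      using right_module[OF ae RB] fixes_D[OF D_compose[OF S(1)[OF j] ae]] by simp
    then have "(\<Psi> R o\<^sub>L (a o\<^sub>L e)) j = (S j o\<^sub>L (a o\<^sub>L e)) j"
      by simp
    then show ?thesis
      using S(2)[OF j y] a(2) e(2) M_fixes[OF e(1)] by simp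
  qed
  then show ?thesis
    using in_D[OF RB] by blast
qed

lemma atomic_D: "atomic D"
proof -
  let ?I = "\<xi> ` M"
  let ?P = "\<lambda>i. orthogonal_projection (orbit i)"
  \<comment> \<open>Restriction to each orbit, extended by zero on its complement. The vectors
    \<open>\<xi> e\<close> serve as indices, and the value 0 off the index set is the convention of
    \<open>linf_sum\<close>.\<close>
  define \<theta> :: "('h \<Rightarrow>\<^sub>L 'h) \<Rightarrow> 'h \<Rightarrow> ('h \<Rightarrow>\<^sub>L 'h)" where "\<theta> d i = (if i \<in> ?I then d o\<^sub>L ?P i else 0)" for d i
  note P = orthogonal_projection[OF closed_csubspace_family]
  note commute = orbit_projection_commute[OF closed_csubspace_family]
  have restrict: "d o\<^sub>L ?P i \<in> operators_on (orbit i)" if d: "d \<in> D" and i: "i \<in> ?I" for d i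
    unfolding operators_on_def
  proof (intro CollectI conjI allI impI)
    show "d o\<^sub>L ?P i \<in> bounded_operators"
      using D_bounded_operators[OF d] P(1)[OF i] by auto
    show "range (d o\<^sub>L ?P i) \<subseteq> orbit i"
      using orbit_invariant[OF d] P(3)[OF i] by auto
    fix x
    assume "\<forall>y\<in>orbit i. cinner x y = 0"
    then have "inner x (?P i x) = 0"
      using P(3)[OF i, of x] by (simp flip: Re_cinner)
    then have "?P i x = 0"
      using projection_quadratic[OF P(2)[OF i], of x] by (simp add: inner_commute)
    then show "(d o\<^sub>L ?P i) x = 0"
      by simp
  qed
  have "norm (d o\<^sub>L ?P i) \<le> norm d" if "i \<in> ?I" for d i
    using norm_blinfun_compose[of d "?P i"] mult_left_mono[OF norm_projection[OF P(2)[OF that]], of "norm d"]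
    by simp
  then have into: "\<theta> d \<in> linf_sum ?I orbit" if "d \<in> D" for d
    using restrict[OF that] unfolding linf_sum_def by (auto simp: \<theta>_def)
  have "inj_on \<theta> D"
  proof (rule inj_onI)
    fix S T
    assume ST: "S \<in> D" "T \<in> D" and eq: "\<theta> S = \<theta> T"
    show "S = T"
    proof (rule eq_on_orbits[OF ST])
      fix i y
      assume i: "i \<in> ?I" and y: "y \<in> orbit i"
      have "S o\<^sub>L ?P i = T o\<^sub>L ?P i"
        using fun_cong[OF eq, of i] i by (simp add: \<theta>_def)
      then have "(S o\<^sub>L ?P i) y = (T o\<^sub>L ?P i) y"
        by simp
      then show "S y = T y"
        by (simp add: P(4)[OF i y])
    qed
  qed
  moreover have "T \<in> \<theta> ` D" if T: "T \<in> linf_sum ?I orbit" for T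
  proof -
    obtain d where d: "d \<in> D" "\<And>i y. i \<in> ?I \<Longrightarrow> y \<in> orbit i \<Longrightarrow> d y = T i y"
      using family_sum[OF T] by blast
    have "T i = \<theta> d i" for i
    proof (cases "i \<in> ?I")
      case True
      then have "T i \<in> operators_on (orbit i)"
        using T unfolding linf_sum_def by blast
      from operators_on_factor[OF closed_csubspace_family[OF True] this] show ?thesis
        using True d(2)[OF True P(3)[OF True]] by (intro blinfun_eqI) (simp add: \<theta>_def)
    next
      case False
      then show ?thesis
        using T by (simp add: linf_sum_def \<theta>_def)
    qed
    then show ?thesis
      using d(1) by blast
  qed
  ultimately have "bij_betw \<theta> D (linf_sum ?I orbit)"
    using into by (auto simp: bij_betw_def)
  moreover have "\<theta> (S + T) = (\<lambda>i. \<theta> S i + \<theta> T i)" for S T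
    by (auto simp: \<theta>_def blinfun_compose_simps)
  moreover have "\<theta> (c \<cdot>\<^sub>C T) = (\<lambda>i. c \<cdot>\<^sub>C \<theta> T i)" for c T
    by (rule ext, rule blinfun_eqI) (simp add: \<theta>_def)
  moreover have "\<theta> (S o\<^sub>L T) = (\<lambda>i. \<theta> S i o\<^sub>L \<theta> T i)" if "T \<in> D" for S T
    by (rule ext, rule blinfun_eqI)
      (simp add: \<theta>_def P(4)[OF _ orbit_invariant[OF that P(3)]])
  moreover have "\<theta> (adj_op T) = (\<lambda>i. adj_op (\<theta> T i))" if T: "T \<in> D" for T
  proof
    fix i
    show "\<theta> (adj_op T) i = adj_op (\<theta> T i)"
    proof (cases "i \<in> ?I")
      case True
      have TB: "T \<in> bounded_operators"
        using T by (rule D_bounded_operators)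
      have "adj T o\<^sub>L ?P i = adj (T o\<^sub>L ?P i)"
        by (rule blinfun_eqI)
          (simp add: adj_compose projection_adj[OF P(2)[OF True]] commute[OF True D_adj[OF T]])
      then show ?thesis
        using True TB P(1)[OF True] by (simp add: \<theta>_def adj_op_eq bounded_operators_compose)
    next
      case False
      then show ?thesis
        by (simp add: \<theta>_def adj_op_eq)
    qed
  qed
  ultimately have "star_isomorphism D (linf_sum ?I orbit) \<theta>"
    unfolding star_isomorphism_def by blast
  then show ?thesis
    unfolding atomic_def using closed_csubspace_family by blast
qed

end

theorem (in normal_expectation) atomic_range: "atomic D"
proof -
  obtain M where M: "\<forall>e\<in>M. minimal_projection e"
    "\<forall>e\<in>M. \<forall>f\<in>M. e \<noteq> f \<longrightarrow> (\<forall>a\<in>D. e o\<^sub>L a o\<^sub>L f = 0)"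
    "\<forall>g. minimal_projection g \<longrightarrow> (\<exists>e\<in>M. \<exists>a\<in>D. g o\<^sub>L a o\<^sub>L e \<noteq> 0)"
    using maximal_family by - (elim exE conjE, rule that)
  have "\<forall>e\<in>M. \<exists>u. atom e u"
    using M(1) atom_exists by blast
  from bchoice[OF this] obtain \<xi> where \<xi>: "\<forall>e\<in>M. atom e (\<xi> e)"
    by blast
  interpret atom_family D \<Psi> M \<xi>
  proof
    show "e o\<^sub>L a o\<^sub>L f = 0" if "e \<in> M" "f \<in> M" "e \<noteq> f" "a \<in> D" for e f a
      using M(2) that by simp
    show "\<exists>e\<in>M. \<exists>a\<in>D. g o\<^sub>L a o\<^sub>L e \<noteq> 0" if "minimal_projection g" for g
      using M(3) that by simp
    show "atom e (\<xi> e)" if "e \<in> M" for e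
      using \<xi> that by blast
  qed
  show ?thesis
    by (rule atomic_D)
qed

theorem proposition2p5:
  fixes A D :: "('h::complex_hilbert_space \<Rightarrow>\<^sub>L 'h) set"
    and \<Phi> :: "('h \<Rightarrow>\<^sub>L 'h) \<Rightarrow> ('h \<Rightarrow>\<^sub>L 'h)"
  assumes "subalgebra A" "closedin weak_star A" "id_blinfun \<in> A"
    and "D \<subseteq> A" "subalgebra D" "closedin weak_star D" "selfadjoint D" "id_blinfun \<in> D"
    and "\<Phi> \<in> A \<rightarrow> D"
    and "continuous_map (subtopology weak_star A) (subtopology weak_star D) \<Phi>"
    and "homomorphism_on A \<Phi>" "\<Phi> id_blinfun = id_blinfun"
    and "bimodule_map_on D A \<Phi>"
    and "\<exists>\<Psi> :: ('h \<Rightarrow>\<^sub>L 'h) \<Rightarrow> ('h \<Rightarrow>\<^sub>L 'h).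
           \<Psi> \<in> bounded_operators \<rightarrow> D \<and> linear_map_on bounded_operators \<Psi> \<and>
           (\<forall>T. positive_op T \<longrightarrow> positive_op (\<Psi> T)) \<and>
           continuous_map weak_star (subtopology weak_star D) \<Psi> \<and>
           (\<forall>a\<in>A. \<Psi> a = \<Phi> a)"
  shows "von_neumann_algebra D \<and> atomic D"
proof
  show vN: "von_neumann_algebra D"
    using assms(5-8) by (simp add: von_neumann_algebra_def)
  obtain \<Psi> :: "('h \<Rightarrow>\<^sub>L 'h) \<Rightarrow> ('h \<Rightarrow>\<^sub>L 'h)" where \<Psi>: "\<Psi> \<in> bounded_operators \<rightarrow> D"
    "linear_map_on bounded_operators \<Psi>" "\<And>T. positive_op T \<Longrightarrow> positive_op (\<Psi> T)"
    "continuous_map weak_star (subtopology weak_star D) \<Psi>" "\<And>a. a \<in> A \<Longrightarrow> \<Psi> a = \<Phi> a"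
    using assms(14) by blast
  have "\<Psi> d = d" if d: "d \<in> D" for d
  proof -
    have "\<Phi> (d o\<^sub>L id_blinfun o\<^sub>L id_blinfun) = d o\<^sub>L \<Phi> id_blinfun o\<^sub>L id_blinfun"
      using assms(13) d assms(3,8) by (simp add: bimodule_map_on_def)
    moreover have "d o\<^sub>L id_blinfun o\<^sub>L id_blinfun = d"
      by (rule blinfun_eqI) simp
    ultimately show ?thesis
      using \<Psi>(5) d assms(4,12) by auto
  qed
  then interpret normal_expectation D \<Psi>
    using vN \<Psi> by unfold_locales auto
  show "atomic D"
    by (rule atomic_range)
qed

end
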